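(* Let $\tau$ be a partition of $N$ with $\tau_1\ge2$, let $m$ be such that $\tau_1=\tau_2=\cdots=\tau_m>\tau_{m+1}$ (with $\tau_{m+1}=0$ if $m=\ell(\tau)$), and let $\alpha=(1^m,0^{N-m})$. Then $\zeta_{\alpha,T_0}$ is singular for $\kappa=-\frac{1}{h_\tau}$: its coefficients (rational functions of $\kappa$) have no pole at $\kappa=-1/h_\tau$, and its specialization at $\kappa=-1/h_\tau$ satisfies $\mathcal{D}_i\zeta_{\alpha,T_0}=0$ for all $1\le i\le N$ (with the Dunkl operators taken at $\kappa=-1/h_\tau$).
   Context: $\tau$ is a partition of $N$ with length $\ell(\tau)$; the hook-length of node $(i,j)$ is $h(i,j)=\tau_i-j+\#\{k\colon i<k\le\ell(\tau),\ j\le\tau_k\}+1$ and $h_\tau=h(1,1)=\tau_1+\ell(\tau)-1$. $\mathcal{Y}(\tau)$ is the set of reverse standard Young tableaux (fillings of the Ferrers diagram with $1,\dots,N$ decreasing along rows and columns); $c(i,T)=\operatorname{col}(i,T)-\operatorname{row}(i,T)$; $T_0\in\mathcal{Y}(\tau)$ is obtained by entering $N,N-1,\dots,1$ column by column. $V_\tau$ is the $\mathbb{R}(\kappa)$-space with basis $\mathcal{Y}(\tau)$ and representation $\tau$ of $\mathcal{S}_N$ given on $s_i=(i,i+1)$ by: $\tau(s_i)T=T$ if $i,i+1$ share a row; $-T$ if they share a column; $T^{(i)}+\frac1bT$ if $b=c(i,T)-c(i+1,T)\ge2$; $(1-\frac1{b^2})T^{(i)}+\frac1bT$ if $b\le-2$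 ($T^{(i)}$: $i,i+1$ interchanged). $\mathcal{P}_\tau=\mathcal{P}\otimes V_\tau$ with $\mathcal{S}_N$-action $w(x^\beta\otimes T)=(xw)^\beta\otimes\tau(w)T$, $(xw)_i=x_{w(i)}$. $\mathcal{D}_i(p\otimes T)=\frac{\partial p}{\partial x_i}\otimes T+\kappa\sum_{j\ne i}\frac{p(x)-p(x(i,j))}{x_i-x_j}\otimes\tau((i,j))T$; $\mathcal{U}_i(p\otimes T)=\mathcal{D}_i(x_ip\otimes T)-\kappa\sum_{j<i}p(x(i,j))\otimes\tau((i,j))T$. For $\beta\in\mathbb{N}_0^N$: $\beta^+$ is its nonincreasing rearrangement, rank $r_\beta(i)=\#\{j\colon\beta_j>\beta_i\}+\#\{j\le i\colon\beta_j=\beta_i\}$. $\beta\prec\gamma$ iff $\beta\ne\gamma$ and $\sum_{j\le i}\beta_j\le\sum_{j\le i}\gamma_j$ for all $i$; $\beta\lhd\gamma$ iff $|\beta|=|\gamma|$ and ($\beta^+\prec\gamma^+$ or ($\beta^+=\gamma^+$ and $\beta\prec\gamma$)). The nonsymmetric Jack polynomial $\zeta_{\beta,T}$ is the unique element of $\mathcal{P}_\tau$ (for indeterminate $\kappa$) of the form $x^\beta\otimes\tau(r_\beta^{-1})T+\sum_{\gamma\lhd\beta}x^\gamma\otimes t_{\beta\gamma}(\kappa)$ with $\mathcal{U}_i\zeta_{\beta,T}=(\beta_i+1+\kappa c(r_\beta(i),T))\zeta_{\beta,T}$ for all $i$. *)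

theory Defs
  imports "HOL-Computational_Algebra.Polynomial" "HOL-Computational_Algebra.Fraction_Field"
begin

text \<open>Conventions. A partition is a nat list (nonincreasing, positive parts). Variables are
  indexed 1..N; exponent vectors are functions nat => nat vanishing outside {1..N}.
  A tableau is a function from cells (row, column), 1-based, to entries, zero outside the
  diagram. An element of P_tau (over a field 'k) is a coefficient function
  F gamma S = coefficient of x^gamma (tensor) S.\<close>

type_synonym tableau = "nat \<times> nat \<Rightarrow> nat"
type_synonym expo = "nat \<Rightarrow> nat"

definition is_partition :: "nat list \<Rightarrow> nat \<Rightarrow> bool" where
  "is_partition \<tau> N \<longleftrightarrow> sorted_wrt (\<ge>) \<tau> \<and> (\<forall>k\<in>set \<tau>. 0 < k) \<and> sum_list \<tau> = N"

definition part :: "nat list \<Rightarrow> nat \<Rightarrow> nat" where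
  "part \<tau> i = (if 1 \<le> i \<and> i \<le> length \<tau> then \<tau> ! (i - 1) else 0)"

definition diagram :: "nat list \<Rightarrow> (nat \<times> nat) set" where
  "diagram \<tau> = {(i, j). 1 \<le> i \<and> i \<le> length \<tau> \<and> 1 \<le> j \<and> j \<le> part \<tau> i}"

definition hook :: "nat list \<Rightarrow> nat \<Rightarrow> nat \<Rightarrow> int" where
  "hook \<tau> i j = int (part \<tau> i) - int j
      + int (card {k. i < k \<and> k \<le> length \<tau> \<and> j \<le> part \<tau> k}) + 1"

definition is_RSYT :: "nat list \<Rightarrow> tableau \<Rightarrow> bool" where
  "is_RSYT \<tau> T \<longleftrightarrow> bij_betw T (diagram \<tau>) {1..sum_list \<tau>}
     \<and> (\<forall>c. c \<notin> diagram \<tau> \<longrightarrow> T c = 0)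
     \<and> (\<forall>i j. (i, j) \<in> diagram \<tau> \<longrightarrow> (i, j + 1) \<in> diagram \<tau> \<longrightarrow> T (i, j + 1) < T (i, j))
     \<and> (\<forall>i j. (i, j) \<in> diagram \<tau> \<longrightarrow> (i + 1, j) \<in> diagram \<tau> \<longrightarrow> T (i + 1, j) < T (i, j))"

definition RSYT :: "nat list \<Rightarrow> tableau set" where
  "RSYT \<tau> = {T. is_RSYT \<tau> T}"

definition cell_of :: "nat list \<Rightarrow> nat \<Rightarrow> tableau \<Rightarrow> nat \<times> nat" where
  "cell_of \<tau> k T = the_inv_into (diagram \<tau>) T k"

definition row :: "nat list \<Rightarrow> nat \<Rightarrow> tableau \<Rightarrow> nat" where
  "row \<tau> k T = fst (cell_of \<tau> k T)"

definition col :: "nat list \<Rightarrow> nat \<Rightarrow> tableau \<Rightarrow> nat" where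
  "col \<tau> k T = snd (cell_of \<tau> k T)"

definition content :: "nat list \<Rightarrow> nat \<Rightarrow> tableau \<Rightarrow> int" where
  "content \<tau> k T = int (col \<tau> k T) - int (row \<tau> k T)"

text \<open>T_0: enter N, N-1, ..., 1 column by column (each column top to bottom)\<close>
definition col_len :: "nat list \<Rightarrow> nat \<Rightarrow> nat" where
  "col_len \<tau> c = card {k. 1 \<le> k \<and> k \<le> length \<tau> \<and> c \<le> part \<tau> k}"

definition T0 :: "nat list \<Rightarrow> tableau" where
  "T0 \<tau> = (\<lambda>(i, j). if (i, j) \<in> diagram \<tau>
      then sum_list \<tau> - (\<Sum>c\<in>{1..<j}. col_len \<tau> c) - (i - 1) else 0)"

definition swap_entries :: "nat \<Rightarrow> tableau \<Rightarrow> tableau" where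
  "swap_entries i T = (\<lambda>c. if T c = i then i + 1 else if T c = i + 1 then i else T c)"

definition basis :: "tableau \<Rightarrow> tableau \<Rightarrow> 'k::field" where
  "basis T = (\<lambda>S. if S = T then 1 else 0)"

text \<open>the vector tau(s_i) T, as coefficient function over the basis of V_tau\<close>
definition tau_s :: "nat list \<Rightarrow> nat \<Rightarrow> tableau \<Rightarrow> tableau \<Rightarrow> 'k::field" where
  "tau_s \<tau> i T = (let b = content \<tau> i T - content \<tau> (i + 1) T in
     if row \<tau> i T = row \<tau> (i + 1) T then basis T
     else if col \<tau> i T = col \<tau> (i + 1) T then (\<lambda>S. - basis T S)
     else if 2 \<le> b then (\<lambda>S. basis (swap_entries i T) S + (1 / of_int b) * basis T S)
     else (\<lambda>S. (1 - 1 / (of_int b)^2) * basis (swap_entries i T) S + (1 / of_int b) * basis T S))"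

definition apply_s :: "nat list \<Rightarrow> nat \<Rightarrow> (tableau \<Rightarrow> 'k::field) \<Rightarrow> (tableau \<Rightarrow> 'k)" where
  "apply_s \<tau> i v = (\<lambda>S. \<Sum>T\<in>RSYT \<tau>. v T * tau_s \<tau> i T S)"

definition sw :: "nat \<Rightarrow> nat \<Rightarrow> nat \<Rightarrow> nat" where
  "sw a b = (\<lambda>k. if k = a then b else if k = b then a else k)"

definition perm_word :: "nat \<Rightarrow> (nat \<Rightarrow> nat) \<Rightarrow> nat list" where
  "perm_word N w = (SOME ws. (\<forall>a\<in>set ws. 1 \<le> a \<and> a < N)
      \<and> w = foldr (\<lambda>a f. sw a (a + 1) \<circ> f) ws id)"

definition tau_perm :: "nat list \<Rightarrow> (nat \<Rightarrow> nat) \<Rightarrow> (tableau \<Rightarrow> 'k::field) \<Rightarrow> (tableau \<Rightarrow> 'k)" where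
  "tau_perm \<tau> w = foldr (\<lambda>a g. apply_s \<tau> a \<circ> g) (perm_word (sum_list \<tau>) w) id"

definition vmap :: "nat list \<Rightarrow> (nat \<Rightarrow> nat) \<Rightarrow> (expo \<Rightarrow> tableau \<Rightarrow> 'k::field) \<Rightarrow> (expo \<Rightarrow> tableau \<Rightarrow> 'k)" where
  "vmap \<tau> w F = (\<lambda>\<gamma>. tau_perm \<tau> w (F \<gamma>))"

definition mulx :: "nat \<Rightarrow> (expo \<Rightarrow> tableau \<Rightarrow> 'k::field) \<Rightarrow> (expo \<Rightarrow> tableau \<Rightarrow> 'k)" where
  "mulx i F = (\<lambda>\<gamma> S. if 0 < \<gamma> i then F (\<gamma>(i := \<gamma> i - 1)) S else 0)"

definition dx :: "nat \<Rightarrow> (expo \<Rightarrow> tableau \<Rightarrow> 'k::field) \<Rightarrow> (expo \<Rightarrow> tableau \<Rightarrow> 'k)" where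
  "dx i F = (\<lambda>\<gamma> S. of_nat (\<gamma> i + 1) * F (\<gamma>(i := \<gamma> i + 1)) S)"

definition swapvars :: "nat \<Rightarrow> nat \<Rightarrow> (expo \<Rightarrow> tableau \<Rightarrow> 'k::field) \<Rightarrow> (expo \<Rightarrow> tableau \<Rightarrow> 'k)" where
  "swapvars i j F = (\<lambda>\<gamma> S. F (\<gamma> \<circ> sw i j) S)"

definition divdiff :: "nat \<Rightarrow> nat \<Rightarrow> (expo \<Rightarrow> tableau \<Rightarrow> 'k::field) \<Rightarrow> (expo \<Rightarrow> tableau \<Rightarrow> 'k)" where
  "divdiff i j F = (THE G. mulx i G - mulx j G = F - swapvars i j F)"

definition dunkl :: "nat list \<Rightarrow> 'k::field \<Rightarrow> nat \<Rightarrow> (expo \<Rightarrow> tableau \<Rightarrow> 'k) \<Rightarrow> (expo \<Rightarrow> tableau \<Rightarrow> 'k)" where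
  "dunkl \<tau> \<kappa> i F = (\<lambda>\<gamma> S. dx i F \<gamma> S
      + \<kappa> * (\<Sum>j\<in>{1..sum_list \<tau>} - {i}. vmap \<tau> (sw i j) (divdiff i j F) \<gamma> S))"

definition ucal :: "nat list \<Rightarrow> 'k::field \<Rightarrow> nat \<Rightarrow> (expo \<Rightarrow> tableau \<Rightarrow> 'k) \<Rightarrow> (expo \<Rightarrow> tableau \<Rightarrow> 'k)" where
  "ucal \<tau> \<kappa> i F = (\<lambda>\<gamma> S. dunkl \<tau> \<kappa> i (mulx i F) \<gamma> S
      - \<kappa> * (\<Sum>j\<in>{1..<i}. vmap \<tau> (sw i j) (swapvars i j F) \<gamma> S))"

definition expo_ok :: "nat \<Rightarrow> expo \<Rightarrow> bool" where
  "expo_ok N \<beta> \<longleftrightarrow> (\<forall>i. i \<notin> {1..N} \<longrightarrow> \<beta> i = 0)"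

definition rank :: "nat \<Rightarrow> expo \<Rightarrow> nat \<Rightarrow> nat" where
  "rank N \<beta> i = (if i \<in> {1..N}
     then card {j\<in>{1..N}. \<beta> i < \<beta> j} + card {j\<in>{1..i}. \<beta> j = \<beta> i} else i)"

definition plus_part :: "nat \<Rightarrow> expo \<Rightarrow> expo" where
  "plus_part N \<beta> = (THE \<gamma>. (\<forall>i j. 1 \<le> i \<longrightarrow> i \<le> j \<longrightarrow> j \<le> N \<longrightarrow> \<gamma> j \<le> \<gamma> i)
      \<and> expo_ok N \<gamma>
      \<and> (\<exists>\<sigma>. bij_betw \<sigma> {1..N} {1..N} \<and> (\<forall>i\<in>{1..N}. \<gamma> i = \<beta> (\<sigma> i))))"

definition dom_prec :: "nat \<Rightarrow> expo \<Rightarrow> expo \<Rightarrow> bool" where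
  "dom_prec N \<beta> \<gamma> \<longleftrightarrow> \<beta> \<noteq> \<gamma> \<and> (\<forall>i\<in>{1..N}. (\<Sum>j\<in>{1..i}. \<beta> j) \<le> (\<Sum>j\<in>{1..i}. \<gamma> j))"

definition dom_lhd :: "nat \<Rightarrow> expo \<Rightarrow> expo \<Rightarrow> bool" where
  "dom_lhd N \<beta> \<gamma> \<longleftrightarrow> (\<Sum>j\<in>{1..N}. \<beta> j) = (\<Sum>j\<in>{1..N}. \<gamma> j)
     \<and> (dom_prec N (plus_part N \<beta>) (plus_part N \<gamma>)
        \<or> (plus_part N \<beta> = plus_part N \<gamma> \<and> dom_prec N \<beta> \<gamma>))"

definition is_jack :: "nat list \<Rightarrow> 'k::field \<Rightarrow> expo \<Rightarrow> tableau \<Rightarrow> (expo \<Rightarrow> tableau \<Rightarrow> 'k) \<Rightarrow> bool" where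
  "is_jack \<tau> \<kappa> \<beta> T Z \<longleftrightarrow>
     (\<forall>\<gamma> S. Z \<gamma> S \<noteq> 0 \<longrightarrow> expo_ok (sum_list \<tau>) \<gamma> \<and> S \<in> RSYT \<tau>)
     \<and> finite {\<gamma>. \<exists>S. Z \<gamma> S \<noteq> 0}
     \<and> Z \<beta> = tau_perm \<tau> (inv (rank (sum_list \<tau>) \<beta>)) (basis T)
     \<and> (\<forall>\<gamma>. \<gamma> \<noteq> \<beta> \<longrightarrow> (\<exists>S. Z \<gamma> S \<noteq> 0) \<longrightarrow> dom_lhd (sum_list \<tau>) \<gamma> \<beta>)
     \<and> (\<forall>i\<in>{1..sum_list \<tau>}. ucal \<tau> \<kappa> i Z =
          (\<lambda>\<gamma> S. (of_nat (\<beta> i) + 1 + \<kappa> * of_int (content \<tau> (rank (sum_list \<tau>) \<beta> i) T)) * Z \<gamma> S))"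

type_synonym ratfun = "real poly fract"

definition kappa :: ratfun where
  "kappa = Fract [:0, 1:] 1"

definition zeta :: "nat list \<Rightarrow> expo \<Rightarrow> tableau \<Rightarrow> (expo \<Rightarrow> tableau \<Rightarrow> ratfun)" where
  "zeta \<tau> \<beta> T = (THE Z. is_jack \<tau> kappa \<beta> T Z)"

definition no_pole :: "real \<Rightarrow> ratfun \<Rightarrow> bool" where
  "no_pole a r \<longleftrightarrow> (\<exists>p q. poly q a \<noteq> 0 \<and> r = Fract p q)"

definition eval_at :: "real \<Rightarrow> ratfun \<Rightarrow> real" where
  "eval_at a r = (THE v. \<exists>p q. poly q a \<noteq> 0 \<and> r = Fract p q \<and> v = poly p a / poly q a)"

end

(* All exponents below (1^m, 0^(N-m)) in the dominance order are 0/1 vectors, so only multilinear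
   polynomials matter. On these, U_i = 1 + x_i D_i + kappa om_i with om_i the diagonal Jucys-Murphy
   element (the sum of the transpositions (i j), j > i), and U_i s_i = s_i U_(i+1) + kappa. Hence, if
   F has spectral vector xi, then s_i F + b F with b = kappa / (xi_(i+1) - xi_i) has the spectral
   vector with xi_i and xi_(i+1) interchanged. Starting from x^(0..0 1..1) this constructs the Jack
   polynomials step by step; the denominators are 1 + kappa c with |c| < h, which do not vanish at
   kappa = -1/h, and the same bound makes the spectrum determine the eigenfunction both for
   indeterminate kappa and at -1/h.

   Where the exponent is zero, s_i acts on the Jack polynomials of a fixed exponent as it does on
   tableaux, so om_i acts by a content and D_i vanishes: D_j zeta = 0 for j > m. For D_m move the last
   box of the exponent to position k: if f_k = s_k f_(k+1) + b f_(k+1), then D_k f_k vanishes as soon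
   as D_(k+1) f_(k+1) does, or b^2 = 1. At kappa = -1/h the latter occurs for k = N - l, where the
   relevant contents are those of the corner and of the foot of the first column. Finally zeta is
   antisymmetric in the first m variables, which gives D_i zeta = 0 for i < m. *)
theory Submission
  imports Defs "HOL-Combinatorics.Permutations"
begin

text \<open>Several of the given notions are choices: \<open>tau_perm\<close> follows a word picked
  by \<open>SOME\<close>, while \<open>divdiff\<close>, \<open>plus_part\<close>,
  \<open>zeta\<close> and \<open>eval_at\<close> are \<open>THE\<close> descriptions. Each has to be
  pinned down before anything can be computed. For \<open>tau_perm\<close> this means checking the
  Coxeter relations for \<open>apply_s\<close> and solving the word problem of the symmetric group;
  for \<open>divdiff\<close>, injectivity of multiplication by x_i - x_j; for \<open>zeta\<close>,
  uniqueness of an eigenfunction with given spectrum. The second obstacle is that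
  \<open>zeta\<close> lives over \<open>ratfun\<close> while the claim concerns a real number.
  Identities between rational functions are not specialized. The construction is carried out over an
  arbitrary field of characteristic zero and run side by side over \<open>ratfun\<close> and at
  -1/h, so that one Jack polynomial is the specialization of the other, and the vanishing of the
  Dunkl operators is proved for the real one only. Dominance is replaced by a linear weight on
  exponents: the leading exponent is the one of least weight, and at such an exponent U_i involves a
  single coefficient of the polynomial.\<close>

instance fract :: ("{idom,ring_char_0}") field_char_0
proof
  show "inj (of_nat :: nat \<Rightarrow> 'a fract)"
    by (auto simp: inj_on_def of_nat_fract eq_fract)
qed

section \<open>Partitions, fillings and the relative position of consecutive entries\<close>

locale shape =
  fixes \<tau> :: "nat list"
  assumes partition: "is_partition \<tau> (sum_list \<tau>)"
begin

abbreviation N :: nat where "N \<equiv> sum_list \<tau>"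

abbreviation D :: "(nat \<times> nat) set" where "D \<equiv> diagram \<tau>"

lemma part_antimono:
  assumes "1 \<le> i" "i \<le> i'"
  shows "part \<tau> i' \<le> part \<tau> i"
proof (cases "i' \<le> length \<tau> \<and> i < i'")
  case True
  then have "i - 1 < i' - 1" "i' - 1 < length \<tau>" using assms by auto
  then have "\<tau> ! (i' - 1) \<le> \<tau> ! (i - 1)"
    using partition sorted_wrt_nth_less unfolding is_partition_def by fastforce
  then show ?thesis using True assms by (simp add: part_def)
next
  case False
  then show ?thesis using assms by (cases "i = i'") (auto simp: part_def)
qed

lemma diagram_down:
  assumes "(i, j) \<in> D" "1 \<le> i'" "i' \<le> i" "1 \<le> j'" "j' \<le> j"
  shows "(i', j') \<in> D"
  using assms part_antimono[of i' i] by (auto simp: diagram_def)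

lemma diagram_pos: "(i, j) \<in> D \<Longrightarrow> 1 \<le> i \<and> 1 \<le> j"
  by (auto simp: diagram_def)

lemma diagram_Sigma: "D = (SIGMA i:{1..length \<tau>}. {1..part \<tau> i})"
  by (auto simp: diagram_def)

lemma finite_diagram [simp]: "finite D"
  by (auto simp: diagram_Sigma)

lemma card_diagram: "card D = N"
proof -
  have "card D = (\<Sum>i\<in>{1..length \<tau>}. part \<tau> i)"
    by (simp add: diagram_Sigma)
  also have "\<dots> = (\<Sum>i<length \<tau>. \<tau> ! i)"
    by (rule sum.reindex_bij_witness[of _ Suc "\<lambda>i. i - 1"]) (auto simp: part_def)
  finally show ?thesis by (simp add: sum_list_sum_nth atLeast0LessThan)
qed

text \<open>Monotonicity is left out on purpose: interchanging two entries may destroy it, yet the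
  relations between the generators are checked by evaluating at all iterated interchanges of a
  standard tableau.\<close>

definition fill :: "tableau \<Rightarrow> bool" where
  "fill T \<longleftrightarrow> bij_betw T D {1..N} \<and> (\<forall>c. c \<notin> D \<longrightarrow> T c = 0)"

lemma RSYT_fill: "T \<in> RSYT \<tau> \<Longrightarrow> fill T"
  by (auto simp: RSYT_def is_RSYT_def fill_def)

lemma cell_of_fill:
  assumes "fill T" "k \<in> {1..N}"
  shows "cell_of \<tau> k T \<in> D" "T (cell_of \<tau> k T) = k"
  using assms the_inv_into_into[of T D k] f_the_inv_into_f[of T D k]
  by (auto simp: fill_def bij_betw_def cell_of_def)

lemma cell_of_eq:
  assumes "fill T" "c \<in> D" "T c = k"
  shows "cell_of \<tau> k T = c"
  using assms the_inv_into_f_f[of T D c] by (auto simp: fill_def bij_betw_def cell_of_def)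

lemma fill_range: "fill T \<Longrightarrow> c \<in> D \<Longrightarrow> T c \<in> {1..N}"
  by (auto simp: fill_def bij_betw_def)

lemma fill_inj: "fill T \<Longrightarrow> c \<in> D \<Longrightarrow> d \<in> D \<Longrightarrow> T c = T d \<Longrightarrow> c = d"
  by (auto simp: fill_def bij_betw_def inj_on_def)

lemma RSYT_row_less:
  assumes "T \<in> RSYT \<tau>" "(i, j + d) \<in> D" "0 < d" "1 \<le> j"
  shows "T (i, j + d) < T (i, j)"
  using assms(2,3)
proof (induction d)
  case (Suc d)
  have d: "(i, j + d) \<in> D" using diagram_down[OF Suc.prems(1)] diagram_pos[OF Suc.prems(1)] assms(4)
    by auto
  then have "T (i, j + d + 1) < T (i, j + d)"
    using assms(1) Suc.prems by (auto simp: RSYT_def is_RSYT_def)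
  then show ?case using Suc.IH d by (cases "d = 0") auto
qed simp

lemma RSYT_col_less:
  assumes "T \<in> RSYT \<tau>" "(i + d, j) \<in> D" "0 < d" "1 \<le> i"
  shows "T (i + d, j) < T (i, j)"
  using assms(2,3)
proof (induction d)
  case (Suc d)
  have d: "(i + d, j) \<in> D" using diagram_down[OF Suc.prems(1)] diagram_pos[OF Suc.prems(1)] assms(4)
    by auto
  then have "T (i + d + 1, j) < T (i + d, j)"
    using assms(1) Suc.prems by (auto simp: RSYT_def is_RSYT_def)
  then show ?case using Suc.IH d by (cases "d = 0") auto
qed simp

lemma RSYT_less:
  assumes "T \<in> RSYT \<tau>" "(i, j) \<in> D" "1 \<le> i'" "i' \<le> i" "1 \<le> j'" "j' \<le> j" "(i', j') \<noteq> (i, j)"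
  shows "T (i, j) < T (i', j')"
proof -
  obtain a b where ab: "i = i' + a" "j = j' + b" using assms(4,6) le_Suc_ex by blast
  have "(i', j) \<in> D" using diagram_down[OF assms(2), of i' j] assms by auto
  then have "b = 0 \<or> T (i', j) < T (i', j')" using RSYT_row_less[OF assms(1), of i' j' b] ab assms by auto
  moreover have "a = 0 \<or> T (i, j) < T (i', j)" using RSYT_col_less[OF assms(1), of i' a j] ab assms by auto
  ultimately show ?thesis using ab assms(7) by auto
qed

text \<open>No third cell fits into the rectangle from the cell of \<open>k + 1\<close> down and
  right to the cell of \<open>k\<close>, since its entry would lie strictly between \<open>k\<close>
  and \<open>k + 1\<close>. So two such cells in one row or column are adjacent, and they are never
  in strictly diagonal position.\<close>

lemma consecutive_cells:
  assumes T: "T \<in> RSYT \<tau>" and k: "1 \<le> k" "k < N"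
  obtains (row) "row \<tau> k T = row \<tau> (k+1) T" "col \<tau> k T = col \<tau> (k+1) T + 1"
  | (col) "col \<tau> k T = col \<tau> (k+1) T" "row \<tau> k T = row \<tau> (k+1) T + 1"
  | (ne) "row \<tau> k T < row \<tau> (k+1) T" "col \<tau> (k+1) T < col \<tau> k T"
  | (sw) "row \<tau> (k+1) T < row \<tau> k T" "col \<tau> k T < col \<tau> (k+1) T"
proof -
  obtain r c where rc: "cell_of \<tau> k T = (r, c)" by fastforce
  obtain r' c' where rc': "cell_of \<tau> (k+1) T = (r', c')" by fastforce
  have f: "fill T" using T by (rule RSYT_fill)
  have in_D: "(r, c) \<in> D" "(r', c') \<in> D" and T_eq: "T (r, c) = k" "T (r', c') = k + 1"
    using cell_of_fill[OF f, of k] cell_of_fill[OF f, of "k+1"] k rc rc' by auto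
  have pos: "1 \<le> r" "1 \<le> c" "1 \<le> r'" "1 \<le> c'" using in_D diagram_pos by blast+
  have neq: "(r, c) \<noteq> (r', c')" using T_eq by auto
  have 1: "\<not> (r \<le> r' \<and> c \<le> c')"
    using RSYT_less[OF T in_D(2), of r c] pos neq T_eq by auto
  have 2: False if "r' \<le> x" "x \<le> r" "c' \<le> y" "y \<le> c" "(x, y) \<noteq> (r, c)" "(x, y) \<noteq> (r', c')" for x y
  proof -
    have xy: "(x, y) \<in> D" using diagram_down[OF in_D(1), of x y] that pos by auto
    show False using RSYT_less[OF T in_D(1), of x y] RSYT_less[OF T xy, of r' c'] T_eq that pos by auto
  qed
  have 3: "row \<tau> k T = r" "row \<tau> (k+1) T = r'" "col \<tau> k T = c" "col \<tau> (k+1) T = c'"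
    using rc rc' by (auto simp: row_def col_def)
  consider "r = r'" "c' < c" | "c = c'" "r' < r" | "r < r'" "c' < c" | "r' < r" "c < c'" | "r' < r" "c' < c"
    using 1 by linarith
  then show thesis
  proof cases
    case 1
    have "c = c' + 1" using 2[of r "c' + 1"] 1 by force
    then show ?thesis using row 1 3 by simp
  next
    case b: 2
    have "r = r' + 1" using 2[of "r' + 1" c] b by force
    then show ?thesis using col b 3 by simp
  next
    case 5
    then show ?thesis using 2[of r' c] by simp
  qed (use ne sw 3 in auto)
qed

text \<open>If \<open>k\<close> and \<open>k + 2\<close> were on one diagonal, the two other corners
  of the rectangle they span would both carry \<open>k + 1\<close>. This keeps the third denominator
  of the braid relation from vanishing.\<close>

lemma content_gap_two:
  assumes T: "T \<in> RSYT \<tau>" and k: "1 \<le> k" "k + 2 \<le> N"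
  shows "content \<tau> k T \<noteq> content \<tau> (k + 2) T"
proof
  assume eq: "content \<tau> k T = content \<tau> (k + 2) T"
  obtain r c where rc: "cell_of \<tau> k T = (r, c)" by fastforce
  obtain r' c' where rc': "cell_of \<tau> (k+2) T = (r', c')" by fastforce
  have f: "fill T" using T by (rule RSYT_fill)
  have in_D: "(r, c) \<in> D" "(r', c') \<in> D" and T_eq: "T (r, c) = k" "T (r', c') = k + 2"
    using cell_of_fill[OF f, of k] cell_of_fill[OF f, of "k+2"] k rc rc' by auto
  have pos: "1 \<le> r" "1 \<le> c" "1 \<le> r'" "1 \<le> c'" using in_D diagram_pos by blast+
  have neq: "(r, c) \<noteq> (r', c')" using T_eq by auto
  have "int c - int r = int c' - int r'" using eq rc rc' by (simp add: content_def row_def col_def)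
  then consider "r < r'" "c < c'" | "r' < r" "c' < c" using neq by (cases "r < r'") auto
  then show False
  proof cases
    case 1
    then show False using RSYT_less[OF T in_D(2), of r c] T_eq pos by auto
  next
    case 2
    have d: "(r', c) \<in> D" "(r, c') \<in> D" using diagram_down[OF in_D(1)] 2 pos by auto
    have "T (r', c) = k + 1" "T (r, c') = k + 1"
      using RSYT_less[OF T in_D(1), of r' c] RSYT_less[OF T d(1), of r' c']
        RSYT_less[OF T in_D(1), of r c'] RSYT_less[OF T d(2), of r' c'] 2 pos T_eq by auto
    then show False using fill_inj[OF f d] 2 by simp
  qed
qed

section \<open>Interchanging consecutive entries; the simple transpositions on V_tau\<close>

lemma swap_entries_twice [simp]: "swap_entries k (swap_entries k T) = T"
  by (auto simp: swap_entries_def)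

lemma swap_entries_sw: "swap_entries k T = sw k (k+1) \<circ> T"
  by (auto simp: swap_entries_def sw_def)

lemma fill_swap:
  assumes "fill T" "1 \<le> k" "k < N"
  shows "fill (swap_entries k T)"
proof -
  have "bij_betw (sw k (k+1)) {1..N} {1..N}"
    by (rule bij_betwI[where g = "sw k (k+1)"]) (use assms in \<open>auto simp: sw_def\<close>)
  then have "bij_betw (swap_entries k T) D {1..N}"
    using assms bij_betw_trans unfolding swap_entries_sw fill_def by blast
  then show ?thesis using assms by (auto simp: fill_def swap_entries_def)
qed

lemma cell_of_swap:
  assumes "fill T" "1 \<le> k" "k < N" "j \<in> {1..N}"
  shows "cell_of \<tau> j (swap_entries k T) = cell_of \<tau> (sw k (k+1) j) T"
proof -
  have "sw k (k+1) j \<in> {1..N}" using assms by (auto simp: sw_def)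
  then show ?thesis
    using cell_of_fill[OF assms(1)] by (intro cell_of_eq fill_swap assms) (auto simp: swap_entries_sw sw_def)
qed

lemma content_swap:
  assumes "fill T" "1 \<le> k" "k < N" "j \<in> {1..N}"
  shows "content \<tau> j (swap_entries k T) = content \<tau> (sw k (k+1) j) T"
  using cell_of_swap[OF assms] by (simp add: content_def row_def col_def)

text \<open>Only the comparison between \<open>k\<close> and \<open>k + 1\<close> is reversed, and
  standardness never compares cells that share neither row nor column.\<close>

lemma RSYT_swap:
  assumes T: "T \<in> RSYT \<tau>" and k: "1 \<le> k" "k < N"
    and ne: "row \<tau> k T \<noteq> row \<tau> (k+1) T" "col \<tau> k T \<noteq> col \<tau> (k+1) T"
  shows "swap_entries k T \<in> RSYT \<tau>"
proof -
  have f: "fill T" using T by (rule RSYT_fill)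
  have mono: "swap_entries k T d < swap_entries k T c"
    if "c \<in> D" "d \<in> D" "T d < T c" "fst c = fst d \<or> snd c = snd d" for c d
  proof -
    have "\<not> (T d = k \<and> T c = k + 1)"
    proof
      assume a: "T d = k \<and> T c = k + 1"
      then have "cell_of \<tau> k T = d" "cell_of \<tau> (k+1) T = c" using cell_of_eq[OF f] that by auto
      then show False using ne that by (auto simp: row_def col_def)
    qed
    then show ?thesis using that by (auto simp: swap_entries_def)
  qed
  show ?thesis
    using fill_swap[OF f k] T
    by (auto simp: RSYT_def is_RSYT_def fill_def intro!: mono)
qed

text \<open>The axial distance of Young's seminormal form, that is, the number \<open>b\<close> in
  \<open>tau_s\<close>.\<close>

definition bc :: "nat \<Rightarrow> tableau \<Rightarrow> int" where
  "bc k T = content \<tau> k T - content \<tau> (k + 1) T"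

lemma bc_swap:
  assumes "fill T" "1 \<le> k" "k < N"
  shows "bc k (swap_entries k T) = - bc k T"
  using assms by (simp add: bc_def content_swap sw_def)

lemma bc_cases:
  assumes "T \<in> RSYT \<tau>" "1 \<le> k" "k < N"
  obtains (row) "bc k T = 1" "row \<tau> k T = row \<tau> (k+1) T"
  | (col) "bc k T = -1" "row \<tau> k T \<noteq> row \<tau> (k+1) T" "col \<tau> k T = col \<tau> (k+1) T"
  | (far) "2 \<le> \<bar>bc k T\<bar>" "swap_entries k T \<in> RSYT \<tau>" "row \<tau> k T \<noteq> row \<tau> (k+1) T" "col \<tau> k T \<noteq> col \<tau> (k+1) T"
  using assms
proof (cases rule: consecutive_cells)
  case row
  then show ?thesis using that(1) by (simp add: bc_def content_def)
next
  case col
  then show ?thesis using that(2) by (simp add: bc_def content_def)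
next
  case ne
  then show ?thesis using that(3) RSYT_swap[OF assms] by (simp add: bc_def content_def)
next
  case sw
  then show ?thesis using that(3) RSYT_swap[OF assms] by (simp add: bc_def content_def)
qed

lemma finite_RSYT [simp]: "finite (RSYT \<tau>)"
proof (rule finite_subset)
  show "RSYT \<tau> \<subseteq> {f. \<forall>x. (x \<in> D \<longrightarrow> f x \<in> {1..N}) \<and> (x \<notin> D \<longrightarrow> f x = 0)}"
    using RSYT_fill fill_range by (auto simp: fill_def)
qed (rule finite_set_of_finite_funs; simp)

text \<open>The coefficient with which \<open>v (swap_entries k S)\<close> enters \<open>apply_s \<tau> k v S\<close>, where \<open>b\<close> is the
  content difference of the target \<open>S\<close>, not of the source tableau. It vanishes for adjacent cells,
  where \<open>swap_entries k S\<close> is not standard.\<close>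
definition gc :: "int \<Rightarrow> 'k::field_char_0" where
  "gc b = (if b \<le> -2 then 1 else if 2 \<le> b then 1 - 1 / (of_int b)\<^sup>2 else 0)"

text \<open>Membership in V_tau. Coefficient functions are defined on every \<open>tableau\<close>,
  and \<open>apply_s\<close> discards all values outside \<open>RSYT \<tau>\<close>, so the group
  relations can hold only for such \<open>v\<close>.\<close>

definition supp :: "(tableau \<Rightarrow> 'k::field) \<Rightarrow> bool" where
  "supp v \<longleftrightarrow> (\<forall>S. v S \<noteq> 0 \<longrightarrow> S \<in> RSYT \<tau>)"

lemma supp_eqI:
  "supp v \<Longrightarrow> supp w \<Longrightarrow> (\<And>S. S \<in> RSYT \<tau> \<Longrightarrow> v S = w S) \<Longrightarrow> v = w"
  unfolding supp_def by (rule ext) metis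

lemma supp_outside: "supp v \<Longrightarrow> S \<notin> RSYT \<tau> \<Longrightarrow> v S = 0"
  by (auto simp: supp_def)

text \<open>One formula for all four clauses of \<open>tau_s\<close>: for adjacent cells 1/b is 1 or
  -1 and \<open>gc\<close> vanishes. The argument of \<open>gc\<close> is \<open>- bc k T\<close>
  because it refers to the target \<open>swap_entries k T\<close>.\<close>

lemma tau_s_eq:
  assumes "T \<in> RSYT \<tau>" "1 \<le> k" "k < N"
  shows "(tau_s \<tau> k T S :: 'k::field_char_0) = 
    (if S = T then 1 / of_int (bc k T) else if S = swap_entries k T then gc (- bc k T) else 0)"
proof -
  have ne: "swap_entries k T \<noteq> T"
    using cell_of_fill[OF RSYT_fill[OF assms(1)], of k] assms 
    by (auto simp: swap_entries_def dest!: fun_cong[of _ _ "cell_of \<tau> k T"])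
  from assms show ?thesis
    unfolding tau_s_def Let_def bc_def[symmetric]
    by (cases rule: bc_cases) (use ne in \<open>auto simp: basis_def gc_def\<close>)
qed

lemma apply_s_supp:
  assumes "1 \<le> k" "k < N"
  shows "supp (apply_s \<tau> k v :: tableau \<Rightarrow> 'k::field_char_0)"
  unfolding supp_def
proof (intro allI impI)
  fix S assume "apply_s \<tau> k v S \<noteq> 0"
  then obtain T where T: "T \<in> RSYT \<tau>" "(tau_s \<tau> k T S :: 'k) \<noteq> 0"
    unfolding apply_s_def by (metis (no_types, lifting) mult_zero_right sum.neutral)
  show "S \<in> RSYT \<tau>"
    by (rule bc_cases[OF T(1) assms])
      (use T assms in \<open>auto simp: tau_s_eq gc_def split: if_splits\<close>)
qed

text \<open>Valid for a nonstandard \<open>S\<close> as well: then \<open>v S\<close> is zero, and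
  if \<open>swap_entries k S\<close> is standard, it has \<open>k\<close> and \<open>k + 1\<close>
  in adjacent cells, where \<open>gc\<close> vanishes. Iterating the formula needs this
  generality.\<close>

lemma apply_s_eq:
  assumes v: "supp v" and S: "fill S" and k: "1 \<le> k" "k < N"
  shows "apply_s \<tau> k v S = v S / of_int (bc k S) + gc (bc k S) * (v (swap_entries k S) :: 'k::field_char_0)"
proof -
  let ?S = "swap_entries k S"
  have ne: "?S \<noteq> S"
    using cell_of_fill[OF S, of k] k 
    by (auto simp: swap_entries_def dest!: fun_cong[of _ _ "cell_of \<tau> k S"])
  have "apply_s \<tau> k v S = (\<Sum>T\<in>RSYT \<tau>. (if T = S then v S / of_int (bc k S) else 0)
       + (if T = ?S then gc (bc k S) * v ?S else 0))"
    unfolding apply_s_def using ne k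
    by (intro sum.cong refl) (auto simp: tau_s_eq bc_swap[OF S k])
  also have "\<dots> = v S / of_int (bc k S) + gc (bc k S) * v ?S"
    using supp_outside[OF v] by (auto simp: sum.distrib sum.delta')
  finally show ?thesis .
qed

end

section \<open>The word problem of the symmetric group\<close>

text \<open>Rewriting of words in the Coxeter generators. Only the directions needed to reach the normal
  forms are included, so the relation is not symmetric.\<close>
inductive weq :: "nat list \<Rightarrow> nat list \<Rightarrow> bool" where
  weq_refl: "weq u u"
| weq_trans: "weq u v \<Longrightarrow> weq v w \<Longrightarrow> weq u w"
| weq_append: "weq u v \<Longrightarrow> weq (x @ u @ y) (x @ v @ y)"
| weq_square: "weq [a, a] []"
| weq_commute: "a + 1 < b \<or> b + 1 < a \<Longrightarrow> weq [a, b] [b, a]"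
| weq_braid: "weq [a + 1, a, a + 1] [a, a + 1, a]"

declare weq_trans [trans]

lemma weq_Cons: "weq u v \<Longrightarrow> weq (a # u) (a # v)"
  using weq_append[of u v "[a]" "[]"] by simp

lemma weq_pre: "weq u v \<Longrightarrow> weq (x @ u) (x @ v)"
  using weq_append[of u v x "[]"] by simp

lemma weq_post: "weq u v \<Longrightarrow> weq (u @ y) (v @ y)"
  using weq_append[of u v "[]" y] by simp

lemma weq_commute_list:
  "(\<And>b. b \<in> set u \<Longrightarrow> a + 1 < b \<or> b + 1 < a) \<Longrightarrow> weq (a # u) (u @ [a])"
proof (induction u)
  case (Cons b u)
  have "weq ([a, b] @ u) ([b, a] @ u)" by (intro weq_post weq_commute) (use Cons.prems in simp)
  moreover have "weq (b # a # u) (b # u @ [a])" by (intro weq_Cons Cons.IH) (use Cons.prems in simp)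
  ultimately show ?case using weq_trans[of "a # b # u" "b # a # u"] by simp
qed (simp add: weq_refl)

lemma weq_set: "weq u v \<Longrightarrow> set v \<subseteq> set u"
  by (induction rule: weq.induct) auto

text \<open>The words \<open>[k..<n+1]\<close> represent the cosets of S_n in S_(n+1). Multiplying
  one on the left by the generator \<open>a\<close> shortens it (a = k), lengthens it (a + 1 = k),
  or lets the generator through, unchanged if a + 1 < k and lowered by one if k < a.\<close>

lemma weq_cycle:
  assumes "1 \<le> k" "k \<le> n + 1" "1 \<le> a" "a \<le> n" "set v \<subseteq> {1..<n}"
  shows "\<exists>k' v'. 1 \<le> k' \<and> k' \<le> n + 1 \<and> set v' \<subseteq> {1..<n} \<and> weq (a # [k..<n+1] @ v) ([k'..<n+1] @ v')"
proof -
  consider "a = k" | "a + 1 = k" | "a + 1 < k" | "k < a" by linarith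
  then show ?thesis
  proof cases
    case 1
    then have "a # [k..<n+1] @ v = [a, a] @ [k+1..<n+1] @ v" using assms by (simp add: upt_conv_Cons del: upt_Suc)
    moreover have "weq ([a, a] @ [k+1..<n+1] @ v) ([] @ [k+1..<n+1] @ v)"
      by (intro weq_post weq_square)
    ultimately show ?thesis using assms 1 by (intro exI[of _ "k+1"] exI[of _ v]) auto
  next
    case 2
    then have "weq (a # [k..<n+1] @ v) ([a..<n+1] @ v)" using weq_refl[of "[a..<n+1] @ v"] assms by (simp add: upt_conv_Cons del: upt_Suc)
    then show ?thesis using assms 2 by (intro exI[of _ a] exI[of _ v]) (simp del: upt_Suc)
  next
    case 3
    have "weq (a # [k..<n+1]) ([k..<n+1] @ [a])" by (rule weq_commute_list) (use 3 in auto)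
    from weq_post[OF this, of v] show ?thesis using assms 3
      by (intro exI[of _ k] exI[of _ "a # v"]) auto
  next
    case 4
    \<comment> \<open>The letter \<open>a\<close> commutes to the right until it meets
      \<open>b, b + 1\<close>; the braid relation turns it into a \<open>b\<close> behind them,
      which commutes with the rest.\<close>
    define b where "b = a - 1"
    have ab: "a = b + 1" "k \<le> b" "b < n" using 4 assms by (auto simp: b_def)
    have "[k..<n+1] = [k..<b] @ [b..<n+1]"
      using upt_add_eq_append[of k b "n+1-b"] ab by (simp del: upt_Suc)
    then have split: "[k..<n+1] = [k..<b] @ [b, b + 1] @ [b+2..<n+1]"
      using ab by (simp add: upt_conv_Cons del: upt_Suc)
    have 1: "weq (a # [k..<b]) ([k..<b] @ [a])" by (rule weq_commute_list) (use ab in auto)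
    have 2: "weq (b # [b+2..<n+1]) ([b+2..<n+1] @ [b])" by (rule weq_commute_list) (use ab in auto)
    have "weq (a # [k..<n+1] @ v) ([k..<b] @ [b + 1, b, b + 1] @ [b+2..<n+1] @ v)"
      using weq_post[OF 1, of "[b, b + 1] @ [b+2..<n+1] @ v"] split ab by (simp del: upt_Suc)
    also have "weq \<dots> ([k..<b] @ [b, b + 1, b] @ [b+2..<n+1] @ v)"
      by (intro weq_append weq_braid)
    also have "weq \<dots> ([k..<n+1] @ b # v)"
      using weq_append[OF 2, of "[k..<b] @ [b, b + 1]" v] split by (simp del: upt_Suc)
    finally show ?thesis using assms ab
      by (intro exI[of _ k] exI[of _ "b # v"]) auto
  qed
qed

lemma weq_normal_form:
  assumes "set u \<subseteq> {1..n}"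
  shows "\<exists>k v. 1 \<le> k \<and> k \<le> n + 1 \<and> set v \<subseteq> {1..<n} \<and> weq u ([k..<n+1] @ v)"
  using assms
proof (induction u)
  case Nil
  show ?case by (intro exI[of _ "n+1"] exI[of _ "[]"]) (simp add: weq_refl)
next
  case (Cons a u)
  then obtain k v where kv: "1 \<le> k" "k \<le> n + 1" "set v \<subseteq> {1..<n}" "weq u ([k..<n+1] @ v)" by auto
  obtain k' v' where "1 \<le> k'" "k' \<le> n + 1" "set v' \<subseteq> {1..<n}"
    "weq (a # [k..<n+1] @ v) ([k'..<n+1] @ v')"
    using weq_cycle[of k n a v] kv Cons.prems by auto
  then show ?case using weq_trans[OF weq_Cons[OF kv(4)]] by blast
qed

definition word_act :: "(nat \<Rightarrow> 'a \<Rightarrow> 'a) \<Rightarrow> nat list \<Rightarrow> 'a \<Rightarrow> 'a" where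
  "word_act f ws = foldr (\<lambda>a g. f a \<circ> g) ws id"

definition word_perm :: "nat list \<Rightarrow> nat \<Rightarrow> nat" where
  "word_perm ws = foldr (\<lambda>a g. sw a (a + 1) \<circ> g) ws id"

lemma word_act_simps [simp]:
  "word_act f [] x = x" "word_act f (a # u) x = f a (word_act f u x)"
  by (simp_all add: word_act_def)

lemma word_act_append [simp]: "word_act f (u @ v) x = word_act f u (word_act f v x)"
  by (induction u) simp_all

lemma word_perm_simps [simp]:
  "word_perm [] = id" "word_perm (a # u) = sw a (a + 1) \<circ> word_perm u"
  by (simp_all add: word_perm_def)

lemma word_perm_append [simp]: "word_perm (u @ v) = word_perm u \<circ> word_perm v"
  by (induction u) (simp_all add: comp_assoc)

lemma word_act_closed:
  assumes "\<And>a x. a \<in> L \<Longrightarrow> x \<in> X \<Longrightarrow> f a x \<in> X" "set u \<subseteq> L" "x \<in> X"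
  shows "word_act f u x \<in> X"
  using assms(2) by (induction u) (auto simp: assms)

text \<open>The relations are required only on an invariant set \<open>X\<close> and for letters in
  \<open>L\<close>, because \<open>apply_s\<close> satisfies them only on supported vectors and for
  indices below \<open>N\<close>. Rewriting introduces no new letters (\<open>weq_set\<close>), so
  it stays inside \<open>L\<close>.\<close>

lemma word_act_weq:
  assumes closed: "\<And>a x. a \<in> L \<Longrightarrow> x \<in> X \<Longrightarrow> f a x \<in> X"
    and square: "\<And>a x. a \<in> L \<Longrightarrow> x \<in> X \<Longrightarrow> f a (f a x) = x"
    and commute: "\<And>a b x. a \<in> L \<Longrightarrow> b \<in> L \<Longrightarrow> a + 1 < b \<or> b + 1 < a \<Longrightarrow> x \<in> X \<Longrightarrow> f a (f b x) = f b (f a x)"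
    and braid: "\<And>a x. a \<in> L \<Longrightarrow> a + 1 \<in> L \<Longrightarrow> x \<in> X \<Longrightarrow> f (a+1) (f a (f (a+1) x)) = f a (f (a+1) (f a x))"
    and "weq u v" "set u \<subseteq> L" "x \<in> X"
  shows "word_act f u x = word_act f v x"
  using assms(5-)
proof (induction arbitrary: x rule: weq.induct)
  case (weq_trans u v w)
  then show ?case using weq_set[OF weq_trans.hyps(1)] by auto
next
  case (weq_append u v w y)
  then show ?case using word_act_closed[of L X f y x] closed by auto
qed (use assms in \<open>auto\<close>)

lemma sw_square [simp]: "sw a b (sw a b x) = x"
  by (auto simp: sw_def)

lemma word_perm_weq:
  assumes "weq u v"
  shows "word_perm u = word_perm v"
proof -
  have "word_act (\<lambda>a p. sw a (a+1) \<circ> p) u id = word_act (\<lambda>a p. sw a (a+1) \<circ> p) v id"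
    by (rule word_act_weq[OF _ _ _ _ assms, of UNIV UNIV]) (auto simp: sw_def fun_eq_iff)
  moreover have "word_act (\<lambda>a p. sw a (a+1) \<circ> p) w id = word_perm w" for w
    by (induction w) auto
  ultimately show ?thesis by simp
qed

lemma word_perm_fix: "set u \<subseteq> {1..<n} \<Longrightarrow> n < x \<Longrightarrow> word_perm u x = x"
  by (induction u) (auto simp: sw_def)

lemma word_perm_upt: "k \<le> n + 1 \<Longrightarrow> word_perm [k..<n+1] (n + 1) = k"
proof (induction k rule: inc_induct)
  case (step k)
  then have "[k..<n+1] = k # [Suc k..<n+1]" by (simp add: upt_conv_Cons del: upt_Suc)
  then show ?case using step by (simp add: sw_def)
qed simp

lemma sw_transpose: "sw a b = transpose a b"
  by (auto simp: sw_def transpose_def)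

lemma bij_word_perm: "bij (word_perm u)"
proof (induction u)
  case (Cons a u)
  show ?case unfolding word_perm_simps sw_transpose by (intro bij_comp Cons bij_transpose)
qed (simp only: word_perm_simps bij_id)

text \<open>The coset word in the normal form is determined by the image of the last point, which is
  \<open>k\<close>; hence it is the same for both words and cancels, and the rest is shorter by one
  generator. The conclusion is a common reduct because \<open>weq\<close> is not symmetric.\<close>

lemma weq_of_word_perm_eq:
  "set u \<subseteq> {1..n} \<Longrightarrow> set u' \<subseteq> {1..n} \<Longrightarrow> word_perm u = word_perm u' \<Longrightarrow> \<exists>v. weq u v \<and> weq u' v"
proof (induction n arbitrary: u u')
  case 0
  then show ?case using weq_refl by auto
next
  case (Suc n)
  obtain k v where v: "1 \<le> k" "k \<le> Suc n + 1" "set v \<subseteq> {1..<Suc n}" "weq u ([k..<Suc n+1] @ v)"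
    using weq_normal_form[OF Suc.prems(1)] by blast
  obtain k' v' where v': "1 \<le> k'" "k' \<le> Suc n + 1" "set v' \<subseteq> {1..<Suc n}" "weq u' ([k'..<Suc n+1] @ v')"
    using weq_normal_form[OF Suc.prems(2)] by blast
  have eq: "word_perm [k..<Suc n+1] \<circ> word_perm v = word_perm [k'..<Suc n+1] \<circ> word_perm v'"
    using word_perm_weq[OF v(4)] word_perm_weq[OF v'(4)] Suc.prems(3) unfolding word_perm_append by metis
  have fixed: "word_perm v (Suc n + 1) = Suc n + 1" "word_perm v' (Suc n + 1) = Suc n + 1"
    using v v' by (auto intro!: word_perm_fix)
  have "(word_perm [k..<Suc n+1] \<circ> word_perm v) (Suc n + 1) = k"
    using word_perm_upt[OF v(2)] fixed by (simp del: upt_Suc)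
  moreover have "(word_perm [k'..<Suc n+1] \<circ> word_perm v') (Suc n + 1) = k'"
    using word_perm_upt[OF v'(2)] fixed by (simp del: upt_Suc)
  ultimately have k: "k = k'" using eq by metis
  have "word_perm v = word_perm v'"
    using eq bij_word_perm[of "[k..<Suc n+1]"] unfolding k bij_def inj_def by (simp only: fun_eq_iff o_apply) blast
  moreover have "set v \<subseteq> {1..n}" "set v' \<subseteq> {1..n}" using v(3) v'(3) by auto
  ultimately obtain w where "weq v w" "weq v' w" using Suc.IH by blast
  then show ?case using weq_trans[OF v(4) weq_pre] weq_trans[OF v'(4) weq_pre] k by blast
qed

lemma sw_permutes: "a \<in> S \<Longrightarrow> b \<in> S \<Longrightarrow> sw a b permutes S"
  unfolding sw_transpose by (rule permutes_swap_id)

lemma word_perm_permutes: "set u \<subseteq> {1..<n} \<Longrightarrow> word_perm u permutes {1..n}"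
proof (induction u)
  case (Cons a u)
  then show ?case unfolding word_perm_simps by (intro permutes_compose sw_permutes Cons.IH) auto
qed (simp only: word_perm_simps permutes_id)

lemma sw_word:
  assumes "1 \<le> a" "a < b" "b \<le> n"
  shows "\<exists>u. set u \<subseteq> {1..<n} \<and> word_perm u = sw a b"
  using assms(2,3)
proof (induction b)
  case (Suc b)
  show ?case
  proof (cases "a = b")
    case True
    then show ?thesis using assms Suc by (intro exI[of _ "[a]"]) auto
  next
    case False
    then obtain u where u: "set u \<subseteq> {1..<n}" "word_perm u = sw a b" using Suc by auto
    have "sw a (Suc b) = sw b (b+1) \<circ> sw a b \<circ> sw b (b+1)"
      using False Suc.prems by (auto simp: sw_def fun_eq_iff)
    then show ?thesis using u Suc.prems assms False
      by (intro exI[of _ "b # u @ [b]"]) (auto simp: comp_assoc)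
  qed
qed simp

lemma sw_self [simp]: "sw a a = id"
  by (auto simp: sw_def)

lemma sw_commute: "sw a b = sw b a"
  by (auto simp: sw_def)

lemma permutes_word:
  assumes "p permutes {1..n}"
  shows "\<exists>u. set u \<subseteq> {1..<n} \<and> word_perm u = p"
  using assms finite_atLeastAtMost
proof (induction p rule: permutes_induct)
  case id
  show ?case by (rule exI[of _ "[]"]) simp
next
  case (swap a b p)
  then obtain u where u: "set u \<subseteq> {1..<n}" "word_perm u = p" by auto
  have "\<exists>w. set w \<subseteq> {1..<n} \<and> word_perm w = sw a b"
    using sw_word[of a b n] sw_word[of b a n] swap(1,2) sw_commute[of a b]
    by (cases a b rule: linorder_cases) (auto intro!: exI[of _ "[]"])
  then obtain w where w: "set w \<subseteq> {1..<n}" "word_perm w = sw a b" by blast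
  then show ?case using u by (intro exI[of _ "w @ u"]) (simp only: word_perm_append set_append Un_subset_iff sw_transpose simp_thms)
qed

section \<open>Coxeter relations for \<open>apply_s\<close>; \<open>tau_perm\<close> as a
  representation\<close>

context shape
begin

lemma bc_nonzero:
  assumes "S \<in> RSYT \<tau>" "1 \<le> k" "k < N"
  shows "bc k S \<noteq> 0"
  by (rule bc_cases[OF assms]) auto

text \<open>The only property of \<open>gc\<close> that the relations rest on; how the factor is
  distributed between the two directions is a matter of normalization.\<close>

lemma gc_mult_neg:
  "b \<noteq> 0 \<Longrightarrow> gc b * gc (- b) = (1 - 1 / (of_int b)\<^sup>2 :: 'k::field_char_0)"
  by (cases "b = 1 \<or> b = -1") (auto simp: gc_def)

lemma apply_s_square:
  fixes v :: "tableau \<Rightarrow> 'k::field_char_0"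
  assumes v: "supp v" and k: "1 \<le> k" "k < N"
  shows "apply_s \<tau> k (apply_s \<tau> k v) = v"
proof (rule supp_eqI[OF apply_s_supp[OF k] v])
  fix S assume S: "S \<in> RSYT \<tau>"
  have f: "fill S" using S by (rule RSYT_fill)
  have b: "(of_int (bc k S) :: 'k) \<noteq> 0" using bc_nonzero[OF S k] by simp
  have "apply_s \<tau> k (apply_s \<tau> k v) S = 
    v S * (1 / (of_int (bc k S))\<^sup>2 + gc (bc k S) * gc (- bc k S))"
    by (simp add: apply_s_eq[OF apply_s_supp[OF k] f k] apply_s_eq[OF v f k]
      apply_s_eq[OF v fill_swap[OF f k] k] bc_swap[OF f k] algebra_simps add_divide_distrib power2_eq_square)
  then show "apply_s \<tau> k (apply_s \<tau> k v) S = v S"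
    using gc_mult_neg[OF bc_nonzero[OF S k], where 'k = 'k] by simp
qed

lemma bc_swap_other:
  assumes "fill T" "1 \<le> k" "k < N" "1 \<le> l" "l < N"
  shows "k + 1 < l \<or> l + 1 < k \<Longrightarrow> bc l (swap_entries k T) = bc l T"
    "l = k + 1 \<Longrightarrow> bc l (swap_entries k T) = bc k T + bc l T"
    "k = l + 1 \<Longrightarrow> bc l (swap_entries k T) = bc k T + bc l T"
  using assms by (auto simp: bc_def content_swap sw_def)

lemma apply_s_commute:
  fixes v :: "tableau \<Rightarrow> 'k::field_char_0"
  assumes v: "supp v" and k: "1 \<le> k" "k < N" and l: "1 \<le> l" "l < N" and kl: "k + 1 < l \<or> l + 1 < k"
  shows "apply_s \<tau> k (apply_s \<tau> l v) = apply_s \<tau> l (apply_s \<tau> k v)"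
proof (rule supp_eqI[OF apply_s_supp[OF k] apply_s_supp[OF l]])
  fix S assume S: "S \<in> RSYT \<tau>"
  have f: "fill S" using S by (rule RSYT_fill)
  have lk: "l + 1 < k \<or> k + 1 < l" using kl by auto
  have e: "swap_entries k (swap_entries l S) = swap_entries l (swap_entries k S)"
    using kl by (auto simp: swap_entries_def)
  show "apply_s \<tau> k (apply_s \<tau> l v) S = apply_s \<tau> l (apply_s \<tau> k v) S"
    using bc_swap_other(1)[OF f k l kl] bc_swap_other(1)[OF f l k lk]
    by (simp add: apply_s_eq[OF apply_s_supp[OF l] f k] apply_s_eq[OF apply_s_supp[OF k] f l] 
      apply_s_eq[OF v f k] apply_s_eq[OF v f l] apply_s_eq[OF v fill_swap[OF f k] l] 
      apply_s_eq[OF v fill_swap[OF f l] k] e algebra_simps add_divide_distrib)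
qed

text \<open>At \<open>S\<close> both sides combine the values of \<open>v\<close> at six fillings.
  Those reached by two or three interchanges have equal coefficients at sight. The other three
  coefficients agree by 1/(x y) = 1/(x (x + y)) + 1/(y (x + y)), where x + y is the content
  difference of \<open>k\<close> and \<open>k + 2\<close> and is nonzero by
  \<open>content_gap_two\<close>.\<close>

lemma apply_s_braid:
  fixes v :: "tableau \<Rightarrow> 'k::field_char_0"
  assumes v: "supp v" and k: "1 \<le> k" "k + 1 < N"
  shows "apply_s \<tau> (k+1) (apply_s \<tau> k (apply_s \<tau> (k+1) v)) = apply_s \<tau> k (apply_s \<tau> (k+1) (apply_s \<tau> k v))"
proof -
  define l where "l = k + 1"
  have k': "1 \<le> k" "k < N" and l: "1 \<le> l" "l < N" using k by (auto simp: l_def)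
  note sk = apply_s_supp[OF k', where 'k = 'k] and sl = apply_s_supp[OF l, where 'k = 'k]
  have "apply_s \<tau> l (apply_s \<tau> k (apply_s \<tau> l v)) = apply_s \<tau> k (apply_s \<tau> l (apply_s \<tau> k v))"
  proof (rule supp_eqI[OF sl sk])
    fix S assume S: "S \<in> RSYT \<tau>"
    have f: "fill S" using S by (rule RSYT_fill)
    note fs = fill_swap[OF _ k'] and ft = fill_swap[OF _ l]
    have sts: "swap_entries k (swap_entries l (swap_entries k S)) = swap_entries l (swap_entries k (swap_entries l S))"
      by (auto simp: swap_entries_def l_def)
    define x where "x = bc k S"
    define y where "y = bc l S"
    have bx: "bc k (swap_entries k T) = - bc k T" "bc l (swap_entries k T) = bc k T + bc l T"
      "bc l (swap_entries l T) = - bc l T" "bc k (swap_entries l T) = bc k T + bc l T" if "fill T" for T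
      using bc_swap[OF that k'] bc_swap[OF that l] bc_swap_other[OF that k' l] bc_swap_other[OF that l k'] by (auto simp: l_def)
    have nz: "x \<noteq> 0" "y \<noteq> 0" "x + y \<noteq> 0"
      using bc_nonzero[OF S k'] bc_nonzero[OF S l] content_gap_two[OF S, of k] k
      by (auto simp: x_def y_def bc_def l_def)
    have nz': "(of_int x :: 'k) \<noteq> 0" "(of_int y :: 'k) \<noteq> 0" "(of_int x + of_int y :: 'k) \<noteq> 0"
      using nz by (simp_all flip: of_int_add)
    have g: "gc x * gc (- x) = 1 - 1 / (of_int x :: 'k)\<^sup>2" "gc y * gc (- y) = 1 - 1 / (of_int y :: 'k)\<^sup>2"
      using gc_mult_neg nz by blast+
    have A: "apply_s \<tau> l (apply_s \<tau> k (apply_s \<tau> l v)) S = 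
       ((v S / of_int y + gc y * v (swap_entries l S)) / of_int x 
         + gc x * (v (swap_entries k S) / of_int (x + y) + gc (x + y) * v (swap_entries l (swap_entries k S)))) / of_int y
      + gc y * ((- v (swap_entries l S) / of_int y + gc (- y) * v S) / of_int (x + y)
         + gc (x + y) * (v (swap_entries k (swap_entries l S)) / of_int x + gc x * v (swap_entries l (swap_entries k (swap_entries l S)))))"
      by (simp add: apply_s_eq[OF _ _ k'] apply_s_eq[OF _ _ l] v sk sl f fs ft bx flip: x_def y_def)
    have B: "apply_s \<tau> k (apply_s \<tau> l (apply_s \<tau> k v)) S = 
       ((v S / of_int x + gc x * v (swap_entries k S)) / of_int y 
         + gc y * (v (swap_entries l S) / of_int (x + y) + gc (x + y) * v (swap_entries k (swap_entries l S)))) / of_int x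
      + gc x * ((- v (swap_entries k S) / of_int x + gc (- x) * v S) / of_int (x + y)
         + gc (x + y) * (v (swap_entries l (swap_entries k S)) / of_int y + gc y * v (swap_entries k (swap_entries l (swap_entries k S)))))"
      by (simp add: apply_s_eq[OF _ _ k'] apply_s_eq[OF _ _ l] v sk sl f fs ft bx flip: x_def y_def)
    have C: "v S / of_int y / of_int x / of_int y + gc y * (gc (- y) * v S) / of_int (x + y)
      = v S / of_int x / of_int y / of_int x + gc x * (gc (- x) * v S) / of_int (x + y)"
    proof -
      have e: "gc y * (gc (- y) * v S) = (1 - 1 / (of_int y :: 'k)\<^sup>2) * v S"
        "gc x * (gc (- x) * v S) = (1 - 1 / (of_int x :: 'k)\<^sup>2) * v S"
        using g by (simp_all flip: mult.assoc)
      show ?thesis unfolding e using nz' by (simp add: divide_simps power2_eq_square) (simp add: algebra_simps)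
    qed
    have C2: "gc y * v (swap_entries l S) / of_int x / of_int y - gc y * v (swap_entries l S) / of_int y / of_int (x + y)
       = gc y * v (swap_entries l S) / of_int (x + y) / of_int x"
      "gc x * v (swap_entries k S) / of_int (x + y) / of_int y 
       = gc x * v (swap_entries k S) / of_int y / of_int x - gc x * v (swap_entries k S) / of_int x / of_int (x + y)"
      using nz' by (simp_all add: divide_simps) (simp_all add: algebra_simps)
    show "apply_s \<tau> l (apply_s \<tau> k (apply_s \<tau> l v)) S = apply_s \<tau> k (apply_s \<tau> l (apply_s \<tau> k v)) S"
      unfolding A B sts using C C2 by (simp add: algebra_simps add_divide_distrib diff_divide_distrib)
  qed
  then show ?thesis by (simp add: l_def)
qed

lemma tau_perm_eq: "tau_perm \<tau> w v = word_act (apply_s \<tau>) (perm_word N w) v"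
  by (simp add: tau_perm_def word_act_def)

lemma perm_word:
  assumes "w permutes {1..N}"
  shows "set (perm_word N w) \<subseteq> {1..<N}" "word_perm (perm_word N w) = w"
proof -
  have "\<exists>ws. (\<forall>a\<in>set ws. 1 \<le> a \<and> a < N) \<and> w = foldr (\<lambda>a f. sw a (a + 1) \<circ> f) ws id"
    using permutes_word[OF assms] unfolding word_perm_def by fastforce
  from someI_ex[OF this] show "set (perm_word N w) \<subseteq> {1..<N}" "word_perm (perm_word N w) = w"
    unfolding perm_word_def word_perm_def by auto
qed

lemma word_act_supp:
  "set u \<subseteq> {1..<N} \<Longrightarrow> supp v \<Longrightarrow> supp (word_act (apply_s \<tau>) u v :: tableau \<Rightarrow> 'k::field_char_0)"
  by (induction u) (auto intro: apply_s_supp)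

lemma tau_perm_supp:
  "w permutes {1..N} \<Longrightarrow> supp v \<Longrightarrow> supp (tau_perm \<tau> w v :: tableau \<Rightarrow> 'k::field_char_0)"
  unfolding tau_perm_eq by (intro word_act_supp perm_word)

text \<open>Frees \<open>tau_perm\<close> from the word selected in \<open>perm_word\<close>: two
  words of one permutation have a common reduct, and rewriting preserves the action.\<close>

lemma tau_perm_word:
  assumes "set u \<subseteq> {1..<N}" "supp (v :: tableau \<Rightarrow> 'k::field_char_0)"
  shows "tau_perm \<tau> (word_perm u) v = word_act (apply_s \<tau>) u v"
proof -
  have weq: "word_act (apply_s \<tau>) u v = word_act (apply_s \<tau>) w v" if "weq u w" "set u \<subseteq> {1..<N}" for u w
    by (rule word_act_weq[OF _ _ _ _ that, of "{v. supp v}"])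
      (use assms(2) in \<open>auto intro!: apply_s_supp apply_s_square apply_s_commute apply_s_braid[simplified]\<close>)
  have p: "word_perm u permutes {1..N}" using word_perm_permutes assms(1) by blast
  have "\<exists>w. weq u w \<and> weq (perm_word N (word_perm u)) w"
    using assms(1) perm_word[OF p] by (intro weq_of_word_perm_eq[of u N]) auto
  then show ?thesis
    unfolding tau_perm_eq using weq assms(1) perm_word(1)[OF p] by metis
qed

lemma tau_perm_comp:
  assumes "p permutes {1..N}" "q permutes {1..N}" "supp (v :: tableau \<Rightarrow> 'k::field_char_0)"
  shows "tau_perm \<tau> (p \<circ> q) v = tau_perm \<tau> p (tau_perm \<tau> q v)"
  using tau_perm_word[of "perm_word N p @ perm_word N q" v] assms perm_word[OF assms(1)] perm_word[OF assms(2)]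
  by (simp add: tau_perm_eq)

lemma tau_perm_id [simp]: "supp (v :: tableau \<Rightarrow> 'k::field_char_0) \<Longrightarrow> tau_perm \<tau> id v = v"
  using tau_perm_word[of "[]" v] by simp

lemma tau_perm_simple:
  "1 \<le> a \<Longrightarrow> a < N \<Longrightarrow> supp (v :: tableau \<Rightarrow> 'k::field_char_0) \<Longrightarrow> tau_perm \<tau> (sw a (a + 1)) v = apply_s \<tau> a v"
  using tau_perm_word[of "[a]" v] by simp

lemma apply_s_lin:
  "apply_s \<tau> x (\<lambda>S. a * v S + b * w S) = (\<lambda>S. a * apply_s \<tau> x v S + b * apply_s \<tau> x w S)"
  by (simp add: apply_s_def sum_distrib_left sum.distrib[symmetric] algebra_simps)

lemma word_act_lin:
  "word_act (apply_s \<tau>) u (\<lambda>S. a * v S + b * w S) S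
    = a * word_act (apply_s \<tau>) u v S + b * word_act (apply_s \<tau>) u w S"
proof (induction u arbitrary: S)
  case (Cons x u)
  then have "word_act (apply_s \<tau>) u (\<lambda>S. a * v S + b * w S)
    = (\<lambda>S. a * word_act (apply_s \<tau>) u v S + b * word_act (apply_s \<tau>) u w S)" by blast
  then show ?case by (simp add: apply_s_lin)
qed simp

lemma tau_perm_lin:
  "tau_perm \<tau> p (\<lambda>S. a * v S + b * w S) = (\<lambda>S. a * tau_perm \<tau> p v S + b * tau_perm \<tau> p w S)"
  unfolding tau_perm_eq by (rule ext) (rule word_act_lin)

lemma tau_perm_zero [simp]: "tau_perm \<tau> p (\<lambda>S. 0) = (\<lambda>S. 0)"
  using tau_perm_lin[of p 0 undefined 0 undefined] by simp

lemma tau_perm_add: "tau_perm \<tau> p (\<lambda>S. v S + w S) = (\<lambda>S. tau_perm \<tau> p v S + tau_perm \<tau> p w S)"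
  using tau_perm_lin[of p 1 v 1 w] by simp

lemma tau_perm_diff: "tau_perm \<tau> p (\<lambda>S. v S - w S) = (\<lambda>S. tau_perm \<tau> p v S - tau_perm \<tau> p w S)"
  using tau_perm_lin[of p 1 v "-1" w] by simp

lemma tau_perm_scale: "tau_perm \<tau> p (\<lambda>S. a * v S) = (\<lambda>S. a * tau_perm \<tau> p v S)"
  using tau_perm_lin[of p a v 0 v] by simp

lemma tau_perm_sum: "tau_perm \<tau> p (\<lambda>S. \<Sum>j\<in>A. f j S) = (\<lambda>S. \<Sum>j\<in>A. tau_perm \<tau> p (f j) S)"
  by (induction A rule: infinite_finite_induct) (simp_all add: tau_perm_add)

section \<open>Jucys-Murphy elements act on tableaux by contents\<close>

lemma content_top:
  assumes T: "T \<in> RSYT \<tau>" and "1 \<le> N"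
  shows "content \<tau> N T = 0"
proof -
  have f: "fill T" using T by (rule RSYT_fill)
  obtain r c where rc: "cell_of \<tau> N T = (r, c)" by fastforce
  have in_D: "(r, c) \<in> D" "T (r, c) = N" using cell_of_fill[OF f, of N] assms rc by auto
  have "(r, c) = (1, 1)"
  proof (rule ccontr)
    assume ne: "(r, c) \<noteq> (1, 1)"
    have "(1, 1) \<in> D" using diagram_down[OF in_D(1)] diagram_pos[OF in_D(1)] by auto
    then show False
      using RSYT_less[OF T in_D(1), of 1 1] ne diagram_pos[OF in_D(1)] in_D fill_range[OF f, of "(1, 1)"] by auto
  qed
  then show ?thesis using rc by (simp add: content_def row_def col_def)
qed

lemma supp_sum: "(\<And>j. j \<in> A \<Longrightarrow> supp (f j)) \<Longrightarrow> supp (\<lambda>S. \<Sum>j\<in>A. f j S)"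
  unfolding supp_def by (meson sum.not_neutral_contains_not_neutral)

lemma supp_zero [simp]: "supp (\<lambda>S. 0)"
  by (simp add: supp_def)

lemma supp_scale: "supp v \<Longrightarrow> supp (\<lambda>S. f S * v S)"
  by (auto simp: supp_def)

lemma tau_perm_sw_supp:
  "i \<in> {1..N} \<Longrightarrow> j \<in> {1..N} \<Longrightarrow> supp v \<Longrightarrow> supp (tau_perm \<tau> (sw i j) v :: tableau \<Rightarrow> 'k::field_char_0)"
  by (intro tau_perm_supp sw_permutes)

text \<open>Downward induction through om_k = s_k + s_k om_(k+1) s_k. It starts at \<open>N\<close>,
  which occupies the corner and has content 0; this is why the transpositions with larger, not
  smaller, indices are summed.\<close>

lemma jucys_murphy:
  fixes v :: "tableau \<Rightarrow> 'k::field_char_0"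
  assumes "1 \<le> k" "k \<le> N" "supp v"
  shows "(\<lambda>S. \<Sum>j\<in>{k<..N}. tau_perm \<tau> (sw k j) v S) = (\<lambda>S. of_int (content \<tau> k S) * v S)"
  using assms(2,1,3)
proof (induction k arbitrary: v rule: inc_induct)
  case base
  show ?case
    by (rule supp_eqI) (use base in \<open>auto simp: content_top intro: supp_scale supp_sum\<close>)
next
  case (step k)
  have k: "1 \<le> k" "k < N" using step by auto
  let ?s = "apply_s \<tau> k :: (tableau \<Rightarrow> 'k) \<Rightarrow> _"
  define u where "u = ?s v"
  have u: "supp u" "?s u = v" using apply_s_supp k apply_s_square[OF step.prems(2)] by (auto simp: u_def)
  have P: "tau_perm \<tau> (sw k j) v = ?s (tau_perm \<tau> (sw (Suc k) j) u)" if j: "j \<in> {Suc k<..N}" for j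
  proof -
    have "sw k j = sw k (k+1) \<circ> (sw (Suc k) j \<circ> sw k (k+1))" using j by (auto simp: sw_def fun_eq_iff)
    moreover have s: "sw k (k+1) permutes {1..N}" and t: "sw (Suc k) j permutes {1..N}" 
      using k j by (auto intro!: sw_permutes)
    ultimately show ?thesis
      using tau_perm_comp[OF s permutes_compose[OF s t] step.prems(2)] tau_perm_comp[OF t s step.prems(2)] 
        tau_perm_simple[OF k step.prems(2)] tau_perm_simple[OF k tau_perm_supp[OF t u(1)]] by (simp add: u_def)
  qed
  have IH: "(\<lambda>S. \<Sum>j\<in>{Suc k<..N}. tau_perm \<tau> (sw (Suc k) j) u S) = (\<lambda>S. of_int (content \<tau> (Suc k) S) * u S)"
    using step.IH[OF _ u(1)] by simp
  have sum_s: "?s (\<lambda>S. \<Sum>j\<in>A. f j S) S = (\<Sum>j\<in>A. ?s (f j) S)" for A :: "nat set" and f S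
    unfolding apply_s_def sum_distrib_right by (rule sum.swap)
  have A: "(\<Sum>j\<in>{Suc k<..N}. tau_perm \<tau> (sw k j) v S) = ?s (\<lambda>S. of_int (content \<tau> (Suc k) S) * u S) S" for S
    using P by (simp add: IH[symmetric] sum_s)
  have B: "(\<Sum>j\<in>{k<..N}. tau_perm \<tau> (sw k j) v S) = u S + ?s (\<lambda>S. of_int (content \<tau> (Suc k) S) * u S) S" for S
  proof -
    have "{k<..N} = insert (Suc k) {Suc k<..N}" using k by auto
    then show ?thesis using A tau_perm_simple[OF k step.prems(2)] by (simp add: u_def)
  qed
  show ?case
  proof (rule supp_eqI)
    fix S assume S: "S \<in> RSYT \<tau>"
    have f: "fill S" using S by (rule RSYT_fill)
    let ?c = "of_int (content \<tau> (Suc k) S) :: 'k" and ?b = "of_int (bc k S) :: 'k"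
    have b: "?b \<noteq> 0" using bc_nonzero[OF S k] by simp
    have c: "content \<tau> (Suc k) (swap_entries k S) = content \<tau> k S"
      using content_swap[OF f k, of "Suc k"] k by (simp add: sw_def)
    have ck: "content \<tau> k S = content \<tau> (Suc k) S + bc k S" by (simp add: bc_def)
    have v: "v S = u S / ?b + gc (bc k S) * u (swap_entries k S)"
      using apply_s_eq[OF u(1) f k] u(2) by simp
    have "(\<Sum>j\<in>{k<..N}. tau_perm \<tau> (sw k j) v S)
      = u S + (?c * u S / ?b + gc (bc k S) * (of_int (content \<tau> k S) * u (swap_entries k S)))"
      unfolding B using apply_s_eq[OF supp_scale[OF u(1)] f k] by (simp add: c)
    also have "\<dots> = (?c + ?b) * v S"
      unfolding ck v using b by (simp add: divide_simps) (simp add: algebra_simps)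
    finally show "(\<Sum>j\<in>{k<..N}. tau_perm \<tau> (sw k j) v S) = of_int (content \<tau> k S) * v S"
      by (simp add: ck)
  qed (use step.prems k in \<open>auto intro!: supp_sum tau_perm_sw_supp supp_scale\<close>)
qed

text \<open>Conjugation by \<open>r\<close> turns the transpositions of \<open>i\<close> with
  positions of larger rank into the Jucys-Murphy element of \<open>r i\<close>. In this form it
  appears in the leading coefficient of U_i.\<close>

lemma jucys_murphy_conj:
  fixes v :: "tableau \<Rightarrow> 'k::field_char_0"
  assumes r: "r permutes {1..N}" and i: "i \<in> {1..N}" and v: "supp v"
  shows "(\<lambda>S. \<Sum>j | j \<in> {1..N} \<and> r i < r j. tau_perm \<tau> (sw i j) v S)
    = tau_perm \<tau> (inv r) (\<lambda>S. of_int (content \<tau> (r i) S) * tau_perm \<tau> r v S)"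
proof -
  have ri: "r i \<in> {1..N}" using permutes_in_image[OF r] i by blast
  have w: "inv r permutes {1..N}" by (rule permutes_inv[OF r])
  have u: "supp (tau_perm \<tau> r v)" by (rule tau_perm_supp[OF r v])
  have P: "tau_perm \<tau> (sw i (inv r l)) v = tau_perm \<tau> (inv r) (tau_perm \<tau> (sw (r i) l) (tau_perm \<tau> r v))" 
    if l: "l \<in> {1..N}" for l
  proof -
    have "sw i (inv r l) = inv r \<circ> (sw (r i) l \<circ> r)"
    proof
      fix x
      have "x = inv r l \<longleftrightarrow> r x = l" using permutes_inv_eq[OF r] by metis
      moreover have "x = i \<longleftrightarrow> r x = r i" using permutes_inj[OF r] by (auto simp: inj_def)
      ultimately show "sw i (inv r l) x = (inv r \<circ> (sw (r i) l \<circ> r)) x"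
        using permutes_inverses(2)[OF r] by (simp add: sw_def)
    qed
    moreover have t: "sw (r i) l permutes {1..N}" using ri l by (rule sw_permutes)
    ultimately show ?thesis
      using tau_perm_comp[OF w permutes_compose[OF r t] v] tau_perm_comp[OF t r v] by simp
  qed
  have "(\<Sum>j | j \<in> {1..N} \<and> r i < r j. tau_perm \<tau> (sw i j) v S)
     = (\<Sum>l\<in>{r i<..N}. tau_perm \<tau> (sw i (inv r l)) v S)" for S
    by (rule sum.reindex_bij_witness[of _ "inv r" r])
      (use permutes_in_image[OF r] permutes_in_image[OF w] permutes_inverses[OF r] in \<open>auto\<close>)
  also have "\<dots> S = (\<Sum>l\<in>{r i<..N}. tau_perm \<tau> (inv r) (tau_perm \<tau> (sw (r i) l) (tau_perm \<tau> r v)) S)" for S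
    by (rule sum.cong) (use P ri in auto)
  also have "\<dots> S = tau_perm \<tau> (inv r) (\<lambda>S. of_int (content \<tau> (r i) S) * tau_perm \<tau> r v S) S" for S
    using fun_cong[OF tau_perm_sum[of "inv r" "\<lambda>l. tau_perm \<tau> (sw (r i) l) (tau_perm \<tau> r v)" "{r i<..N}"], of S]
      jucys_murphy[OF _ _ u, of "r i"] ri by simp
  finally show ?thesis by blast
qed

end

section \<open>Divided differences of multilinear polynomials\<close>

lemma mulx_inj:
  assumes "mulx i G = mulx i H"
  shows "G = H"
proof (intro ext)
  fix g S
  show "G g S = H g S" using fun_cong[OF fun_cong[OF assms, of "g(i := g i + 1)"], of S] by (simp add: mulx_def)
qed

lemma mulx_diff_inj:
  fixes G :: "expo \<Rightarrow> tableau \<Rightarrow> 'k::field"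
  assumes ij: "i \<noteq> j" and eq: "mulx i G - mulx j G = mulx i H - mulx j H"
  shows "G = H"
proof -
  have "G g S = H g S" for g S
  proof (induction "g j" arbitrary: g rule: less_induct)
    case less
    let ?g = "g(i := g i + 1)"
    have "mulx i G ?g S - mulx j G ?g S = mulx i H ?g S - mulx j H ?g S"
      using fun_cong[OF fun_cong[OF eq, of ?g], of S] by simp
    moreover have "mulx j G ?g S = mulx j H ?g S"
      using less[of "?g(j := g j - 1)"] ij by (simp add: mulx_def)
    ultimately show ?case by (simp add: mulx_def)
  qed
  then show ?thesis by blast
qed

lemma divdiff_eqI:
  fixes F G :: "expo \<Rightarrow> tableau \<Rightarrow> 'k::field"
  assumes ij: "i \<noteq> j" and eq: "mulx i G - mulx j G = F - swapvars i j F"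
  shows "divdiff i j F = G"
  unfolding divdiff_def
proof (rule the_equality[where P = "\<lambda>G. mulx i G - mulx j G = F - swapvars i j F", OF eq])
  fix H assume "mulx i H - mulx j H = F - swapvars i j F"
  then show "H = G" using eq mulx_diff_inj[OF ij, of H G] by simp
qed

lemma comp_sw: "i \<noteq> j \<Longrightarrow> g \<circ> sw i j = g(i := g j, j := g i)"
  by (auto simp: sw_def)

text \<open>For A + B x_i + C x_j + D x_i x_j with A, B, C, D free of x_i and x_j, the divided
  difference is B - C.\<close>

definition mdiff :: "nat \<Rightarrow> nat \<Rightarrow> (expo \<Rightarrow> tableau \<Rightarrow> 'k::field) \<Rightarrow> (expo \<Rightarrow> tableau \<Rightarrow> 'k)" where
  "mdiff i j F = (\<lambda>g S. if g i = 0 \<and> g j = 0 then F (g(i := 1)) S - F (g(j := 1)) S else 0)"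

lemma mulx_mdiff:
  fixes F :: "expo \<Rightarrow> tableau \<Rightarrow> 'k::field"
  assumes ml: "\<And>g S k. 1 < g k \<Longrightarrow> F g S = 0" and ij: "i \<noteq> j"
  shows "mulx i (mdiff i j F) g S - mulx j (mdiff i j F) g S = F g S - swapvars i j F g S"
proof -
  consider "1 < g i \<or> 1 < g j" | "g i = 0" "g j = 0" | "g i = 1" "g j = 0" | "g i = 0" "g j = 1" | "g i = 1" "g j = 1"
    by linarith
  then show ?thesis
  proof cases
    case 1
    then have "F g S = 0" "F (g(i := g j, j := g i)) S = 0"
      using ml[of g i S] ml[of g j S] ml[of "g(i := g j, j := g i)" i S] ml[of "g(i := g j, j := g i)" j S] ij by auto
    then show ?thesis using 1 ij by (auto simp: mulx_def mdiff_def swapvars_def comp_sw)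
  next
    case 2
    then have "g(i := 0, j := 0) = g" by auto
    with 2 show ?thesis using ij by (simp add: mulx_def mdiff_def swapvars_def comp_sw)
  next
    case 3
    then have "g(i := 1) = g" "g(i := Suc 0) = g" by auto
    with 3 show ?thesis using ij by (simp add: mulx_def mdiff_def swapvars_def comp_sw)
  next
    case 4
    then have "g(j := 1) = g" "g(j := Suc 0) = g" "g(j := 0, i := Suc 0) = g(i := Suc 0, j := 0)" using ij by auto
    with 4 show ?thesis using ij by (simp add: mulx_def mdiff_def swapvars_def comp_sw)
  next
    case 5
    then have "g(i := Suc 0, j := Suc 0) = g" by auto
    with 5 show ?thesis using ij by (simp add: mulx_def mdiff_def swapvars_def comp_sw)
  qed
qed

lemma divdiff_mlin:
  fixes F :: "expo \<Rightarrow> tableau \<Rightarrow> 'k::field"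
  assumes "\<And>g S k. 1 < g k \<Longrightarrow> F g S = 0" "i \<noteq> j"
  shows "divdiff i j F = mdiff i j F"
  using assms mulx_mdiff[of F i j] by (intro divdiff_eqI) (auto simp: fun_eq_iff)

text \<open>With F' for F after exchanging x_i and x_j: x_i F - x_j F' = (x_i - x_j) F' + x_i (F -
  F').\<close>

lemma divdiff_mulx:
  fixes F :: "expo \<Rightarrow> tableau \<Rightarrow> 'k::field"
  assumes ml: "\<And>g S k. 1 < g k \<Longrightarrow> F g S = 0" and ij: "i \<noteq> j"
  shows "divdiff i j (mulx i F) = (\<lambda>g S. swapvars i j F g S + mulx i (mdiff i j F) g S)"
proof (rule divdiff_eqI[OF ij], intro ext)
  fix g S
  let ?G = "mdiff i j F"
  have "mulx i (mulx i ?G) g S - mulx j (mulx i ?G) g S = mulx i F g S - mulx i (swapvars i j F) g S"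
    using mulx_mdiff[of F i j "g(i := g i - 1)" S, OF ml ij] ij
    by (auto simp: mulx_def fun_upd_twist)
  moreover have "swapvars i j (mulx i F) g S = mulx j (swapvars i j F) g S"
    using ij by (simp add: swapvars_def mulx_def comp_sw fun_upd_twist)
  ultimately show "(mulx i (\<lambda>g S. swapvars i j F g S + mulx i ?G g S) - mulx j (\<lambda>g S. swapvars i j F g S + mulx i ?G g S)) g S
    = (mulx i F - swapvars i j (mulx i F)) g S"
    by (auto simp: mulx_def algebra_simps split: if_splits)
qed

section \<open>Dunkl and Cherednik operators on multilinear polynomials\<close>

context shape
begin

definition cube :: "nat \<Rightarrow> expo set" where
  "cube m = {g. (\<forall>i. g i \<le> 1) \<and> expo_ok N g \<and> (\<Sum>i\<in>{1..N}. g i) = m}"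

definition mlin :: "nat \<Rightarrow> (expo \<Rightarrow> tableau \<Rightarrow> 'k::field) \<Rightarrow> bool" where
  "mlin m F \<longleftrightarrow> (\<forall>g. supp (F g) \<and> (g \<notin> cube m \<longrightarrow> F g = (\<lambda>S. 0)))"

lemma mlin_supp: "mlin m F \<Longrightarrow> supp (F g)"
  by (simp add: mlin_def)

lemma mlin_outside: "mlin m F \<Longrightarrow> g \<notin> cube m \<Longrightarrow> F g = (\<lambda>S. 0)"
  by (simp add: mlin_def)

lemma mlin_large: "mlin m F \<Longrightarrow> 1 < g k \<Longrightarrow> F g S = 0"
  using mlin_outside[of m F g] by (fastforce simp: cube_def not_le dest!: spec[of _ k])

text \<open>The action of the symmetric group on P_tau. A permutation p carries x^beta to the
  monomial with exponent beta o p^-1, so the coefficient at \<open>g\<close> comes from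
  \<open>g \<circ> p\<close>.\<close>

definition act :: "(nat \<Rightarrow> nat) \<Rightarrow> (expo \<Rightarrow> tableau \<Rightarrow> 'k::field) \<Rightarrow> (expo \<Rightarrow> tableau \<Rightarrow> 'k)" where
  "act p F = (\<lambda>g. tau_perm \<tau> p (F (g \<circ> p)))"

definition om :: "nat \<Rightarrow> (expo \<Rightarrow> tableau \<Rightarrow> 'k::field) \<Rightarrow> (expo \<Rightarrow> tableau \<Rightarrow> 'k)" where
  "om i F = (\<lambda>g S. \<Sum>j\<in>{i<..N}. act (sw i j) F g S)"

lemma dunkl_mlin:
  fixes F :: "expo \<Rightarrow> tableau \<Rightarrow> 'k::field_char_0"
  assumes F: "mlin m F"
  shows "dunkl \<tau> \<kappa> i F = (\<lambda>g S. if g i = 0 then F (g(i := 1)) S 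
    + \<kappa> * (\<Sum>j\<in>{1..N}-{i}. tau_perm \<tau> (sw i j) (mdiff i j F g) S) else 0)"
proof (intro ext)
  fix g S
  have dd: "divdiff i j F = mdiff i j F" if "j \<noteq> i" for j
    using that mlin_large[OF F] by (intro divdiff_mlin) auto
  have "mdiff i j F g = (\<lambda>S. 0)" if "g i \<noteq> 0" for j
    using that by (simp add: mdiff_def)
  moreover have "dx i F g S = (if g i = 0 then F (g(i := 1)) S else 0)"
    using mlin_large[OF F, of "g(i := g i + 1)" i S] by (auto simp: dx_def)
  moreover have "(\<Sum>j\<in>{1..N}-{i}. vmap \<tau> (sw i j) (divdiff i j F) g S) 
    = (\<Sum>j\<in>{1..N}-{i}. tau_perm \<tau> (sw i j) (mdiff i j F g) S)"
    by (intro sum.cong) (auto simp: vmap_def dd)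
  ultimately show "dunkl \<tau> \<kappa> i F g S = (if g i = 0 then F (g(i := 1)) S 
    + \<kappa> * (\<Sum>j\<in>{1..N}-{i}. tau_perm \<tau> (sw i j) (mdiff i j F g) S) else 0)"
    by (simp add: dunkl_def)
qed

text \<open>Two product rules, one for the derivative of x_i F and \<open>divdiff_mulx\<close> for
  the differences, split off F and all terms (i j) F. Those with j < i are exactly what U_i
  subtracts, and those with j > i form \<open>om\<close>.\<close>

lemma ucal_mlin:
  fixes F :: "expo \<Rightarrow> tableau \<Rightarrow> 'k::field_char_0"
  assumes F: "mlin m F" and i: "i \<in> {1..N}"
  shows "ucal \<tau> \<kappa> i F = (\<lambda>g S. F g S + mulx i (dunkl \<tau> \<kappa> i F) g S + \<kappa> * om i F g S)"
proof (intro ext)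
  fix g S
  have dd: "vmap \<tau> (sw i j) (divdiff i j (mulx i F)) g S 
    = act (sw i j) F g S + tau_perm \<tau> (sw i j) (mulx i (mdiff i j F) g) S" if "j \<noteq> i" for j
  proof -
    have e: "divdiff i j (mulx i F) = (\<lambda>g S. swapvars i j F g S + mulx i (mdiff i j F) g S)"
      using that mlin_large[OF F] by (intro divdiff_mulx) auto
    show ?thesis by (simp add: e vmap_def tau_perm_add act_def swapvars_def)
  qed
  have "(\<Sum>j\<in>{1..N}-{i}. act (sw i j) F g S) = (\<Sum>j\<in>{1..<i}. act (sw i j) F g S) + om i F g S"
  proof -
    have "{1..N} - {i} = {1..<i} \<union> {i<..N}" using i by auto
    moreover have "{1..<i} \<inter> {i<..N} = {}" by auto
    ultimately show ?thesis using sum.union_disjoint[of "{1..<i}" "{i<..N}"] by (simp add: om_def)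
  qed
  then have 1: "ucal \<tau> \<kappa> i F g S = dx i (mulx i F) g S 
    + \<kappa> * (\<Sum>j\<in>{1..N}-{i}. tau_perm \<tau> (sw i j) (mulx i (mdiff i j F) g) S) + \<kappa> * om i F g S"
    by (simp add: ucal_def dunkl_def dd sum.distrib algebra_simps) (simp add: vmap_def swapvars_def act_def)
  have "mulx i (mdiff i j F) g = (if g i = 1 then mdiff i j F (g(i := 0)) else (\<lambda>S. 0))" for j
    by (auto simp: mulx_def mdiff_def fun_eq_iff)
  then have 2: "(\<Sum>j\<in>{1..N}-{i}. tau_perm \<tau> (sw i j) (mulx i (mdiff i j F) g) S)
    = (if g i = 1 then (\<Sum>j\<in>{1..N}-{i}. tau_perm \<tau> (sw i j) (mdiff i j F (g(i := 0))) S) else 0)"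
    by simp
  have g1: "g(i := Suc 0) = g" if "g i = Suc 0" using that by auto
  have "dx i (mulx i F) g S = F g S + (if g i = 1 then F g S else 0)"
    using mlin_large[OF F, of g i S] by (cases "g i = 0 \<or> g i = 1") (auto simp: dx_def mulx_def)
  then show "ucal \<tau> \<kappa> i F g S = F g S + mulx i (dunkl \<tau> \<kappa> i F) g S + \<kappa> * om i F g S"
    unfolding 1 2 dunkl_mlin[OF F] by (auto simp: mulx_def g1)
qed

lemma act_comp:
  assumes "p permutes {1..N}" "q permutes {1..N}" "\<And>g. supp (F g :: tableau \<Rightarrow> 'k::field_char_0)"
  shows "act p (act q F) = act (p \<circ> q) F"
  using tau_perm_comp[OF assms] by (simp add: act_def comp_assoc)

lemma cube_comp:
  assumes "p permutes {1..N}"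
  shows "g \<circ> p \<in> cube m \<longleftrightarrow> g \<in> cube m"
proof -
  have *: "g \<circ> p \<in> cube m" if "g \<in> cube m" "p permutes {1..N}" for g p
    using that permutes_not_in[OF that(2)] sum.permute[OF that(2), of g]
    by (auto simp: cube_def expo_ok_def)
  show ?thesis using *[of g p] *[of "g \<circ> p" "inv p"] assms permutes_inv[OF assms] permutes_inv_o[OF assms]
    by (auto simp: comp_assoc)
qed

lemma mlin_act:
  assumes "p permutes {1..N}" "mlin m F"
  shows "mlin m (act p F :: expo \<Rightarrow> tableau \<Rightarrow> 'k::field_char_0)"
  unfolding mlin_def
proof (intro allI conjI impI)
  fix g
  show "supp (act p F g)"
    unfolding act_def by (rule tau_perm_supp[OF assms(1) mlin_supp[OF assms(2)]])
  assume "g \<notin> cube m"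
  then show "act p F g = (\<lambda>S. 0)" 
    using mlin_outside[OF assms(2)] cube_comp[OF assms(1)] by (simp add: act_def)
qed

lemma supp_lin:
  assumes "supp v" "supp w"
  shows "supp (\<lambda>S. a * v S + b * w S)"
proof -
  have "a * v S + b * w S = 0" if "S \<notin> RSYT \<tau>" for S
    using supp_outside[OF assms(1) that] supp_outside[OF assms(2) that] by simp
  then show ?thesis unfolding supp_def by blast
qed

lemma mlin_lin:
  assumes "mlin m F" "mlin m G"
  shows "mlin m (\<lambda>g S. a * F g S + b * G g S)"
  unfolding mlin_def
proof (intro allI conjI impI)
  fix g
  show "supp (\<lambda>S. a * F g S + b * G g S)"
    by (rule supp_lin) (rule mlin_supp[OF assms(1)], rule mlin_supp[OF assms(2)])
  assume "g \<notin> cube m"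
  then show "(\<lambda>S. a * F g S + b * G g S) = (\<lambda>S. 0)" 
    using mlin_outside[OF assms(1)] mlin_outside[OF assms(2)] by simp
qed

lemma act_lin: "act p (\<lambda>g S. a * F g S + b * G g S) = (\<lambda>g S. a * act p F g S + b * act p G g S)"
  by (simp add: act_def tau_perm_lin)

lemma mulx_act:
  assumes "p permutes {1..N}"
  shows "mulx (p i) (act p F) = act p (mulx i F)"
proof (intro ext)
  fix g :: expo and S
  have "g(p i := g (p i) - 1) \<circ> p = (g \<circ> p)(i := g (p i) - 1)"
    using permutes_inj[OF assms] by (auto simp: inj_def)
  then show "mulx (p i) (act p F) g S = act p (mulx i F) g S"
    by (simp add: mulx_def act_def)
qed

lemma dunkl_act:
  fixes F :: "expo \<Rightarrow> tableau \<Rightarrow> 'k::field_char_0"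
  assumes p: "p permutes {1..N}" and F: "mlin m F" and i: "i \<in> {1..N}"
  shows "dunkl \<tau> \<kappa> (p i) (act p F) = act p (dunkl \<tau> \<kappa> i F)"
proof (intro ext)
  fix g :: expo and S
  have upd: "g(p k := a) \<circ> p = (g \<circ> p)(k := a)" for k a
    using permutes_inj[OF p] by (auto simp: inj_def)
  have mdiff_supp: "supp (mdiff k l F h)" for k l h
    using mlin_supp[OF F] by (auto simp: mdiff_def supp_def split: if_splits) (metis eq_iff_diff_eq_0)
  have T: "tau_perm \<tau> (sw (p i) (p j)) (mdiff (p i) (p j) (act p F) g) 
    = tau_perm \<tau> p (tau_perm \<tau> (sw i j) (mdiff i j F (g \<circ> p)))" if j: "j \<in> {1..N}" for j
  proof -
    have "mdiff (p i) (p j) (act p F) g = tau_perm \<tau> p (mdiff i j F (g \<circ> p))"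
    proof (cases "g (p i) = 0 \<and> g (p j) = 0")
      case True
      then show ?thesis by (simp add: mdiff_def act_def tau_perm_diff upd)
    next
      case False
      then have "mdiff (p i) (p j) (act p F) g = (\<lambda>S. 0)" "mdiff i j F (g \<circ> p) = (\<lambda>S. 0)"
        by (auto simp: mdiff_def fun_eq_iff)
      then show ?thesis by simp
    qed
    moreover have "sw (p i) (p j) \<circ> p = p \<circ> sw i j"
      by (rule ext) (simp add: sw_def inj_eq[OF permutes_inj[OF p]])
    moreover have s: "sw i j permutes {1..N}" using i j by (rule sw_permutes)
    moreover have t: "sw (p i) (p j) permutes {1..N}"
      by (rule sw_permutes) (simp_all only: permutes_in_image[OF p] i j)
    ultimately show ?thesis using tau_perm_comp[OF t p mdiff_supp] tau_perm_comp[OF p s mdiff_supp] by metis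
  qed
  have "(\<Sum>j\<in>{1..N}-{p i}. tau_perm \<tau> (sw (p i) j) (mdiff (p i) j (act p F) g) S)
    = (\<Sum>j\<in>{1..N}-{i}. tau_perm \<tau> (sw (p i) (p j)) (mdiff (p i) (p j) (act p F) g) S)"
    by (rule sum.reindex_bij_witness[of _ p "inv p"])
      (simp_all only: Diff_iff singleton_iff permutes_in_image[OF p] permutes_in_image[OF permutes_inv[OF p]]
        permutes_inverses[OF p] inj_eq[OF permutes_inj[OF p]] permutes_inv_eq[OF p], auto)
  also have "\<dots> = tau_perm \<tau> p (\<lambda>S. \<Sum>j\<in>{1..N}-{i}. tau_perm \<tau> (sw i j) (mdiff i j F (g \<circ> p)) S) S"
    unfolding tau_perm_sum by (rule sum.cong) (use T in auto)
  finally have e: "(\<Sum>j\<in>{1..N}-{p i}. tau_perm \<tau> (sw (p i) j) (mdiff (p i) j (act p F) g) S)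
    = tau_perm \<tau> p (\<lambda>S. \<Sum>j\<in>{1..N}-{i}. tau_perm \<tau> (sw i j) (mdiff i j F (g \<circ> p)) S) S" .
  show "dunkl \<tau> \<kappa> (p i) (act p F) g S = act p (dunkl \<tau> \<kappa> i F) g S"
    unfolding dunkl_mlin[OF mlin_act[OF p F]] dunkl_mlin[OF F] e
    using tau_perm_lin[of p 1 "F ((g \<circ> p)(i := 1))" \<kappa>]
    by (auto simp: act_def upd)
qed

lemma act_supp:
  "p permutes {1..N} \<Longrightarrow> (\<And>g. supp (F g)) \<Longrightarrow> supp (act p F g :: tableau \<Rightarrow> 'k::field_char_0)"
  by (simp add: act_def tau_perm_supp)

lemma om_supp:
  "1 \<le> i \<Longrightarrow> (\<And>g. supp (F g)) \<Longrightarrow> supp (om i F g :: tableau \<Rightarrow> 'k::field_char_0)"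
  unfolding om_def by (intro supp_sum act_supp sw_permutes) auto

lemma act_sum: "act p (\<lambda>g S. \<Sum>j\<in>A. f j g S) = (\<lambda>g S. \<Sum>j\<in>A. act p (f j) g S)"
  by (simp add: act_def tau_perm_sum)

lemma act_square:
  assumes "a \<in> {1..N}" "b \<in> {1..N}" "\<And>g. supp (F g :: tableau \<Rightarrow> 'k::field_char_0)"
  shows "act (sw a b) (act (sw a b) F) = F"
proof -
  have p: "sw a b permutes {1..N}" using assms by (intro sw_permutes)
  have "sw a b \<circ> sw a b = id" by (auto simp: fun_eq_iff)
  then have "act (sw a b) (act (sw a b) F) = act id F" using act_comp[of "sw a b" "sw a b" F] p assms(3) by simp
  also have "\<dots> = F" using assms(3) by (simp add: act_def)
  finally show ?thesis .
qed

section \<open>Commutation with a simple transposition\<close>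

context
  fixes a :: nat
  assumes a: "1 \<le> a" "a < N"
begin

lemma simple_permutes: "sw a (a + 1) permutes {1..N}"
  using a by (intro sw_permutes) auto

lemma act_sw_act:
  assumes "\<And>g. supp (F g :: tableau \<Rightarrow> 'k::field_char_0)" "i \<in> {1..N}" "j \<in> {1..N}"
    "sw i' j' \<circ> sw a (a + 1) = sw a (a + 1) \<circ> sw i j" "i' \<in> {1..N}" "j' \<in> {1..N}"
  shows "act (sw i' j') (act (sw a (a + 1)) F) = act (sw a (a + 1)) (act (sw i j) F)"
  using act_comp[of "sw i' j'" "sw a (a + 1)" F] act_comp[of "sw a (a + 1)" "sw i j" F] assms
    sw_permutes simple_permutes by metis

text \<open>The term j = a + 1 gives s_a s_a F = F; each further transposition of \<open>a\<close>
  is conjugated by s_a into one of \<open>a + 1\<close>.\<close>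

lemma om_act_left:
  assumes F: "\<And>g. supp (F g :: tableau \<Rightarrow> 'k::field_char_0)"
  shows "om a (act (sw a (a + 1)) F) = (\<lambda>g S. F g S + act (sw a (a + 1)) (om (a + 1) F) g S)"
proof (intro ext)
  fix g S
  have *: "act (sw a j) (act (sw a (a + 1)) F) = act (sw a (a + 1)) (act (sw (a + 1) j) F)"
    if "j \<in> {a + 1<..N}" for j
    by (rule act_sw_act[of F, OF F]) (use that a in \<open>auto simp: sw_def fun_eq_iff\<close>)
  have "{a<..N} = insert (a + 1) {a + 1<..N}" using a by auto
  then show "om a (act (sw a (a + 1)) F) g S = F g S + act (sw a (a + 1)) (om (a + 1) F) g S"
    using act_square[of a "a + 1" F] F * a by (simp add: om_def act_sum)
qed

text \<open>\<open>om_act_left\<close> for s_a F in place of F, multiplied by s_a.\<close>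

lemma om_act_right:
  assumes F: "\<And>g. supp (F g :: tableau \<Rightarrow> 'k::field_char_0)"
  shows "om (a + 1) (act (sw a (a + 1)) F) = (\<lambda>g S. act (sw a (a + 1)) (om a F) g S - F g S)"
proof -
  let ?s = "sw a (a + 1)"
  have sF: "supp (act ?s F g)" for g using act_supp[of ?s F] simple_permutes F by blast
  have "om a F = (\<lambda>g S. act ?s F g S + act ?s (om (a + 1) (act ?s F)) g S)"
    using om_act_left[of "act ?s F"] sF act_square[of a "a + 1" F] F a by simp
  then have "act ?s (om a F) = (\<lambda>g S. act ?s (act ?s F) g S + act ?s (act ?s (om (a + 1) (act ?s F))) g S)"
    using act_lin[of ?s 1 "act ?s F" 1 "act ?s (om (a + 1) (act ?s F))"] by simp
  then show ?thesis
    using act_square[of a "a + 1" F] F act_square[of a "a + 1" "om (a + 1) (act (sw a (a + 1)) F)"] om_supp[of "a + 1" "act (sw a (a + 1)) F"] sF a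
    by (simp add: fun_eq_iff)
qed

lemma om_act_other:
  assumes F: "\<And>g. supp (F g :: tableau \<Rightarrow> 'k::field_char_0)" and j: "j \<in> {1..N}" "j \<noteq> a" "j \<noteq> a + 1"
  shows "om j (act (sw a (a + 1)) F) = act (sw a (a + 1)) (om j F)"
proof (intro ext)
  fix g S
  have *: "act (sw j l) (act (sw a (a + 1)) F) = act (sw a (a + 1)) (act (sw j (sw a (a + 1) l)) F)"
    if "l \<in> {j<..N}" for l
    by (rule act_sw_act[of F, OF F]) (use that a j in \<open>auto simp: sw_def fun_eq_iff\<close>)
  have "(\<Sum>l\<in>{j<..N}. act (sw j l) (act (sw a (a + 1)) F) g S) 
    = (\<Sum>l\<in>{j<..N}. act (sw a (a + 1)) (act (sw j l) F) g S)"
    by (rule sum.reindex_bij_witness[of _ "sw a (a+1)" "sw a (a+1)"])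
      (use * j a in \<open>auto simp: sw_def split: if_splits\<close>)
  then show "om j (act (sw a (a + 1)) F) g S = act (sw a (a + 1)) (om j F) g S"
    by (simp add: om_def act_sum)
qed

lemma act_lin3:
  "act p (\<lambda>g S. F g S + G g S + \<kappa> * H g S) = (\<lambda>g S. act p F g S + act p G g S + \<kappa> * act p H g S)"
  using act_lin[of p 1 "\<lambda>g S. F g S + G g S" \<kappa> H] act_lin[of p 1 F 1 G] by simp

text \<open>Since x_i D_i is equivariant, the corrections by \<open>\<kappa>\<close> come from
  \<open>om\<close> alone.\<close>

lemma ucal_act:
  fixes F :: "expo \<Rightarrow> tableau \<Rightarrow> 'k::field_char_0"
  assumes F: "mlin m F"
  shows "ucal \<tau> \<kappa> a (act (sw a (a + 1)) F) = (\<lambda>g S. act (sw a (a + 1)) (ucal \<tau> \<kappa> (a + 1) F) g S + \<kappa> * F g S)"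
    "ucal \<tau> \<kappa> (a + 1) (act (sw a (a + 1)) F) = (\<lambda>g S. act (sw a (a + 1)) (ucal \<tau> \<kappa> a F) g S - \<kappa> * F g S)"
    "j \<in> {1..N} \<Longrightarrow> j \<noteq> a \<Longrightarrow> j \<noteq> a + 1 \<Longrightarrow>
       ucal \<tau> \<kappa> j (act (sw a (a + 1)) F) = act (sw a (a + 1)) (ucal \<tau> \<kappa> j F)"
proof -
  let ?s = "sw a (a + 1)"
  note Fs = mlin_supp[OF F] and sF = mlin_act[OF simple_permutes F]
  have MD: "mulx (?s i) (dunkl \<tau> \<kappa> (?s i) (act ?s F)) = act ?s (mulx i (dunkl \<tau> \<kappa> i F))" if "i \<in> {1..N}" for i
    using dunkl_act[OF simple_permutes F that] mulx_act[OF simple_permutes] by simp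
  have s: "?s (a + 1) = a" "?s a = a + 1" by (auto simp: sw_def)
  have i: "a \<in> {1..N}" "a + 1 \<in> {1..N}" using a by auto
  show "ucal \<tau> \<kappa> a (act ?s F) = (\<lambda>g S. act ?s (ucal \<tau> \<kappa> (a + 1) F) g S + \<kappa> * F g S)"
    unfolding ucal_mlin[OF F i(2)] ucal_mlin[OF sF i(1)] act_lin3 om_act_left[of F, OF Fs]
    using MD[OF i(2)] unfolding s by (simp add: algebra_simps)
  show "ucal \<tau> \<kappa> (a + 1) (act ?s F) = (\<lambda>g S. act ?s (ucal \<tau> \<kappa> a F) g S - \<kappa> * F g S)"
    unfolding ucal_mlin[OF F i(1)] ucal_mlin[OF sF i(2)] act_lin3 om_act_right[of F, OF Fs]
    using MD[OF i(1)] unfolding s by (simp add: algebra_simps)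
  show "ucal \<tau> \<kappa> j (act ?s F) = act ?s (ucal \<tau> \<kappa> j F)" if j: "j \<in> {1..N}" "j \<noteq> a" "j \<noteq> a + 1"
  proof -
    have "?s j = j" using j by (auto simp: sw_def)
    then show ?thesis
      unfolding ucal_mlin[OF F j(1)] ucal_mlin[OF sF j(1)] act_lin3 om_act_other[of F, OF Fs j]
      using MD[OF j(1)] by simp
  qed
qed

end

section \<open>Joint eigenfunctions\<close>

lemma mdiff_lin: 
  "mdiff i j (\<lambda>g S. a * F g S + b * G g S) g = (\<lambda>S. a * mdiff i j F g S + b * mdiff i j G g S)"
  by (auto simp: mdiff_def algebra_simps)

lemma dunkl_lin:
  fixes F G :: "expo \<Rightarrow> tableau \<Rightarrow> 'k::field_char_0"
  assumes F: "mlin m F" and G: "mlin m G"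
  shows "dunkl \<tau> \<kappa> i (\<lambda>g S. a * F g S + b * G g S) = (\<lambda>g S. a * dunkl \<tau> \<kappa> i F g S + b * dunkl \<tau> \<kappa> i G g S)"
  unfolding dunkl_mlin[OF F] dunkl_mlin[OF G] dunkl_mlin[OF mlin_lin[OF F G]] mdiff_lin tau_perm_lin
  by (auto simp: fun_eq_iff sum.distrib sum_distrib_left algebra_simps)

lemma om_lin: "om i (\<lambda>g S. a * F g S + b * G g S) = (\<lambda>g S. a * om i F g S + b * om i G g S)"
  by (simp add: om_def act_lin sum.distrib sum_distrib_left)

lemma ucal_lin:
  fixes F G :: "expo \<Rightarrow> tableau \<Rightarrow> 'k::field_char_0"
  assumes F: "mlin m F" and G: "mlin m G" and i: "i \<in> {1..N}"
  shows "ucal \<tau> \<kappa> i (\<lambda>g S. a * F g S + b * G g S) = (\<lambda>g S. a * ucal \<tau> \<kappa> i F g S + b * ucal \<tau> \<kappa> i G g S)"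
  unfolding ucal_mlin[OF F i] ucal_mlin[OF G i] ucal_mlin[OF mlin_lin[OF F G] i] om_lin dunkl_lin[OF F G]
  by (auto simp: fun_eq_iff mulx_def algebra_simps)

text \<open>\<open>F\<close> may be zero: the eigenfunctions with a fixed spectral vector form a
  linear space, and differences of two of them are later shown to vanish.\<close>

definition eig :: "nat \<Rightarrow> 'k::field_char_0 \<Rightarrow> (expo \<Rightarrow> tableau \<Rightarrow> 'k) \<Rightarrow> (nat \<Rightarrow> 'k) \<Rightarrow> bool" where
  "eig m \<kappa> F \<xi> \<longleftrightarrow> mlin m F \<and> (\<forall>i\<in>{1..N}. ucal \<tau> \<kappa> i F = (\<lambda>g S. \<xi> i * F g S))"

lemma eig_lin:
  "eig m \<kappa> F \<xi> \<Longrightarrow> eig m \<kappa> G \<xi> \<Longrightarrow> eig m \<kappa> (\<lambda>g S. a * F g S + b * G g S) \<xi>"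
  unfolding eig_def using mlin_lin[of m F G a b] ucal_lin[of m F G]
  by (simp add: algebra_simps)

text \<open>The condition on \<open>b\<close> is a product because it serves two situations. At
  unequal exponents b is \<open>\<kappa>\<close> over 1 + \<open>\<kappa>\<close> c; at equal
  exponents the difference of eigenvalues is itself a multiple of \<open>\<kappa>\<close>, and b is
  a number independent of it.\<close>

lemma eig_step:
  assumes F: "eig m \<kappa> F \<xi>" and a: "1 \<le> a" "a < N" and b: "b * (\<xi> (a + 1) - \<xi> a) = \<kappa>"
  shows "eig m \<kappa> (\<lambda>g S. act (sw a (a + 1)) F g S + b * F g S) (\<xi> \<circ> sw a (a + 1))"
proof -
  let ?s = "sw a (a + 1)"
  have F': "mlin m F" and U: "\<And>i. i \<in> {1..N} \<Longrightarrow> ucal \<tau> \<kappa> i F = (\<lambda>g S. \<xi> i * F g S)"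
    using F by (auto simp: eig_def)
  have sF: "mlin m (act ?s F)" by (rule mlin_act[OF simple_permutes[OF a] F'])
  have scale: "act ?s (\<lambda>g S. c * F g S) = (\<lambda>g S. c * act ?s F g S)" for c
    using act_lin[of ?s c F 0 F] by simp
  have L: "ucal \<tau> \<kappa> i (\<lambda>g S. act ?s F g S + b * F g S) = (\<lambda>g S. ucal \<tau> \<kappa> i (act ?s F) g S + b * (\<xi> i * F g S))"
    if "i \<in> {1..N}" for i
    using ucal_lin[OF sF F' that, of \<kappa> 1 b] U[OF that] by simp
  have i': "a \<in> {1..N}" "a + 1 \<in> {1..N}" using a by auto
  have b': "b * \<xi> (a + 1) = \<kappa> + b * \<xi> a" using b by (simp add: algebra_simps)
  have "ucal \<tau> \<kappa> i (\<lambda>g S. act ?s F g S + b * F g S) = (\<lambda>g S. \<xi> (?s i) * (act ?s F g S + b * F g S))"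
    if i: "i \<in> {1..N}" for i
  proof -
    consider "i = a" | "i = a + 1" | "i \<noteq> a" "i \<noteq> a + 1" by blast
    then show ?thesis
    proof cases
      case 1
      have e: "\<kappa> * x + b * (\<xi> a * x) = \<xi> (a + 1) * (b * x)" for x
      proof -
        have "\<kappa> * x + b * (\<xi> a * x) = (\<kappa> + b * \<xi> a) * x" by (simp add: algebra_simps)
        then show ?thesis by (simp add: b'[symmetric] mult_ac)
      qed
      have s: "?s a = a + 1" by (simp add: sw_def)
      show ?thesis unfolding L[OF i] unfolding 1 ucal_act(1)[OF a F'] s U[OF i'(2)] scale using e
        by (simp add: fun_eq_iff ring_distribs)
    next
      case 2
      have e: "b * (\<xi> (a + 1) * x) = \<kappa> * x + \<xi> a * (b * x)" for x
      proof -
        have "b * (\<xi> (a + 1) * x) = (b * \<xi> (a + 1)) * x" by simp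
        also have "\<dots> = \<kappa> * x + \<xi> a * (b * x)" unfolding b' by (simp add: algebra_simps)
        finally show ?thesis .
      qed
      have s: "?s (a + 1) = a" by (simp add: sw_def)
      show ?thesis unfolding L[OF i] unfolding 2 ucal_act(2)[OF a F'] s U[OF i'(1)] scale e
        by (simp add: fun_eq_iff ring_distribs)
    next
      case 3
      then have s: "?s i = i" by (simp add: sw_def)
      show ?thesis unfolding L[OF i] ucal_act(3)[OF a F' i 3] s U[OF i] scale
        by (simp add: algebra_simps)
    qed
  qed
  then show ?thesis
    using mlin_lin[OF sF F', of 1 b] by (simp add: eig_def)
qed

section \<open>Ranks, leading coefficients and uniqueness from the spectrum\<close>

definition rank_compat :: "expo \<Rightarrow> (nat \<Rightarrow> nat) \<Rightarrow> bool" where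
  "rank_compat g r \<longleftrightarrow> r permutes {1..N} \<and>
     (\<forall>i\<in>{1..N}. \<forall>j\<in>{1..N}. r i < r j \<longleftrightarrow> g j < g i \<or> g j = g i \<and> i < j)"

lemma rank_compat_rank: "rank_compat g (rank N g)"
proof -
  define A where "A i = {j\<in>{1..N}. g i < g j \<or> g j = g i \<and> j \<le> i}" for i
  have rank: "rank N g i = card (A i)" if "i \<in> {1..N}" for i
  proof -
    have "A i = {j\<in>{1..N}. g i < g j} \<union> {j\<in>{1..i}. g j = g i}"
      using that by (auto simp: A_def)
    moreover have "card ({j\<in>{1..N}. g i < g j} \<union> {j\<in>{1..i}. g j = g i})
      = card {j\<in>{1..N}. g i < g j} + card {j\<in>{1..i}. g j = g i}"
      by (rule card_Un_disjoint) auto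
    ultimately show ?thesis using that by (simp add: rank_def)
  qed
  have less: "rank N g i < rank N g j" if "i \<in> {1..N}" "j \<in> {1..N}" "g j < g i \<or> g j = g i \<and> i < j" for i j
    unfolding rank[OF that(1)] rank[OF that(2)]
    by (rule psubset_card_mono) (use that in \<open>auto simp: A_def\<close>)
  have compat: "rank N g i < rank N g j \<longleftrightarrow> g j < g i \<or> g j = g i \<and> i < j" if ij: "i \<in> {1..N}" "j \<in> {1..N}" for i j
  proof
    assume lt: "rank N g i < rank N g j"
    show "g j < g i \<or> g j = g i \<and> i < j"
    proof (rule ccontr)
      assume "\<not> ?thesis"
      then have "i = j \<or> g i < g j \<or> g i = g j \<and> j < i" by auto
      then show False using less[OF ij(2,1)] lt by auto
    qed
  qed (use less ij in blast)
  have inj: "inj_on (rank N g) {1..N}"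
  proof (rule inj_onI)
    fix i j assume ij: "i \<in> {1..N}" "j \<in> {1..N}" "rank N g i = rank N g j"
    show "i = j"
      using less[OF ij(1,2)] less[OF ij(2,1)] ij(3) by (cases i j rule: linorder_cases; cases "g i" "g j" rule: linorder_cases) auto
  qed
  have "rank N g ` {1..N} \<subseteq> {1..N}"
  proof
    fix x assume "x \<in> rank N g ` {1..N}"
    then obtain i where i: "i \<in> {1..N}" "x = card (A i)" using rank by auto
    have "A i \<subseteq> {1..N}" "i \<in> A i" using i by (auto simp: A_def)
    then show "x \<in> {1..N}" using i card_mono[of "{1..N}" "A i"] card_gt_0_iff[of "A i"] finite_subset[of "A i" "{1..N}"] by auto
  qed
  then have "bij_betw (rank N g) {1..N} {1..N}"
    using inj endo_inj_surj[of "{1..N}" "rank N g"] by (auto simp: bij_betw_def)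
  then have "rank N g permutes {1..N}"
    by (rule bij_imp_permutes) (auto simp: rank_def)
  then show ?thesis using compat by (simp add: rank_compat_def)
qed

text \<open>If g i = 0, only transpositions with later zeros survive, by \<open>lower\<close>. If g
  i = 1, each zero at j contributes \<open>F g\<close> minus the coefficient at the swapped
  exponent; for j > i that second term cancels against \<open>om\<close>, and for j < i it vanishes
  by \<open>lower\<close>, while later ones contribute through \<open>om\<close>. In both cases
  exactly the positions of larger rank remain.\<close>

lemma ucal_leading:
  fixes F :: "expo \<Rightarrow> tableau \<Rightarrow> 'k::field_char_0"
  assumes F: "mlin m F" and g: "g \<in> cube m" and i: "i \<in> {1..N}" and r: "rank_compat g r"
    and lower: "\<And>a b. a \<in> {1..N} \<Longrightarrow> b \<in> {1..N} \<Longrightarrow> a < b \<Longrightarrow> g a = 0 \<Longrightarrow> g b = 1 \<Longrightarrow> F (g \<circ> sw a b) = (\<lambda>S. 0)"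
  shows "ucal \<tau> \<kappa> i F g = (\<lambda>S. (1 + of_nat (g i)) * F g S
    + \<kappa> * tau_perm \<tau> (inv r) (\<lambda>S. of_int (content \<tau> (r i) S) * tau_perm \<tau> r (F g) S) S)"
proof
  fix S
  have g01: "g j = 0 \<or> g j = 1" for j
  proof -
    have "g j \<le> 1" using g by (simp add: cube_def)
    then show ?thesis by linarith
  qed
  have J: "{j \<in> {1..N}. r i < r j} = {j \<in> {1..N}. g j < g i \<or> g j = g i \<and> i < j}"
    using r i by (auto simp: rank_compat_def)
  have conj: "(\<Sum>j | j \<in> {1..N} \<and> r i < r j. tau_perm \<tau> (sw i j) (F g) S)
    = tau_perm \<tau> (inv r) (\<lambda>S. of_int (content \<tau> (r i) S) * tau_perm \<tau> r (F g) S) S"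
    using fun_cong[OF jucys_murphy_conj[of r i "F g"], of S] r i mlin_supp[OF F] by (simp add: rank_compat_def)
  have fixed: "g \<circ> sw i j = g" if "g i = g j" for j
    using that by (auto simp: sw_def fun_eq_iff)
  have "ucal \<tau> \<kappa> i F g S = (1 + of_nat (g i)) * F g S + 
    \<kappa> * (\<Sum>j | j \<in> {1..N} \<and> r i < r j. tau_perm \<tau> (sw i j) (F g) S)"
  proof (cases "g i = 0")
    case True
    have "om i F g S = (\<Sum>j\<in>{i<..N}. if g j = 0 then tau_perm \<tau> (sw i j) (F g) S else 0)"
      unfolding om_def
    proof (rule sum.cong[OF refl])
      fix j assume j: "j \<in> {i<..N}"
      show "act (sw i j) F g S = (if g j = 0 then tau_perm \<tau> (sw i j) (F g) S else 0)"
        using lower[of i j] fixed[of j] True j i g01[of j] by (auto simp: act_def)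
    qed
    also have "\<dots> = (\<Sum>j | j \<in> {1..N} \<and> r i < r j. tau_perm \<tau> (sw i j) (F g) S)"
      unfolding J using True i by (intro sum.mono_neutral_cong_right) auto
    finally show ?thesis using True by (simp add: ucal_mlin[OF F i] mulx_def)
  next
    case False
    then have gi: "g i = 1" using g01[of i] by auto
    have pos: "0 < g j \<longleftrightarrow> g j = Suc 0" for j using g01[of j] by auto
    let ?h = "g(i := 0)"
    have h: "?h(i := 1) = g" using gi by auto
    have md: "mdiff i j F ?h = (\<lambda>S. if g j = 0 then F g S - F (g \<circ> sw i j) S else 0)" if "j \<noteq> i" for j
    proof -
      have 1: "?h(j := 1) = g \<circ> sw i j" if "g j = 0" using comp_sw[of i j g] \<open>j \<noteq> i\<close> gi that by simp
      have 2: "?h i = 0" "?h j = g j" using that by auto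
      show ?thesis unfolding mdiff_def h 2 by (cases "g j = 0") (simp_all only: 1 simp_thms if_True if_False)
    qed
    have A: "mulx i (dunkl \<tau> \<kappa> i F) g S = F g S + \<kappa> * (\<Sum>j\<in>{1..N}-{i}. tau_perm \<tau> (sw i j) (mdiff i j F ?h) S)"
      using gi h by (simp add: mulx_def dunkl_mlin[OF F])
    have "om i F g S = (\<Sum>j\<in>{1..N}-{i}. if i < j then act (sw i j) F g S else 0)"
      unfolding om_def using i by (intro sum.mono_neutral_cong_left) auto
    moreover have "(\<Sum>j\<in>{1..N}-{i}. tau_perm \<tau> (sw i j) (mdiff i j F ?h) S) 
         + (\<Sum>j\<in>{1..N}-{i}. if i < j then act (sw i j) F g S else 0)
       = (\<Sum>j\<in>{1..N}-{i}. if g j = 0 \<or> i < j then tau_perm \<tau> (sw i j) (F g) S else 0)"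
      unfolding sum.distrib[symmetric]
    proof (rule sum.cong[OF refl])
      fix j assume j: "j \<in> {1..N} - {i}"
      have "g \<circ> sw j i = g \<circ> sw i j" by (simp add: sw_commute)
      then have "F (g \<circ> sw i j) = (\<lambda>S. 0)" if "g j = 0" "j < i" using lower[of j i] that j i gi by auto
      moreover have "g \<circ> sw i j = g" if "g j \<noteq> 0" using fixed[of j] gi g01[of j] that by auto
      ultimately show "tau_perm \<tau> (sw i j) (mdiff i j F ?h) S + (if i < j then act (sw i j) F g S else 0)
        = (if g j = 0 \<or> i < j then tau_perm \<tau> (sw i j) (F g) S else 0)"
        using j md[of j] by (cases "g j = 0"; cases "i < j") (auto simp: act_def tau_perm_diff)
    qed
    moreover have "\<dots> = (\<Sum>j | j \<in> {1..N} \<and> r i < r j. tau_perm \<tau> (sw i j) (F g) S)"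
      unfolding J using gi i by (intro sum.mono_neutral_cong_right) (auto simp: pos)
    ultimately have "om i F g S = (\<Sum>j | j \<in> {1..N} \<and> r i < r j. tau_perm \<tau> (sw i j) (F g) S)
        - (\<Sum>j\<in>{1..N}-{i}. tau_perm \<tau> (sw i j) (mdiff i j F ?h) S)"
      by (metis (no_types, lifting) add_diff_cancel_left')
    then show ?thesis unfolding ucal_mlin[OF F i] A using gi by (simp only:) (simp add: algebra_simps)
  qed
  then show "ucal \<tau> \<kappa> i F g S = (1 + of_nat (g i)) * F g S
    + \<kappa> * tau_perm \<tau> (inv r) (\<lambda>S. of_int (content \<tau> (r i) S) * tau_perm \<tau> r (F g) S) S"
    unfolding conj .
qed

text \<open>A linear stand-in for dominance on \<open>cube m\<close>: moving a one to the left
  lowers it, so larger exponents in dominance have smaller weight.\<close>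

definition wt :: "expo \<Rightarrow> nat" where
  "wt g = (\<Sum>i\<in>{1..N}. i * g i)"

lemma wt_swap:
  assumes "a \<in> {1..N}" "b \<in> {1..N}" "a < b" "g a = 0" "g b = 1"
  shows "wt (g \<circ> sw a b) + b = wt g + a"
proof -
  have split: "{1..N} = insert a (insert b ({1..N} - {a, b}))" using assms by auto
  have e: "wt h = a * h a + (b * h b + (\<Sum>i\<in>{1..N} - {a, b}. i * h i))" for h
    unfolding wt_def by (subst split) (use assms in auto)
  have "(\<Sum>i\<in>{1..N} - {a, b}. i * (g \<circ> sw a b) i) = (\<Sum>i\<in>{1..N} - {a, b}. i * g i)"
    by (rule sum.cong) (auto simp: sw_def)
  then show ?thesis unfolding e[of g] e[of "g \<circ> sw a b"] using assms by (simp add: sw_def)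
qed

definition generic :: "'k::field_char_0 \<Rightarrow> bool" where
  "generic \<kappa> \<longleftrightarrow> (\<forall>n::int. \<bar>n\<bar> \<le> int (part \<tau> 1) + int (length \<tau>) - 2 \<longrightarrow> 1 + \<kappa> * of_int n \<noteq> 0)"

definition content_range :: "int \<Rightarrow> bool" where
  "content_range c \<longleftrightarrow> 1 - int (length \<tau>) \<le> c \<and> c \<le> int (part \<tau> 1) - 1"

lemma content_range_content:
  assumes "T \<in> RSYT \<tau>" "k \<in> {1..N}"
  shows "content_range (content \<tau> k T)"
proof -
  obtain r c where rc: "cell_of \<tau> k T = (r, c)" by fastforce
  have "(r, c) \<in> D" using cell_of_fill[OF RSYT_fill[OF assms(1)] assms(2)] rc by auto
  then have "1 \<le> r" "r \<le> length \<tau>" "1 \<le> c" "c \<le> part \<tau> r" by (auto simp: diagram_def)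
  moreover have "part \<tau> r \<le> part \<tau> 1" using part_antimono[of 1 r] \<open>1 \<le> r\<close> by simp
  ultimately show ?thesis using rc by (simp add: content_range_def content_def row_def col_def)
qed

lemma generic_nonzero:
  "generic \<kappa> \<Longrightarrow> content_range c \<Longrightarrow> content_range d \<Longrightarrow> 1 + \<kappa> * of_int (c - d) \<noteq> 0"
  by (auto simp: generic_def content_range_def simp del: of_int_diff)

text \<open>At an exponent of minimal weight in the support the operators act through Jucys-Murphy elements,
  so the exponent can be read off from the eigenvalues.\<close>
lemma eig_minimal:
  fixes F :: "expo \<Rightarrow> tableau \<Rightarrow> 'k::field_char_0"
  assumes F: "eig m \<kappa> F (\<lambda>i. of_nat (g0 i) + 1 + \<kappa> * of_int (d i))" and gen: "generic \<kappa>"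
    and d: "\<And>i. i \<in> {1..N} \<Longrightarrow> content_range (d i)" and g0: "g0 \<in> cube m" and ne: "F h \<noteq> (\<lambda>S. 0)"
  shows "F g0 \<noteq> (\<lambda>S. 0) \<and> wt g0 \<le> wt h"
proof -
  have ml: "mlin m F" and U: "\<And>i. i \<in> {1..N} \<Longrightarrow> ucal \<tau> \<kappa> i F = (\<lambda>g S. (of_nat (g0 i) + 1 + \<kappa> * of_int (d i)) * F g S)"
    using F by (auto simp: eig_def)
  obtain g where g: "F g \<noteq> (\<lambda>S. 0)" and min: "\<And>h. F h \<noteq> (\<lambda>S. 0) \<Longrightarrow> wt g \<le> wt h"
    using ex_has_least_nat[of "\<lambda>g. F g \<noteq> (\<lambda>S. 0)" h wt] ne by blast
  have gc: "g \<in> cube m" using mlin_outside[OF ml, of g] g by blast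
  have lower: "F (g \<circ> sw a b) = (\<lambda>S. 0)" if "a \<in> {1..N}" "b \<in> {1..N}" "a < b" "g a = 0" "g b = 1" for a b
    using min[of "g \<circ> sw a b"] wt_swap[OF that] that(3) by (cases "F (g \<circ> sw a b) = (\<lambda>S. 0)") auto
  let ?r = "rank N g"
  have r: "?r permutes {1..N}" using rank_compat_rank by (simp add: rank_compat_def)
  define u where "u = tau_perm \<tau> ?r (F g)"
  have u: "supp u" unfolding u_def by (rule tau_perm_supp[OF r mlin_supp[OF ml]])
  have ru: "tau_perm \<tau> (inv ?r) u = F g"
    using tau_perm_comp[OF permutes_inv[OF r] r mlin_supp[OF ml, of g]] permutes_inv_o(2)[OF r] mlin_supp[OF ml, of g]
    by (simp add: u_def)
  have "u \<noteq> (\<lambda>S. 0)" using ru g by auto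
  then obtain S where S: "u S \<noteq> 0" by auto
  then have SR: "S \<in> RSYT \<tau>" using u by (auto simp: supp_def)
  have "g0 i = g i" if i: "i \<in> {1..N}" for i
  proof -
    let ?c = "\<lambda>S. of_int (content \<tau> (?r i) S) :: 'k" and ?x = "of_nat (g0 i) + 1 + \<kappa> * of_int (d i)"
    have ri: "?r i \<in> {1..N}" using permutes_in_image[OF r] i by blast
    have "(\<lambda>S. ?x * F g S) = (\<lambda>S. (1 + of_nat (g i)) * F g S + \<kappa> * tau_perm \<tau> (inv ?r) (\<lambda>S. ?c S * u S) S)"
      using ucal_leading[OF ml gc i rank_compat_rank lower, of \<kappa>] U[OF i] by (simp add: u_def)
    then have "tau_perm \<tau> ?r (\<lambda>S. ?x * F g S) = tau_perm \<tau> ?r (\<lambda>S. (1 + of_nat (g i)) * F g S + \<kappa> * tau_perm \<tau> (inv ?r) (\<lambda>S. ?c S * u S) S)"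
      by simp
    moreover have "tau_perm \<tau> ?r (tau_perm \<tau> (inv ?r) (\<lambda>S. ?c S * u S)) = (\<lambda>S. ?c S * u S)"
      using tau_perm_comp[OF r permutes_inv[OF r] supp_scale[OF u, of ?c]] permutes_inv_o(1)[OF r] supp_scale[OF u, of ?c]
      by simp
    ultimately have "(\<lambda>S. ?x * u S) = (\<lambda>S. (1 + of_nat (g i)) * u S + \<kappa> * (?c S * u S))"
      unfolding tau_perm_scale tau_perm_lin by (simp add: u_def)
    from fun_cong[OF this, of S] have "?x * u S = (1 + of_nat (g i) + \<kappa> * ?c S) * u S"
      by (simp add: algebra_simps)
    then have eq: "?x = 1 + of_nat (g i) + \<kappa> * ?c S" using S by simp
    have cr: "content_range (content \<tau> (?r i) S)" by (rule content_range_content[OF SR ri])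
    have "g0 i \<le> 1" "g i \<le> 1" using g0 gc by (auto simp: cube_def)
    \<comment> \<open>Different exponents with equal eigenvalues would force \<open>\<kappa>\<close>
      times a difference of two contents to be -1, which \<open>generic\<close> excludes.\<close>
    then consider "g0 i = g i" | "g0 i = 1" "g i = 0" | "g0 i = 0" "g i = 1" by linarith
    then show ?thesis
    proof cases
      case 2
      then have "1 + \<kappa> * of_int (d i - content \<tau> (?r i) S) = 0" using eq by (simp add: algebra_simps)
      then show ?thesis using generic_nonzero[OF gen d[OF i] cr] by blast
    next
      case 3
      then have "1 + \<kappa> * of_int (content \<tau> (?r i) S - d i) = 0" using eq by (simp add: algebra_simps)
      then show ?thesis using generic_nonzero[OF gen cr d[OF i]] by blast
    qed
  qed
  moreover have "g0 i = g i" if "i \<notin> {1..N}" for i using that g0 gc by (auto simp: cube_def expo_ok_def)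
  ultimately have "g0 = g" by (intro ext) blast
  then show ?thesis using g min[OF ne] by simp
qed

text \<open>A permutation is determined by the order it induces, because q i is the number of j with
  q j at most q i. Ranks can therefore be identified by verifying an order instead of
  counting.\<close>

lemma rank_compat_unique:
  assumes "rank_compat g r" "rank_compat g r'"
  shows "r = r'"
proof
  fix i
  have card: "q i = card {j\<in>{1..N}. \<not> q i < q j}" if q: "q permutes {1..N}" and i: "i \<in> {1..N}" for q
  proof -
    have qi: "q i \<in> {1..N}" using permutes_in_image[OF q] i by blast
    have "q ` {j\<in>{1..N}. \<not> q i < q j} = {1..q i}"
    proof (intro equalityI subsetI)
      fix x assume "x \<in> q ` {j\<in>{1..N}. \<not> q i < q j}"
      then obtain j where "x = q j" "j \<in> {1..N}" "q j \<le> q i" by auto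
      then show "x \<in> {1..q i}" using permutes_in_image[OF q, of j] by auto
    next
      fix x assume x: "x \<in> {1..q i}"
      then have "x \<in> {1..N}" using qi by auto
      then have "inv q x \<in> {1..N}" "q (inv q x) = x"
        using permutes_in_image[OF permutes_inv[OF q]] permutes_inverses[OF q] by auto
      then show "x \<in> q ` {j\<in>{1..N}. \<not> q i < q j}" using x by (intro image_eqI[of _ _ "inv q x"]) auto
    qed
    moreover have "inj_on q A" for A using permutes_inj[OF q] by (auto intro: inj_on_subset)
    ultimately have "card {j\<in>{1..N}. \<not> q i < q j} = card {1..q i}" using card_image by metis
    then show ?thesis by simp
  qed
  show "r i = r' i"
  proof (cases "i \<in> {1..N}")
    case True
    then have "{j\<in>{1..N}. \<not> r i < r j} = {j\<in>{1..N}. \<not> r' i < r' j}"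
      using assms by (auto simp: rank_compat_def)
    then show ?thesis using card[of r] card[of r'] assms True by (simp add: rank_compat_def)
  next
    case False
    then show ?thesis using assms permutes_not_in[of r "{1..N}" i] permutes_not_in[of r' "{1..N}" i]
      by (simp add: rank_compat_def)
  qed
qed

section \<open>Jack polynomials with 0/1 exponents and their step-by-step construction\<close>

lemma rank_swap:
  assumes a: "1 \<le> a" "a < N" and ne: "g a \<noteq> g (a + 1)"
  shows "rank N (g \<circ> sw a (a + 1)) = rank N g \<circ> sw a (a + 1)"
proof (rule rank_compat_unique[OF rank_compat_rank])
  let ?s = "sw a (a + 1)" and ?r = "rank N g"
  have r: "?r permutes {1..N}" and c: "\<And>i j. i \<in> {1..N} \<Longrightarrow> j \<in> {1..N} \<Longrightarrow> 
      ?r i < ?r j \<longleftrightarrow> g j < g i \<or> g j = g i \<and> i < j"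
    using rank_compat_rank[of g] by (auto simp: rank_compat_def)
  have s: "?s permutes {1..N}" using simple_permutes[OF a] .
  have "?r (?s i) < ?r (?s j) \<longleftrightarrow> g (?s j) < g (?s i) \<or> g (?s j) = g (?s i) \<and> i < j"
    if ij: "i \<in> {1..N}" "j \<in> {1..N}" for i j
  proof -
    have "?s i \<in> {1..N}" "?s j \<in> {1..N}" using permutes_in_image[OF s] ij by blast+
    moreover have "?s i < ?s j \<longleftrightarrow> i < j" if "g (?s j) = g (?s i)"
      using that ne by (auto simp: sw_def split: if_splits)
    ultimately show ?thesis using c by blast
  qed
  then show "rank_compat (g \<circ> ?s) (?r \<circ> ?s)"
    using permutes_compose[OF s r] by (simp add: rank_compat_def)
qed

text \<open>Spectrum and leading coefficient replace triangularity: for generic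
  \<open>\<kappa>\<close> the spectrum already forbids exponents of smaller weight
  (\<open>jack_lower\<close>), and for the exponent \<open>block m\<close> triangularity amounts to
  support in \<open>cube m\<close>.\<close>

definition jack :: "nat \<Rightarrow> 'k::field_char_0 \<Rightarrow> expo \<Rightarrow> tableau \<Rightarrow> (expo \<Rightarrow> tableau \<Rightarrow> 'k) \<Rightarrow> bool" where
  "jack m \<kappa> g T Z \<longleftrightarrow>
     eig m \<kappa> Z (\<lambda>i. of_nat (g i) + 1 + \<kappa> * of_int (content \<tau> (rank N g i) T))
     \<and> Z g = tau_perm \<tau> (inv (rank N g)) (basis T)"

lemma supp_basis: "T \<in> RSYT \<tau> \<Longrightarrow> supp (basis T)"
  by (auto simp: supp_def basis_def)

lemma rank_permutes: "rank N g permutes {1..N}"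
  using rank_compat_rank by (simp add: rank_compat_def)

lemma content_range_rank:
  "T \<in> RSYT \<tau> \<Longrightarrow> i \<in> {1..N} \<Longrightarrow> content_range (content \<tau> (rank N g i) T)"
  using permutes_in_image[OF rank_permutes] by (intro content_range_content) auto

lemma tau_perm_inverse:
  assumes "p permutes {1..N}" "supp (v :: tableau \<Rightarrow> 'k::field_char_0)"
  shows "tau_perm \<tau> p (tau_perm \<tau> (inv p) v) = v"
  using tau_perm_comp[OF assms(1) permutes_inv[OF assms(1)] assms(2)] permutes_inv_o(1)[OF assms(1)] assms(2)
  by simp

lemma cube_comp_simple:
  "1 \<le> a \<Longrightarrow> a < N \<Longrightarrow> g \<circ> sw a (a + 1) \<in> cube m \<longleftrightarrow> g \<in> cube m"
  by (rule cube_comp[OF simple_permutes])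

lemma jack_eig: "jack m \<kappa> g T Z \<Longrightarrow> mlin m Z"
  by (simp add: jack_def eig_def)

lemma jack_lower:
  assumes "jack m \<kappa> g T Z" "generic \<kappa>" "T \<in> RSYT \<tau>" "g \<in> cube m" "wt h < wt g"
  shows "Z h = (\<lambda>S. 0)"
proof (rule ccontr)
  assume ne: "Z h \<noteq> (\<lambda>S. 0)"
  have "eig m \<kappa> Z (\<lambda>i. of_nat (g i) + 1 + \<kappa> * of_int (content \<tau> (rank N g i) T))"
    using assms(1) by (simp add: jack_def)
  from eig_minimal[where d = "\<lambda>i. content \<tau> (rank N g i) T", OF this assms(2) content_range_rank[OF assms(3)] assms(4) ne]
  show False using assms(5) by simp
qed

text \<open>The difference is an eigenfunction without leading coefficient, and by
  \<open>eig_minimal\<close> a nonzero one would have it.\<close>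

lemma jack_unique:
  assumes Z: "jack m \<kappa> g T Z" and Z': "jack m \<kappa> g T Z'" and "generic \<kappa>" "T \<in> RSYT \<tau>" "g \<in> cube m"
  shows "Z = Z'"
proof -
  let ?F = "\<lambda>h S. 1 * Z h S + (-1) * Z' h S"
  have "eig m \<kappa> ?F (\<lambda>i. of_nat (g i) + 1 + \<kappa> * of_int (content \<tau> (rank N g i) T))"
    using Z Z' by (intro eig_lin) (auto simp: jack_def)
  note min = eig_minimal[where d = "\<lambda>i. content \<tau> (rank N g i) T", OF this assms(3) content_range_rank[OF assms(4)] assms(5)]
  have "?F g = (\<lambda>S. 0)" using Z Z' by (simp add: jack_def)
  then have "?F h = (\<lambda>S. 0)" for h using min[of h] by blast
  then have "Z h S - Z' h S = 0" for h S by (simp add: fun_eq_iff)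
  then have "Z h S = Z' h S" for h S by simp
  then show ?thesis by blast
qed

text \<open>The coefficient of \<open>eig_step\<close> when g a = 0 and g (a + 1) = 1: the 1 in the
  denominator is the difference of the exponents.\<close>

definition jack_coeff :: "'k::field_char_0 \<Rightarrow> expo \<Rightarrow> tableau \<Rightarrow> nat \<Rightarrow> 'k" where
  "jack_coeff \<kappa> g T a = \<kappa> / (1 + \<kappa> * of_int (content \<tau> (rank N g (a + 1)) T - content \<tau> (rank N g a) T))"

text \<open>The new leading exponent has smaller weight than \<open>g\<close>, so \<open>Z\<close>
  vanishes there; the leading coefficient is merely transported by s_a and stays normalized.\<close>

lemma jack_step:
  fixes Z :: "expo \<Rightarrow> tableau \<Rightarrow> 'k::field_char_0"
  assumes Z: "jack m \<kappa> g T Z" and gen: "generic \<kappa>" and T: "T \<in> RSYT \<tau>" and g: "g \<in> cube m"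
    and a: "1 \<le> a" "a < N" and ga: "g a = 0" "g (a + 1) = 1"
  shows "jack m \<kappa> (g \<circ> sw a (a + 1)) T (\<lambda>h S. act (sw a (a + 1)) Z h S + jack_coeff \<kappa> g T a * Z h S)"
proof -
  let ?s = "sw a (a + 1)" and ?b = "jack_coeff \<kappa> g T a" and ?r = "rank N g"
  define \<xi> :: "nat \<Rightarrow> 'k" where "\<xi> = (\<lambda>i. of_nat (g i) + 1 + \<kappa> * of_int (content \<tau> (?r i) T))"
  have i: "a \<in> {1..N}" "a + 1 \<in> {1..N}" using a by auto
  have r: "?r permutes {1..N}" and s: "?s permutes {1..N}"
    using rank_permutes simple_permutes[OF a] by auto
  have "\<xi> (a + 1) - \<xi> a = 1 + \<kappa> * of_int (content \<tau> (?r (a + 1)) T - content \<tau> (?r a) T)"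
    using ga by (simp add: \<xi>_def algebra_simps)
  then have "?b * (\<xi> (a + 1) - \<xi> a) = \<kappa>"
    using generic_nonzero[OF gen content_range_rank[OF T i(2), of g] content_range_rank[OF T i(1), of g]]
    by (simp add: jack_coeff_def)
  moreover have "eig m \<kappa> Z \<xi>" using Z by (simp add: jack_def \<xi>_def)
  ultimately have "eig m \<kappa> (\<lambda>h S. act ?s Z h S + ?b * Z h S) (\<xi> \<circ> ?s)" using eig_step a by blast
  moreover have rs: "rank N (g \<circ> ?s) = ?r \<circ> ?s" using rank_swap[OF a, of g] ga by simp
  moreover have "Z (g \<circ> ?s) = (\<lambda>S. 0)"
    using jack_lower[OF Z gen T g, of "g \<circ> ?s"] wt_swap[OF i, of g] ga by simp
  moreover have "act ?s Z (g \<circ> ?s) = tau_perm \<tau> (inv (?r \<circ> ?s)) (basis T)"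
  proof -
    have "g \<circ> ?s \<circ> ?s = g" by (auto simp: fun_eq_iff)
    moreover have "inv (?r \<circ> ?s) = ?s \<circ> inv ?r"
    proof -
      have "inv ?s = ?s" by (rule inv_unique_comp) (auto simp: fun_eq_iff)
      then show ?thesis using o_inv_distrib[OF permutes_bij[OF r] permutes_bij[OF s]] by simp
    qed
    ultimately show ?thesis 
      using tau_perm_comp[OF s permutes_inv[OF r] supp_basis[OF T, where 'a = 'k]] Z by (simp add: act_def jack_def)
  qed
  ultimately show ?thesis by (simp add: jack_def \<xi>_def comp_def)
qed

lemma ucal_outside:
  fixes F :: "expo \<Rightarrow> tableau \<Rightarrow> 'k::field_char_0"
  assumes F: "mlin m F" and i: "i \<in> {1..N}" and h: "h \<notin> cube m"
  shows "ucal \<tau> \<kappa> i F h = (\<lambda>S. 0)"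
proof -
  have 0: "F (h \<circ> sw i j) = (\<lambda>S. 0)" if "j \<in> {1..N}" for j
    using mlin_outside[OF F, of "h \<circ> sw i j"] cube_comp[OF sw_permutes[OF i that]] h by blast
  have 1: "om i F h S = 0" for S
    unfolding om_def act_def by (rule sum.neutral) (use 0 i in auto)
  have 2: "mulx i (dunkl \<tau> \<kappa> i F) h S = 0" for S
  proof (cases "h i = 1")
    case True
    then have hi: "h(i := 0, i := 1) = h" "h(i := Suc 0) = h" by auto
    have "mdiff i j F (h(i := 0)) = (\<lambda>S. 0)" if "j \<in> {1..N} - {i}" for j
    proof -
      have "h(i := 0, j := 1) = h \<circ> sw i j" if "h j = 0" using comp_sw[of i j h] \<open>j \<in> {1..N} - {i}\<close> True that by simp
      then show ?thesis unfolding mdiff_def hi(1) using 0[of j] that mlin_outside[OF F h] by (cases "h j = 0") simp_all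
    qed
    then show ?thesis using True hi mlin_outside[OF F h] by (simp add: mulx_def dunkl_mlin[OF F])
  qed (auto simp: mulx_def dunkl_mlin[OF F])
  show ?thesis using 1 2 mlin_outside[OF F h] by (simp add: ucal_mlin[OF F i])
qed

definition jack_base :: "expo \<Rightarrow> tableau \<Rightarrow> expo \<Rightarrow> tableau \<Rightarrow> 'k::field_char_0" where
  "jack_base g T = (\<lambda>h. if h = g then tau_perm \<tau> (inv (rank N g)) (basis T) else (\<lambda>S. 0))"

text \<open>Moving a one to the left never produces a nondecreasing exponent, so
  \<open>ucal_leading\<close> applies at every exponent and the single leading term is an
  eigenfunction.\<close>

lemma jack_base:
  fixes \<kappa> :: "'k::field_char_0"
  assumes T: "T \<in> RSYT \<tau>" and g: "g \<in> cube m"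
    and incr: "\<And>a b. a \<in> {1..N} \<Longrightarrow> b \<in> {1..N} \<Longrightarrow> a < b \<Longrightarrow> g a \<le> g b"
  shows "jack m \<kappa> g T (jack_base g T)"
proof -
  let ?Z = "jack_base g T :: expo \<Rightarrow> tableau \<Rightarrow> 'k"
  have "supp (tau_perm \<tau> (inv (rank N g)) (basis T) :: tableau \<Rightarrow> 'k)"
    by (rule tau_perm_supp[OF permutes_inv[OF rank_permutes] supp_basis[OF T]])
  then have Zs: "supp (?Z h)" for h by (simp add: jack_base_def)
  have ml: "mlin m ?Z" using Zs g by (auto simp: mlin_def jack_base_def)
  have "ucal \<tau> \<kappa> i ?Z h = (\<lambda>S. (of_nat (g i) + 1 + \<kappa> * of_int (content \<tau> (rank N g i) T)) * ?Z h S)"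
    if i: "i \<in> {1..N}" for i h
  proof (cases "h \<in> cube m")
    case True
    have lower: "?Z (h \<circ> sw a b) = (\<lambda>S. 0)" if ab: "a \<in> {1..N}" "b \<in> {1..N}" "a < b" "h a = 0" "h b = 1" for a b
    proof -
      have "h \<circ> sw a b \<noteq> g"
        using incr[of a b] ab by (auto simp: sw_def dest!: fun_cong[of _ g])
      then show ?thesis by (simp add: jack_base_def)
    qed
    let ?r = "rank N h"
    have U: "ucal \<tau> \<kappa> i ?Z h = (\<lambda>S. (1 + of_nat (h i)) * ?Z h S
      + \<kappa> * tau_perm \<tau> (inv ?r) (\<lambda>S. of_int (content \<tau> (?r i) S) * tau_perm \<tau> ?r (?Z h) S) S)"
      by (rule ucal_leading[OF ml True i rank_compat_rank lower])
    show ?thesis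
    proof (cases "h = g")
      case True
      have "tau_perm \<tau> ?r (?Z h) = basis T"
        using tau_perm_inverse[OF rank_permutes supp_basis[OF T, where 'a = 'k]] True by (simp add: jack_base_def)
      moreover have "(\<lambda>S. of_int (content \<tau> (?r i) S) * basis T S) 
        = (\<lambda>S. of_int (content \<tau> (?r i) T) * basis T S :: 'k)"
        by (auto simp: basis_def)
      ultimately have "tau_perm \<tau> (inv ?r) (\<lambda>S. of_int (content \<tau> (?r i) S) * tau_perm \<tau> ?r (?Z h) S)
        = (\<lambda>S. of_int (content \<tau> (?r i) T) * tau_perm \<tau> (inv ?r) (basis T) S)"
        by (simp add: tau_perm_scale)
      then show ?thesis unfolding U using True by (simp add: jack_base_def algebra_simps)
    next
      case False
      then have "?Z h = (\<lambda>S. 0)" by (simp add: jack_base_def)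
      then show ?thesis unfolding U by simp
    qed
  next
    case False
    then show ?thesis using ucal_outside[OF ml i False] mlin_outside[OF ml False] by simp
  qed
  then show ?thesis using ml by (auto simp: jack_def eig_def jack_base_def)
qed

end

section \<open>Specialization of rational functions\<close>

text \<open>\<open>no_pole\<close> and \<open>eval_at\<close> in one relation, so that regularity
  and value pass together through the field operations.\<close>

definition specializes :: "real \<Rightarrow> ratfun \<Rightarrow> real \<Rightarrow> bool" where
  "specializes a r v \<longleftrightarrow> (\<exists>p q. poly q a \<noteq> 0 \<and> r = Fract p q \<and> v = poly p a / poly q a)"

lemma poly_nonzero: "poly q a \<noteq> 0 \<Longrightarrow> q \<noteq> 0"
  by auto

lemma specializes_unique:
  assumes "specializes a r v" "specializes a r w"
  shows "v = w"
proof -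
  obtain p q p' q' where pq: "poly q a \<noteq> 0" "r = Fract p q" "v = poly p a / poly q a"
    "poly q' a \<noteq> 0" "r = Fract p' q'" "w = poly p' a / poly q' a"
    using assms unfolding specializes_def by blast
  then have "p * q' = p' * q" using eq_fract(1)[of q q' p p'] poly_nonzero by metis
  then have "poly p a * poly q' a = poly p' a * poly q a" by (metis poly_mult)
  then show ?thesis using pq(1,4) unfolding pq(3,6) by (simp add: frac_eq_eq)
qed

lemma specializes_no_pole: "specializes a r v \<Longrightarrow> no_pole a r"
  by (auto simp: specializes_def no_pole_def)

lemma specializes_eval_at: "specializes a r v \<Longrightarrow> eval_at a r = v"
  using specializes_unique[of a r] unfolding eval_at_def specializes_def[symmetric] by blast

lemma specializes_add:
  assumes "specializes a r v" "specializes a s w"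
  shows "specializes a (r + s) (v + w)"
proof -
  obtain p q p' q' where pq: "poly q a \<noteq> 0" "r = Fract p q" "v = poly p a / poly q a"
    "poly q' a \<noteq> 0" "s = Fract p' q'" "w = poly p' a / poly q' a"
    using assms unfolding specializes_def by blast
  then have "r + s = Fract (p * q' + p' * q) (q * q')" using poly_nonzero by (metis add_fract)
  moreover have "v + w = poly (p * q' + p' * q) a / poly (q * q') a"
    using pq(1,4) unfolding pq(3,6) by (simp add: add_frac_eq)
  ultimately show ?thesis using pq unfolding specializes_def 
    by (intro exI[of _ "p * q' + p' * q"] exI[of _ "q * q'"]) simp
qed

lemma specializes_mult:
  assumes "specializes a r v" "specializes a s w"
  shows "specializes a (r * s) (v * w)"
proof -
  obtain p q p' q' where pq: "poly q a \<noteq> 0" "r = Fract p q" "v = poly p a / poly q a"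
    "poly q' a \<noteq> 0" "s = Fract p' q'" "w = poly p' a / poly q' a"
    using assms unfolding specializes_def by blast
  then show ?thesis unfolding specializes_def 
    by (intro exI[of _ "p * p'"] exI[of _ "q * q'"]) simp
qed

lemma specializes_inverse:
  assumes "specializes a r v" "v \<noteq> 0"
  shows "specializes a (inverse r) (inverse v)"
proof -
  obtain p q where pq: "poly q a \<noteq> 0" "r = Fract p q" "v = poly p a / poly q a"
    using assms unfolding specializes_def by blast
  then show ?thesis unfolding specializes_def using assms(2)
    by (intro exI[of _ q] exI[of _ p]) simp
qed

lemma specializes_divide:
  "specializes a r v \<Longrightarrow> specializes a s w \<Longrightarrow> w \<noteq> 0 \<Longrightarrow> specializes a (r / s) (v / w)"
  unfolding divide_inverse by (intro specializes_mult specializes_inverse)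

lemma specializes_of_int: "specializes a (of_int n) (of_int n)"
proof -
  have nat: "of_nat k = Fract (of_nat k :: real poly) 1" for k by (rule of_nat_fract)
  have "of_int n = Fract (of_int n :: real poly) 1"
  proof (cases n)
    case (nonneg k)
    then show ?thesis using nat by simp
  next
    case (neg k)
    then show ?thesis using nat[of "Suc k"] by (simp del: of_nat_Suc)
  qed
  then show ?thesis unfolding specializes_def by (intro exI[of _ "of_int n"] exI[of _ 1]) simp
qed

lemma specializes_0: "specializes a 0 0" and specializes_1: "specializes a 1 1"
  using specializes_of_int[of a 0] specializes_of_int[of a 1] by simp_all

lemma specializes_uminus: "specializes a r v \<Longrightarrow> specializes a (- r) (- v)"
  using specializes_mult[OF specializes_of_int[of a "-1"]] by fastforce

lemma specializes_diff: "specializes a r v \<Longrightarrow> specializes a s w \<Longrightarrow> specializes a (r - s) (v - w)"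
  using specializes_add[OF _ specializes_uminus] by fastforce

lemma specializes_kappa: "specializes a kappa a"
  unfolding specializes_def kappa_def by (intro exI[of _ "[:0, 1:]"] exI[of _ 1]) simp

lemma specializes_sum:
  "(\<And>x. x \<in> A \<Longrightarrow> specializes a (f x) (g x)) \<Longrightarrow> specializes a (sum f A) (sum g A)"
  by (induction A rule: infinite_finite_induct) (auto intro: specializes_0 specializes_add)

lemma specializes_basis: "specializes a (basis T S) (basis T S)"
  by (simp add: basis_def specializes_0 specializes_1)

text \<open>The same expression in two fields, \<open>ratfun\<close> first and \<open>real\<close>
  second: the representation does not involve \<open>kappa\<close>.\<close>

lemma specializes_tau_s: "specializes a (tau_s \<tau> k T S) (tau_s \<tau> k T S)"
proof -
  \<comment> \<open>Division by zero yields zero in both fields, so b = 0 can stay.\<close>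
  have div: "specializes a (1 / of_int b) (1 / of_int b)" for b
    by (cases "b = 0") (auto intro: specializes_0 specializes_1 specializes_divide specializes_of_int)
  have div2: "specializes a (1 - 1 / (of_int b)^2) (1 - 1 / (of_int b)^2)" for b
    using specializes_diff[OF specializes_1 specializes_mult[OF div[of b] div[of b]]]
    by (simp add: power2_eq_square)
  note intros = specializes_basis specializes_add specializes_mult specializes_uminus div div2
  let ?b = "content \<tau> k T - content \<tau> (k + 1) T"
  show ?thesis
    unfolding tau_s_def Let_def
    by (cases "row \<tau> k T = row \<tau> (k + 1) T"; cases "col \<tau> k T = col \<tau> (k + 1) T"; cases "2 \<le> ?b")
      (simp_all only: if_True if_False simp_thms intros)
qed

lemma specializes_tau_perm:
  assumes "\<And>S. specializes a (v S) (w S)"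
  shows "specializes a (tau_perm \<tau> p v S) (tau_perm \<tau> p w S)"
proof -
  have "specializes a (word_act (apply_s \<tau>) u v S) (word_act (apply_s \<tau>) u w S)" for u S
  proof (induction u arbitrary: S)
    case (Cons x u)
    then show ?case by (simp add: apply_s_def specializes_sum specializes_mult specializes_tau_s)
  qed (simp add: assms)
  then show ?thesis by (simp add: tau_perm_def word_act_def)
qed

section \<open>Parallel construction over rational functions and at a number\<close>

context shape
begin

text \<open>Specializing 1 + \<open>kappa\<close> n at 0 gives 1, so it is not the zero
  function.\<close>

lemma generic_kappa: "generic kappa"
  unfolding generic_def
proof (intro allI impI notI)
  fix n :: int
  assume "1 + kappa * of_int n = 0"
  moreover have "specializes 0 (1 + kappa * of_int n) (1 + 0 * of_int n)"
    by (intro specializes_add specializes_mult specializes_1 specializes_kappa specializes_of_int)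
  ultimately show False using specializes_unique[OF specializes_0[of 0]] by fastforce
qed

lemma wt_bound:
  assumes "g \<in> cube m"
  shows "wt g \<le> (\<Sum>i\<in>{1..N}. i)"
  unfolding wt_def by (rule sum_mono) (use assms in \<open>auto simp: cube_def intro: order_trans[OF mult_le_mono2]\<close>)

text \<open>The induction runs from large weight to small: an exponent with a descent is reached by
  \<open>jack_step\<close> from the one with that descent undone, and one without descents is
  covered by \<open>jack_base\<close>. No pole arises because the denominator of each
  \<open>jack_coeff\<close> specializes to a number that \<open>generic\<close> keeps away from
  zero.\<close>

lemma jack_exists:
  assumes k: "generic k" and T: "T \<in> RSYT \<tau>"
  shows "g \<in> cube m \<Longrightarrow> \<exists>Z Z'. jack m kappa g T Z \<and> jack m k g T Z' \<and> (\<forall>h S. specializes k (Z h S) (Z' h S))"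
proof (induction "(\<Sum>i\<in>{1..N}. i) - wt g" arbitrary: g rule: less_induct)
  case less
  show ?case
  proof (cases "\<forall>a. 1 \<le> a \<and> a < N \<longrightarrow> g a \<le> g (a + 1)")
    case True
    have incr: "g a \<le> g b" if "a \<in> {1..N}" "b \<in> {1..N}" "a < b" for a b
    proof -
      have "a \<le> b" "b \<le> N" using that by auto
      then show ?thesis
      proof (induction b rule: dec_induct)
        case (step b)
        then show ?case using True that(1) by (metis Suc_eq_plus1 Suc_leD Suc_le_lessD atLeastAtMost_iff le_trans)
      qed simp
    qed
    have "specializes k (jack_base g T h S) (jack_base g T h S)" for h S
      using specializes_tau_perm[of k "basis T" "basis T"] by (simp add: jack_base_def specializes_0 specializes_basis)
    then show ?thesis
      by (intro exI[of _ "jack_base g T"] conjI allI jack_base[OF T less.prems incr])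
  next
    case False
    then obtain a where a: "1 \<le> a" "a < N" "g (a + 1) < g a" by (auto simp: not_le)
    let ?s = "sw a (a + 1)" and ?g = "g \<circ> sw a (a + 1)"
    have "g a \<le> 1" using less.prems by (simp add: cube_def)
    then have ga: "g a = 1" "g (a + 1) = 0" using a by auto
    then have ga': "?g a = 0" "?g (a + 1) = 1" by (simp_all add: sw_def)
    have gc: "?g \<in> cube m" using less.prems cube_comp_simple a by simp
    have gg: "?g \<circ> ?s = g" by (auto simp: fun_eq_iff)
    have "wt g + (a + 1) = wt ?g + a"
      using wt_swap[of a "a + 1" ?g] a ga' gg by simp
    then have "(\<Sum>i\<in>{1..N}. i) - wt ?g < (\<Sum>i\<in>{1..N}. i) - wt g" using wt_bound[OF gc] by linarith
    from less.hyps[OF this gc] obtain Z Z' where Z: "jack m kappa ?g T Z" "jack m k ?g T Z'"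
      "\<And>h S. specializes k (Z h S) (Z' h S)" by blast
    let ?b = "jack_coeff kappa ?g T a" and ?b' = "jack_coeff k ?g T a"
    have i: "a \<in> {1..N}" "a + 1 \<in> {1..N}" using a by auto
    have b: "specializes k ?b ?b'"
      unfolding jack_coeff_def using generic_nonzero[OF k content_range_rank[OF T i(2), of ?g] content_range_rank[OF T i(1), of ?g]]
      by (intro specializes_divide specializes_add specializes_mult specializes_1 specializes_kappa specializes_of_int)
    have s: "specializes k (act ?s Z h S + ?b * Z h S) (act ?s Z' h S + ?b' * Z' h S)" for h S
      unfolding act_def by (intro specializes_add specializes_mult specializes_tau_perm Z b)
    show ?thesis
      using jack_step[OF Z(1) generic_kappa T gc a(1,2) ga'] jack_step[OF Z(2) k T gc a(1,2) ga']
      unfolding gg by (intro exI conjI allI) (assumption, assumption, rule s)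
  qed
qed

end

section \<open>Columns of the diagram and the tableau \<open>T0\<close>\<close>

lemma down_closed_interval:
  assumes "finite K" "\<And>k. k \<in> K \<Longrightarrow> 1 \<le> k" "\<And>k i. k \<in> K \<Longrightarrow> 1 \<le> i \<Longrightarrow> i \<le> k \<Longrightarrow> i \<in> K"
  shows "K = {1..card K}"
proof (cases "K = {}")
  case False
  define M where "M = Max K"
  have "M \<in> K" using Max_in[OF assms(1) False] by (simp add: M_def)
  have "K = {1..M}"
  proof (intro equalityI subsetI)
    fix k assume "k \<in> K"
    then show "k \<in> {1..M}" using assms(2)[of k] Max_ge[OF assms(1), of k] by (simp add: M_def)
  next
    fix k assume "k \<in> {1..M}"
    then show "k \<in> K" using assms(3)[OF \<open>M \<in> K\<close>, of k] by simp
  qed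
  then show ?thesis by simp
qed simp

context shape
begin

lemma col_len_iff: "(i, j) \<in> D \<longleftrightarrow> 1 \<le> j \<and> 1 \<le> i \<and> i \<le> col_len \<tau> j"
proof (cases "1 \<le> j")
  case True
  let ?K = "{k. 1 \<le> k \<and> k \<le> length \<tau> \<and> j \<le> part \<tau> k}"
  have "?K = {1..card ?K}"
  proof (rule down_closed_interval)
    fix k i assume "k \<in> ?K" "1 \<le> i" "i \<le> k"
    then show "i \<in> ?K" using part_antimono[of i k] by auto
  qed auto
  moreover have "(i, j) \<in> D \<longleftrightarrow> i \<in> ?K" using True by (auto simp: diagram_def)
  ultimately show ?thesis using True unfolding col_len_def by (metis (no_types, lifting) atLeastAtMost_iff)
qed (auto simp: diagram_def)

definition csum :: "nat \<Rightarrow> nat" where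
  "csum j = (\<Sum>c\<in>{1..<j}. col_len \<tau> c)"

lemma csum_Suc: "1 \<le> j \<Longrightarrow> csum (j + 1) = csum j + col_len \<tau> j"
  by (simp add: csum_def)

lemma csum_mono: "j \<le> j' \<Longrightarrow> csum j \<le> csum j'"
  unfolding csum_def by (rule sum_mono2) auto

lemma csum_total: "csum (part \<tau> 1 + 1) = N"
proof -
  have "D = (\<lambda>(j, i). (i, j)) ` (SIGMA j:{1..part \<tau> 1}. {1..col_len \<tau> j})"
  proof (intro equalityI subsetI)
    fix x assume x: "x \<in> D"
    obtain i j where ij: "x = (i, j)" by fastforce
    then have "j \<le> part \<tau> i" "1 \<le> i" using x by (auto simp: diagram_def)
    then have "j \<le> part \<tau> 1" using part_antimono[of 1 i] by simp
    then show "x \<in> (\<lambda>(j, i). (i, j)) ` (SIGMA j:{1..part \<tau> 1}. {1..col_len \<tau> j})"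
      using x ij col_len_iff[of i j] by (intro image_eqI[of _ _ "(j, i)"]) auto
  qed (auto simp: col_len_iff)
  then have "card D = card (SIGMA j:{1..part \<tau> 1}. {1..col_len \<tau> j})"
    by (simp add: card_image inj_on_def split_def prod_eq_iff)
  then show ?thesis by (simp add: card_diagram csum_def atLeastLessThanSuc_atLeastAtMost)
qed

lemma csum_cell:
  assumes "(i, j) \<in> D"
  shows "csum j + i \<le> csum (j + 1)" "csum j + i \<le> N"
proof -
  show 1: "csum j + i \<le> csum (j + 1)" using assms csum_Suc[of j] by (simp add: col_len_iff)
  have "1 \<le> i" "j \<le> part \<tau> i" using assms by (auto simp: diagram_def)
  then have "j \<le> part \<tau> 1" using part_antimono[of 1 i] by simp
  then have "csum (j + 1) \<le> N" using csum_mono[of "j + 1" "part \<tau> 1 + 1"] csum_total by simp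
  then show "csum j + i \<le> N" using 1 by simp
qed

text \<open>Additive form, free of the truncated subtractions in \<open>T0\<close>.\<close>

lemma T0_eq: "(i, j) \<in> D \<Longrightarrow> T0 \<tau> (i, j) + csum j + i = N + 1"
  using csum_cell(2)[of i j] diagram_pos[of i j] by (auto simp: T0_def csum_def)

lemma T0_RSYT: "T0 \<tau> \<in> RSYT \<tau>"
proof -
  have inj: "inj_on (T0 \<tau>) D"
  proof (rule inj_onI)
    fix x y assume xy: "x \<in> D" "y \<in> D" "T0 \<tau> x = T0 \<tau> y"
    obtain i j where x: "x = (i, j)" by fastforce
    obtain i' j' where y: "y = (i', j')" by fastforce
    have eq: "csum j + i = csum j' + i'" using T0_eq[of i j] T0_eq[of i' j'] xy x y by simp
    have pos: "1 \<le> i" "1 \<le> i'" using diagram_pos xy x y by blast+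
    have "\<not> j < j'" using csum_cell(1)[of i j] csum_mono[of "j + 1" j'] xy x y eq pos by auto
    moreover have "\<not> j' < j" using csum_cell(1)[of i' j'] csum_mono[of "j' + 1" j] xy x y eq pos by auto
    ultimately show "x = y" using x y eq by auto
  qed
  have "T0 \<tau> ` D \<subseteq> {1..N}"
  proof
    fix v assume "v \<in> T0 \<tau> ` D"
    then obtain i j where "(i, j) \<in> D" "v = T0 \<tau> (i, j)" by auto
    then show "v \<in> {1..N}" using T0_eq[of i j] csum_cell(2)[of i j] diagram_pos[of i j] by auto
  qed
  then have "T0 \<tau> ` D = {1..N}"
    using card_subset_eq[of "{1..N}" "T0 \<tau> ` D"] card_image[OF inj] card_diagram by simp
  then have bij: "bij_betw (T0 \<tau>) D {1..N}" using inj by (simp add: bij_betw_def)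
  moreover have "T0 \<tau> (i, j + 1) < T0 \<tau> (i, j)" if "(i, j) \<in> D" "(i, j + 1) \<in> D" for i j
    using T0_eq[OF that(1)] T0_eq[OF that(2)] csum_cell(1)[OF that(1)] diagram_pos[OF that(1)] by linarith
  moreover have "T0 \<tau> (i + 1, j) < T0 \<tau> (i, j)" if "(i, j) \<in> D" "(i + 1, j) \<in> D" for i j
    using T0_eq[OF that(1)] T0_eq[OF that(2)] by linarith
  moreover have "T0 \<tau> c = 0" if "c \<notin> D" for c using that by (auto simp: T0_def split: prod.splits)
  ultimately show ?thesis by (simp add: RSYT_def is_RSYT_def)
qed

end

section \<open>The block of equal rows and its exponent\<close>

definition block :: "nat \<Rightarrow> expo" where
  "block m = (\<lambda>i. if 1 \<le> i \<and> i \<le> m then 1 else 0)"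

locale top_block = shape +
  fixes m :: nat
  assumes two_columns: "2 \<le> part \<tau> 1"
    and m: "1 \<le> m" "m \<le> length \<tau>"
    and equal_rows: "\<And>i. 1 \<le> i \<Longrightarrow> i \<le> m \<Longrightarrow> part \<tau> i = part \<tau> 1"
    and next_row: "part \<tau> (m + 1) < part \<tau> 1"
begin

lemma col_len_last: "col_len \<tau> (part \<tau> 1) = m"
proof -
  have "{k. 1 \<le> k \<and> k \<le> length \<tau> \<and> part \<tau> 1 \<le> part \<tau> k} = {1..m}"
  proof (intro equalityI subsetI)
    fix k assume k: "k \<in> {k. 1 \<le> k \<and> k \<le> length \<tau> \<and> part \<tau> 1 \<le> part \<tau> k}"
    show "k \<in> {1..m}"
    proof (rule ccontr)
      assume "k \<notin> {1..m}"
      then have "m + 1 \<le> k" using k by auto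
      then show False using part_antimono[of "m + 1" k] next_row k by auto
    qed
  next
    fix k assume "k \<in> {1..m}"
    then show "k \<in> {k. 1 \<le> k \<and> k \<le> length \<tau> \<and> part \<tau> 1 \<le> part \<tau> k}"
      using m equal_rows[of k] by simp
  qed
  then show ?thesis by (simp add: col_len_def)
qed

lemma part_pos: "1 \<le> k \<Longrightarrow> k \<le> length \<tau> \<Longrightarrow> 1 \<le> part \<tau> k"
  using partition by (auto simp: part_def is_partition_def Suc_le_eq)

lemma col_len_first: "col_len \<tau> 1 = length \<tau>"
proof -
  have "{k. 1 \<le> k \<and> k \<le> length \<tau> \<and> 1 \<le> part \<tau> k} = {1..length \<tau>}" using part_pos by auto
  then show ?thesis by (simp add: col_len_def)
qed

lemma csum_last: "csum (part \<tau> 1) + m = N"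
  using csum_Suc[of "part \<tau> 1"] csum_total two_columns col_len_last by simp

text \<open>With at least two columns, the first and the last are disjoint, and they have
  \<open>length \<tau>\<close> and \<open>m\<close> cells. This places the critical position N - l
  at or beyond \<open>m\<close>.\<close>

lemma size_bound: "length \<tau> + m \<le> N"
proof -
  have "csum 2 = length \<tau>" using col_len_first by (simp add: csum_def numeral_2_eq_2)
  then show ?thesis using csum_mono[OF two_columns] csum_last by simp
qed

lemma cell_of_T0_last:
  assumes "k \<in> {1..m}"
  shows "cell_of \<tau> k (T0 \<tau>) = (m + 1 - k, part \<tau> 1)"
proof (rule cell_of_eq[OF RSYT_fill[OF T0_RSYT]])
  show in_D: "(m + 1 - k, part \<tau> 1) \<in> D" using assms two_columns by (auto simp: col_len_iff col_len_last[simplified])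
  show "T0 \<tau> (m + 1 - k, part \<tau> 1) = k" using T0_eq[OF in_D] csum_last assms by auto
qed

lemma cell_of_T0_first: "cell_of \<tau> (N + 1 - length \<tau>) (T0 \<tau>) = (length \<tau>, 1)"
proof (rule cell_of_eq[OF RSYT_fill[OF T0_RSYT]])
  show in_D: "(length \<tau>, 1) \<in> D" using m by (auto simp: col_len_iff col_len_first[simplified])
  show "T0 \<tau> (length \<tau>, 1) = N + 1 - length \<tau>" using T0_eq[OF in_D] by (simp add: csum_def)
qed

abbreviation \<alpha> :: expo where "\<alpha> \<equiv> block m"

lemma block_in_cube: "\<alpha> \<in> cube m"
proof -
  have "(\<Sum>i\<in>{1..N}. \<alpha> i) = (\<Sum>i\<in>{1..m}. 1)"
    using size_bound by (intro sum.mono_neutral_cong_right) (auto simp: block_def)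
  then show ?thesis using size_bound by (auto simp: cube_def expo_ok_def block_def)
qed

lemma rank_block: "rank N \<alpha> = id"
proof (rule rank_compat_unique[OF rank_compat_rank])
  show "rank_compat \<alpha> id" by (auto simp: rank_compat_def permutes_id block_def)
qed

end

section \<open>Sorting exponents; the dominance order below the block exponent\<close>

context shape
begin

definition antitone :: "expo \<Rightarrow> bool" where
  "antitone f \<longleftrightarrow> (\<forall>i j. 1 \<le> i \<longrightarrow> i \<le> j \<longrightarrow> j \<le> N \<longrightarrow> f j \<le> f i)"

text \<open>At the threshold t = f i, at least i values of \<open>f'\<close> lie above, but at most
  i - 1 values of \<open>f\<close>.\<close>

lemma antitone_less_aux:
  assumes "antitone f" "antitone f'"
    and "\<And>t. card {i\<in>{1..N}. t < f i} = card {i\<in>{1..N}. t < f' i}"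
    and i: "i \<in> {1..N}"
  shows "\<not> f i < f' i"
proof
  assume lt: "f i < f' i"
  have "{1..i} \<subseteq> {k\<in>{1..N}. f i < f' k}"
  proof
    fix k assume k: "k \<in> {1..i}"
    then have "f' i \<le> f' k" using assms(2) i by (auto simp: antitone_def)
    then show "k \<in> {k\<in>{1..N}. f i < f' k}" using lt k i by auto
  qed
  from card_mono[OF _ this] have 1: "i \<le> card {k\<in>{1..N}. f i < f' k}" by simp
  have "{k\<in>{1..N}. f i < f k} \<subseteq> {1..<i}"
  proof
    fix k assume k: "k \<in> {k\<in>{1..N}. f i < f k}"
    then have "\<not> i \<le> k" using assms(1) i unfolding antitone_def by (metis (no_types, lifting) atLeastAtMost_iff leD mem_Collect_eq)
    then show "k \<in> {1..<i}" using k by auto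
  qed
  from card_mono[OF _ this] have 2: "card {k\<in>{1..N}. f i < f k} \<le> i - 1" by simp
  show False using 1 2 assms(3)[of "f i"] i by auto
qed

lemma antitone_unique:
  assumes "antitone f" "antitone f'" "expo_ok N f" "expo_ok N f'"
    and "\<And>t. card {i\<in>{1..N}. t < f i} = card {i\<in>{1..N}. t < f' i}"
  shows "f = f'"
proof
  fix i
  show "f i = f' i"
  proof (cases "i \<in> {1..N}")
    case True
    then show ?thesis using antitone_less_aux[of f f' i] antitone_less_aux[of f' f i] assms by force
  next
    case False
    then show ?thesis using assms by (simp add: expo_ok_def)
  qed
qed

lemma card_above_bij:
  assumes "bij_betw \<sigma> {1..N} {1..N}" "\<And>i. i \<in> {1..N} \<Longrightarrow> f i = h (\<sigma> i)"
  shows "card {i\<in>{1..N}. t < f i} = card {i\<in>{1..N}. (t::nat) < h i}"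
proof (rule bij_betw_same_card[of \<sigma>])
  show "bij_betw \<sigma> {i\<in>{1..N}. t < f i} {i\<in>{1..N}. t < h i}"
  proof (rule bij_betw_subset[OF assms(1)])
    show "\<sigma> ` {i\<in>{1..N}. t < f i} = {i\<in>{1..N}. t < h i}"
    proof (intro equalityI subsetI)
      fix k assume "k \<in> \<sigma> ` {i\<in>{1..N}. t < f i}"
      then obtain i where i: "k = \<sigma> i" "i \<in> {1..N}" "t < f i" by blast
      then have "k \<in> {1..N}" "t < h k" using bij_betwE[OF assms(1)] assms(2)[of i] by simp_all
      then show "k \<in> {i\<in>{1..N}. t < h i}" by blast
    next
      fix k assume k: "k \<in> {i\<in>{1..N}. t < h i}"
      then have "k \<in> \<sigma> ` {1..N}" using bij_betw_imp_surj_on[OF assms(1)] by blast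
      then obtain i where i: "k = \<sigma> i" "i \<in> {1..N}" by blast
      then have "t < f i" using assms(2)[of i] k by simp
      then show "k \<in> \<sigma> ` {i\<in>{1..N}. t < f i}" using i by blast
    qed
  qed auto
qed

lemma antitone_rank: "antitone (h \<circ> inv (rank N h))"
  unfolding antitone_def
proof (intro allI impI)
  fix i j :: nat assume ij: "1 \<le> i" "i \<le> j" "j \<le> N"
  let ?r = "rank N h"
  have r: "?r permutes {1..N}" by (rule rank_permutes)
  have "inv ?r i \<in> {1..N}" "inv ?r j \<in> {1..N}"
    using permutes_in_image[OF permutes_inv[OF r]] ij by auto
  then have "?r (inv ?r i) < ?r (inv ?r j) \<longrightarrow> h (inv ?r j) \<le> h (inv ?r i)"
    using rank_compat_rank[of h] unfolding rank_compat_def by fastforce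
  then show "(h \<circ> inv ?r) j \<le> (h \<circ> inv ?r) i"
    using permutes_inverses(1)[OF r] ij by (cases "i = j") auto
qed

text \<open>Ranks list positions by decreasing exponent, so the inverse rank permutation sorts;
  \<open>antitone_unique\<close> settles the \<open>THE\<close>.\<close>

lemma plus_part_eq:
  assumes h: "expo_ok N h"
  shows "plus_part N h = h \<circ> inv (rank N h)"
proof -
  let ?f = "h \<circ> inv (rank N h)"
  have w: "inv (rank N h) permutes {1..N}" by (rule permutes_inv[OF rank_permutes])
  have ok: "expo_ok N ?f" using h permutes_not_in[OF w] by (simp add: expo_ok_def)
  have bij: "bij_betw (inv (rank N h)) {1..N} {1..N}" by (rule permutes_imp_bij[OF w])
  show ?thesis
    unfolding plus_part_def
  proof (rule the_equality)
    show "(\<forall>i j. 1 \<le> i \<longrightarrow> i \<le> j \<longrightarrow> j \<le> N \<longrightarrow> ?f j \<le> ?f i) \<and> expo_ok N ?f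
      \<and> (\<exists>\<sigma>. bij_betw \<sigma> {1..N} {1..N} \<and> (\<forall>i\<in>{1..N}. ?f i = h (\<sigma> i)))"
      using antitone_rank[of h] ok bij unfolding antitone_def by auto
  next
    fix f assume f: "(\<forall>i j. 1 \<le> i \<longrightarrow> i \<le> j \<longrightarrow> j \<le> N \<longrightarrow> f j \<le> f i) \<and> expo_ok N f
      \<and> (\<exists>\<sigma>. bij_betw \<sigma> {1..N} {1..N} \<and> (\<forall>i\<in>{1..N}. f i = h (\<sigma> i)))"
    then obtain \<sigma> where \<sigma>: "bij_betw \<sigma> {1..N} {1..N}" "\<And>i. i \<in> {1..N} \<Longrightarrow> f i = h (\<sigma> i)" by blast
    show "f = ?f"
    proof (rule antitone_unique)
      show "antitone f" using f by (simp add: antitone_def)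
      show "card {i\<in>{1..N}. t < f i} = card {i\<in>{1..N}. t < ?f i}" for t
        using card_above_bij[of \<sigma> f h t] card_above_bij[of "inv (rank N h)" ?f h t] \<sigma> bij by simp
    qed (use f ok antitone_rank in auto)
  qed
qed

lemma finite_cube: "finite (cube m)"
proof (rule finite_subset)
  show "cube m \<subseteq> {f. \<forall>x. (x \<in> {1..N} \<longrightarrow> f x \<in> {0..1}) \<and> (x \<notin> {1..N} \<longrightarrow> f x = 0)}"
    by (auto simp: cube_def expo_ok_def)
qed (rule finite_set_of_finite_funs; simp)

lemma card_above_cube:
  assumes "h \<in> cube m"
  shows "card {i\<in>{1..N}. t < h i} = (if t = 0 then m else 0)"
proof -
  have le: "h i \<le> 1" for i using assms by (simp add: cube_def)
  show ?thesis
  proof (cases "t = 0")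
    case True
    have "m = (\<Sum>i\<in>{1..N}. h i)" using assms by (simp add: cube_def)
    also have "\<dots> = (\<Sum>i\<in>{i\<in>{1..N}. t < h i}. 1)"
      using True le by (intro sum.mono_neutral_cong_right) (auto simp: le_antisym Suc_le_eq)
    finally show ?thesis using True by simp
  next
    case False
    then have "{i\<in>{1..N}. t < h i} = {}" using le by (auto simp: not_less intro: order_trans[of _ 1])
    then show ?thesis using False by simp
  qed
qed

end

context top_block
begin

lemma plus_part_cube: "h \<in> cube m \<Longrightarrow> plus_part N h = \<alpha>"
proof -
  assume h: "h \<in> cube m"
  have w: "inv (rank N h) permutes {1..N}" by (rule permutes_inv[OF rank_permutes])
  have c: "h \<circ> inv (rank N h) \<in> cube m" using h cube_comp[OF w] by simp
  have "h \<circ> inv (rank N h) = \<alpha>"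
  proof (rule antitone_unique)
    show "antitone \<alpha>" by (auto simp: antitone_def block_def)
    show "card {i\<in>{1..N}. t < (h \<circ> inv (rank N h)) i} = card {i\<in>{1..N}. t < \<alpha> i}" for t
      using card_above_cube[OF c] card_above_cube[OF block_in_cube] by simp
  qed (use antitone_rank c block_in_cube in \<open>auto simp: cube_def\<close>)
  then show ?thesis using plus_part_eq[of h] h by (simp add: cube_def)
qed

text \<open>The largest part of \<open>h\<close> is bounded by that of \<open>\<alpha>\<close>,
  which is 1, so \<open>h\<close> is a 0/1 vector. Conversely, the first i entries of a 0/1 vector
  with m ones sum to at most min(i, m), the partial sum of \<open>\<alpha>\<close>.\<close>

lemma dom_lhd_block_iff:
  assumes ok: "expo_ok N h" and ne: "h \<noteq> \<alpha>"
  shows "dom_lhd N h \<alpha> \<longleftrightarrow> h \<in> cube m"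
proof
  assume d: "dom_lhd N h \<alpha>"
  let ?f = "h \<circ> inv (rank N h)"
  have N: "1 \<le> N" using size_bound m by simp
  have r: "rank N h permutes {1..N}" by (rule rank_permutes)
  have "?f 1 \<le> 1"
  proof (cases "plus_part N h = plus_part N \<alpha>")
    case True
    then show ?thesis using plus_part_eq[OF ok] plus_part_cube[OF block_in_cube] 
      by (metis block_def le_refl zero_le)
  next
    case False
    then have "dom_prec N ?f \<alpha>" using d plus_part_eq[OF ok] plus_part_cube[OF block_in_cube]
      by (simp add: dom_lhd_def)
    then have "(\<Sum>j\<in>{1..1}. ?f j) \<le> (\<Sum>j\<in>{1..1}. \<alpha> j)" using N unfolding dom_prec_def by (metis atLeastAtMost_iff le_refl)
    then show ?thesis using m by (simp add: block_def)
  qed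
  then have f1: "?f i \<le> 1" if "i \<in> {1..N}" for i
    using antitone_rank[of h] that unfolding antitone_def by (meson atLeastAtMost_iff le_refl le_trans)
  have "h i \<le> 1" for i
  proof (cases "i \<in> {1..N}")
    case True
    then show ?thesis using f1[of "rank N h i"] permutes_in_image[OF r] permutes_inverses(2)[OF r] by (metis comp_apply)
  next
    case False
    then show ?thesis using ok by (simp add: expo_ok_def)
  qed
  moreover have "(\<Sum>i\<in>{1..N}. h i) = m" using d block_in_cube by (simp add: dom_lhd_def cube_def)
  ultimately show "h \<in> cube m" using ok by (simp add: cube_def)
next
  assume h: "h \<in> cube m"
  have "(\<Sum>j\<in>{1..i}. h j) \<le> (\<Sum>j\<in>{1..i}. \<alpha> j)" if i: "i \<in> {1..N}" for i
  proof (cases "i \<le> m")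
    case True
    then show ?thesis using h by (intro sum_mono) (auto simp: cube_def block_def)
  next
    case False
    have "(\<Sum>j\<in>{1..i}. h j) \<le> (\<Sum>j\<in>{1..N}. h j)" using i by (intro sum_mono2) auto
    moreover have "(\<Sum>j\<in>{1..i}. \<alpha> j) = (\<Sum>j\<in>{1..m}. 1)"
      using False by (intro sum.mono_neutral_cong_right) (auto simp: block_def)
    ultimately show ?thesis using h by (simp add: cube_def)
  qed
  then show "dom_lhd N h \<alpha>"
    using plus_part_cube[OF h] plus_part_cube[OF block_in_cube] h block_in_cube ne
    by (simp add: dom_lhd_def dom_prec_def cube_def)
qed

text \<open>By \<open>dom_lhd_block_iff\<close> the triangularity clause says precisely that the
  exponents lie in \<open>cube m\<close>.\<close>

lemma is_jack_iff_jack: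
  fixes \<kappa> :: "'k::field_char_0"
  assumes T: "T \<in> RSYT \<tau>"
  shows "is_jack \<tau> \<kappa> \<alpha> T Z \<longleftrightarrow> jack m \<kappa> \<alpha> T Z"
proof
  assume J: "is_jack \<tau> \<kappa> \<alpha> T Z"
  have "mlin m Z"
    unfolding mlin_def
  proof (intro allI conjI impI)
    fix h
    show "supp (Z h)" using J by (auto simp: is_jack_def supp_def)
    assume h: "h \<notin> cube m"
    show "Z h = (\<lambda>S. 0)"
    proof (rule ccontr)
      assume "Z h \<noteq> (\<lambda>S. 0)"
      then have ex: "\<exists>S. Z h S \<noteq> 0" by auto
      have ne: "h \<noteq> \<alpha>" using h block_in_cube by auto
      have "expo_ok N h" "dom_lhd N h \<alpha>" using J ex ne unfolding is_jack_def by blast+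
      then show False using dom_lhd_block_iff ne h by blast
    qed
  qed
  then show "jack m \<kappa> \<alpha> T Z" using J by (simp add: jack_def eig_def is_jack_def)
next
  assume J: "jack m \<kappa> \<alpha> T Z"
  then have ml: "mlin m Z" by (rule jack_eig)
  have c: "h \<in> cube m" if "Z h S \<noteq> 0" for h S using mlin_outside[OF ml, of h] that by fastforce
  have "finite {h. \<exists>S. Z h S \<noteq> 0}" by (rule finite_subset[OF _ finite_cube[of m]]) (use c in auto)
  moreover have "\<forall>h S. Z h S \<noteq> 0 \<longrightarrow> expo_ok N h \<and> S \<in> RSYT \<tau>"
    using c mlin_supp[OF ml] unfolding cube_def supp_def by blast
  moreover have "\<forall>h. h \<noteq> \<alpha> \<longrightarrow> (\<exists>S. Z h S \<noteq> 0) \<longrightarrow> dom_lhd N h \<alpha>"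
    using c dom_lhd_block_iff unfolding cube_def by blast
  ultimately show "is_jack \<tau> \<kappa> \<alpha> T Z" using J by (simp add: jack_def eig_def is_jack_def)
qed

lemma zeta_eq:
  assumes T: "T \<in> RSYT \<tau>" and Z: "jack m kappa \<alpha> T Z"
  shows "zeta \<tau> \<alpha> T = Z"
  unfolding zeta_def is_jack_iff_jack[OF T]
proof (rule the_equality)
  fix Z' assume "jack m kappa \<alpha> T Z'"
  then show "Z' = Z" using jack_unique[OF _ Z generic_kappa T block_in_cube] by blast
qed (rule Z)

end

section \<open>Simple transpositions at equal exponents; vanishing on the tail\<close>

context shape
begin

lemma apply_s_basis: "T \<in> RSYT \<tau> \<Longrightarrow> apply_s \<tau> k (basis T) = tau_s \<tau> k T"
  by (simp add: apply_s_def basis_def if_distrib[of "\<lambda>x. x * _"] cong: if_cong)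

text \<open>Applying \<^term>\<open>eig_step\<close> at two positions of equal exponent produces an eigenfunction for
  the spectral vector of the swapped tableau.\<close>
lemma act_jack:
  fixes Z :: "expo \<Rightarrow> tableau \<Rightarrow> 'k::field_char_0"
  assumes Z: "jack m \<kappa> g T Z" and gen: "generic \<kappa>" and T: "T \<in> RSYT \<tau>" and g: "g \<in> cube m"
    and a: "1 \<le> a" "a < N" and ga: "g a = g (a + 1)" and r: "rank N g a = a" "rank N g (a + 1) = a + 1"
  shows "\<bar>bc a T\<bar> = 1 \<Longrightarrow> act (sw a (a + 1)) Z = (\<lambda>h S. Z h S / of_int (bc a T))"
    and "jack m \<kappa> g (swap_entries a T) Z' \<Longrightarrow> swap_entries a T \<in> RSYT \<tau> \<Longrightarrow>
      act (sw a (a + 1)) Z = (\<lambda>h S. Z h S / of_int (bc a T) + gc (- bc a T) * Z' h S)"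
proof -
  let ?s = "sw a (a + 1)" and ?r = "rank N g" and ?T = "swap_entries a T"
  let ?b = "of_int (bc a T) :: 'k"
  let ?F = "\<lambda>h S. act ?s Z h S + (- 1 / ?b) * Z h S"
  define d where "d i = content \<tau> (?s (?r i)) T" for i
  define \<xi> :: "nat \<Rightarrow> 'k" where "\<xi> = (\<lambda>i. of_nat (g i) + 1 + \<kappa> * of_int (content \<tau> (?r i) T))"
  have f: "fill T" using T by (rule RSYT_fill)
  have rp: "?r permutes {1..N}" and s: "?s permutes {1..N}"
    using rank_permutes simple_permutes[OF a] by auto
  have b: "?b \<noteq> 0" using bc_nonzero[OF T a] by simp
  have "\<xi> (a + 1) - \<xi> a = - \<kappa> * ?b"
    using ga r by (simp add: \<xi>_def bc_def algebra_simps)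
  then have "(- 1 / ?b) * (\<xi> (a + 1) - \<xi> a) = \<kappa>" using b by simp
  moreover have "eig m \<kappa> Z \<xi>" using Z by (simp add: jack_def \<xi>_def)
  ultimately have E: "eig m \<kappa> ?F (\<xi> \<circ> ?s)" using eig_step a by blast
  have rs: "?r (?s i) = ?s (?r i)" for i
    using r inj_eq[OF permutes_inj[OF rp], of i a] inj_eq[OF permutes_inj[OF rp], of i "a + 1"] by (simp add: sw_def)
  have gs: "g (?s i) = g i" for i using ga by (simp add: sw_def)
  have F: "eig m \<kappa> ?F (\<lambda>i. of_nat (g i) + 1 + \<kappa> * of_int (d i))"
  proof -
    have "\<xi> \<circ> ?s = (\<lambda>i. of_nat (g i) + 1 + \<kappa> * of_int (d i))"
      by (rule ext) (simp only: \<xi>_def comp_apply d_def rs gs)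
    then show ?thesis using E by (simp only:)
  qed
  have d: "content_range (d i)" if "i \<in> {1..N}" for i
    unfolding d_def using permutes_in_image[OF s] permutes_in_image[OF rp] that
    by (intro content_range_content T) blast
  note zero = eig_minimal[where d = d, OF _ gen d g]
  \<comment> \<open>As \<open>?r\<close> fixes a and a + 1, it commutes with s_a, and the leading
    coefficient of s_a Z is that of s_a T; subtracting Z / b leaves only the swapped
    tableau.\<close>
  have Fg: "?F g = (\<lambda>S. gc (- bc a T) * tau_perm \<tau> (inv ?r) (basis ?T) S)"
  proof -
    have "g \<circ> ?s = g" using gs by auto
    moreover have "?s \<circ> inv ?r = inv ?r \<circ> ?s"
    proof
      fix i
      have "?r (inv ?r (?s i)) = ?s (?r (inv ?r i))" using permutes_inverses(1)[OF rp] by simp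
      then have "?r (inv ?r (?s i)) = ?r (?s (inv ?r i))" by (simp only: rs)
      then have "inv ?r (?s i) = ?s (inv ?r i)" by (rule injD[OF permutes_inj[OF rp]])
      then show "(?s \<circ> inv ?r) i = (inv ?r \<circ> ?s) i" by simp
    qed
    ultimately have A: "act ?s Z g = tau_perm \<tau> (inv ?r) (apply_s \<tau> a (basis T))"
      using Z tau_perm_comp[OF s permutes_inv[OF rp] supp_basis[OF T, where 'a = 'k]]
        tau_perm_comp[OF permutes_inv[OF rp] s supp_basis[OF T, where 'a = 'k]]
        tau_perm_simple[OF a supp_basis[OF T, where 'a = 'k]] by (simp add: act_def jack_def)
    have B: "apply_s \<tau> a (basis T) = (\<lambda>S. (1 / ?b) * basis T S + gc (- bc a T) * basis ?T S)"
    proof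
      fix S
      have "?T \<noteq> T"
        using cell_of_fill[OF f, of a] a by (auto simp: swap_entries_def dest!: fun_cong[of _ _ "cell_of \<tau> a T"])
      then show "apply_s \<tau> a (basis T) S = (1 / ?b) * basis T S + gc (- bc a T) * basis ?T S"
        unfolding apply_s_basis[OF T] using tau_s_eq[OF T a, of S, where 'k = 'k] by (auto simp: basis_def)
    qed
    have "act ?s Z g = (\<lambda>S. (1 / ?b) * tau_perm \<tau> (inv ?r) (basis T) S + gc (- bc a T) * tau_perm \<tau> (inv ?r) (basis ?T) S)"
      unfolding A B by (rule tau_perm_lin)
    then show ?thesis using Z by (simp add: jack_def)
  qed
  have scaled: "act ?s Z h S = Z h S / ?b + ?F h S" for h S by simp
  show "act ?s Z = (\<lambda>h S. Z h S / ?b)" if "\<bar>bc a T\<bar> = 1"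
  proof -
    have "gc (- bc a T) = (0 :: 'k)"
      using that by (auto simp: gc_def)
    then have "?F g = (\<lambda>S. 0)" using Fg by simp
    then have "?F h = (\<lambda>S. 0)" for h using zero[OF F, of h] by blast
    then have "?F h S = 0" for h S by (rule fun_cong)
    then show ?thesis using scaled by (intro ext) (metis add.right_neutral)
  qed
  show "act ?s Z = (\<lambda>h S. Z h S / ?b + gc (- bc a T) * Z' h S)"
    if Z': "jack m \<kappa> g ?T Z'" and TR: "?T \<in> RSYT \<tau>"
  proof -
    let ?G = "\<lambda>h S. 1 * ?F h S + (- gc (- bc a T)) * Z' h S"
    have "content \<tau> (?r i) ?T = d i" if "i \<in> {1..N}" for i
      unfolding d_def using content_swap[OF f a, of "?r i"] permutes_in_image[OF rp] that by blast
    then have "eig m \<kappa> Z' (\<lambda>i. of_nat (g i) + 1 + \<kappa> * of_int (d i))"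
      using Z' by (simp add: jack_def eig_def)
    then have G: "eig m \<kappa> ?G (\<lambda>i. of_nat (g i) + 1 + \<kappa> * of_int (d i))" by (rule eig_lin[OF F])
    have "?G g = (\<lambda>S. 0)" using fun_cong[OF Fg] Z' by (simp add: jack_def)
    then have "?G h = (\<lambda>S. 0)" for h using zero[OF G, of h] by blast
    then have "?G h S = 0" for h S by (rule fun_cong)
    then have "?F h S = gc (- bc a T) * Z' h S" for h S by (simp add: algebra_simps)
    then show ?thesis using scaled by (intro ext) metis
  qed
qed

lemma om_scale: "om i (\<lambda>g S. c * F g S) = (\<lambda>g S. c * om i F g S)"
  using om_lin[of i c F 0 F] by simp

text \<open>The induction of \<open>jucys_murphy\<close>, lifted from tableaux to polynomials.
  \<open>act_jack\<close> expresses s_i Z through the Jack polynomials of T and of the swapped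
  tableau, so the hypothesis has to hold for all tableaux at once; the companion polynomial is
  supplied by \<open>jack_exists\<close>.\<close>

lemma om_jack:
  fixes \<kappa> :: real
  assumes gen: "generic \<kappa>" and g: "g \<in> cube m" and j: "1 \<le> j"
    and tail: "\<And>i. j \<le> i \<Longrightarrow> i \<le> N \<Longrightarrow> g i = 0" "\<And>i. j \<le> i \<Longrightarrow> i \<le> N \<Longrightarrow> rank N g i = i"
  shows "i \<le> N \<Longrightarrow> j \<le> i \<Longrightarrow> T \<in> RSYT \<tau> \<Longrightarrow> jack m \<kappa> g T Z \<Longrightarrow>
    om i Z = (\<lambda>h S. of_int (content \<tau> i T) * Z h S)"
proof (induction i arbitrary: T Z rule: inc_induct)
  case base
  then show ?case using content_top[of T] j by (simp add: om_def)
next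
  case (step i)
  let ?s = "sw i (i + 1)"
  have i: "1 \<le> i" "i < N" using step j by auto
  note T = step.prems(2) and Z = step.prems(3)
  have f: "fill T" using T by (rule RSYT_fill)
  have IH: "om (i + 1) Y = (\<lambda>h S. of_int (content \<tau> (i + 1) T') * Y h S)" 
    if "T' \<in> RSYT \<tau>" "jack m \<kappa> g T' Y" for T' Y
    using step.IH[of T' Y] that step.prems by simp
  have Zs: "supp (Z h)" for h using mlin_supp[OF jack_eig[OF Z]] .
  let ?b = "real_of_int (bc i T)" and ?c = "real_of_int (content \<tau> (i + 1) T)"
  have b: "?b \<noteq> 0" using bc_nonzero[OF T i] by simp
  have ci: "content \<tau> i T = content \<tau> (i + 1) T + bc i T" by (simp add: bc_def)
  have r: "g i = g (i + 1)" "rank N g i = i" "rank N g (i + 1) = i + 1"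
    using tail[of i] tail[of "i + 1"] i step.prems by auto
  note AJ = act_jack[OF Z gen T g i r]
  \<comment> \<open>In s_i Z the component Z / b has eigenvalue c and the remaining one c + b; the
    deficit b on Z / b is the term - Z.\<close>
  have "om (i + 1) (act ?s Z) = (\<lambda>h S. (?c + ?b) * act ?s Z h S - Z h S)"
  proof (cases "swap_entries i T \<in> RSYT \<tau>")
    case True
    obtain Y where Y: "jack m \<kappa> g (swap_entries i T) Y" using jack_exists[OF gen True g] by blast
    have A: "act ?s Z = (\<lambda>h S. (1 / ?b) * Z h S + gc (- bc i T) * Y h S)" using AJ(2)[OF Y True] by simp
    have c: "content \<tau> (i + 1) (swap_entries i T) = content \<tau> i T"
      using content_swap[OF f i, of "i + 1"] i by (simp add: sw_def)
    show ?thesis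
      unfolding A om_lin IH[OF T Z] IH[OF True Y] c ci using b by (simp add: fun_eq_iff field_simps)
  next
    case False
    have "\<bar>bc i T\<bar> = 1" by (rule bc_cases[OF T i]) (use False in auto)
    then have A: "act ?s Z = (\<lambda>h S. (1 / ?b) * Z h S)" using AJ(1) by simp
    show ?thesis
      unfolding A om_scale IH[OF T Z] using b by (simp add: fun_eq_iff field_simps)
  qed
  \<comment> \<open>\<open>om_act_left\<close> is used for s_i Z, so that the left side becomes om_i
    Z.\<close>
  then have "om i (act ?s (act ?s Z)) = (\<lambda>h S. act ?s Z h S + act ?s (\<lambda>h S. (?c + ?b) * act ?s Z h S - Z h S) h S)"
    using om_act_left[OF i, of "act ?s Z"] act_supp[OF simple_permutes[OF i], of Z] Zs by simp
  moreover have sq: "act ?s (act ?s Z) = Z" using act_square[of i "i + 1" Z] i Zs by simp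
  moreover have "act ?s (\<lambda>h S. (?c + ?b) * act ?s Z h S - Z h S) = (\<lambda>h S. (?c + ?b) * Z h S - act ?s Z h S)"
    using act_lin[of ?s "?c + ?b" "act ?s Z" "-1" Z] sq by simp
  ultimately show ?case by (simp add: ci)
qed

text \<open>U_i and 1 + \<open>\<kappa>\<close> om_i have the same eigenvalue on Z, which leaves x_i
  D_i Z = 0.\<close>

lemma dunkl_jack_tail:
  fixes \<kappa> :: real
  assumes gen: "generic \<kappa>" and g: "g \<in> cube m" and j: "1 \<le> j"
    and tail: "\<And>i. j \<le> i \<Longrightarrow> i \<le> N \<Longrightarrow> g i = 0" "\<And>i. j \<le> i \<Longrightarrow> i \<le> N \<Longrightarrow> rank N g i = i"
    and T: "T \<in> RSYT \<tau>" and Z: "jack m \<kappa> g T Z" and i: "j \<le> i" "i \<le> N"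
  shows "dunkl \<tau> \<kappa> i Z = (\<lambda>h S. 0)"
proof -
  have i': "i \<in> {1..N}" using i j by auto
  have "om i Z = (\<lambda>h S. of_int (content \<tau> i T) * Z h S)"
    by (rule om_jack[OF gen g j tail i(2,1) T Z])
  moreover have "ucal \<tau> \<kappa> i Z = (\<lambda>h S. (1 + \<kappa> * of_int (content \<tau> i T)) * Z h S)"
    using Z i' tail[OF i] by (simp add: jack_def eig_def)
  ultimately have "mulx i (dunkl \<tau> \<kappa> i Z) h S = 0" for h S
    using ucal_mlin[OF jack_eig[OF Z] i', of \<kappa>] by (simp add: fun_eq_iff algebra_simps)
  then have "mulx i (dunkl \<tau> \<kappa> i Z) = mulx i (\<lambda>h S. 0)" by (simp add: fun_eq_iff mulx_def)
  then show ?thesis by (rule mulx_inj)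
qed

end

section \<open>The singular value and the chain of moved exponents\<close>

context top_block
begin

definition singular_value :: real ("\<kappa>\<^sub>0") where
  "\<kappa>\<^sub>0 = - 1 / real_of_int (hook \<tau> 1 1)"

lemma hook_corner: "hook \<tau> 1 1 = int (part \<tau> 1) + int (length \<tau>) - 1"
proof -
  have "{k. 1 < k \<and> k \<le> length \<tau> \<and> 1 \<le> part \<tau> k} = {2..length \<tau>}" using part_pos by auto
  then show ?thesis using m by (simp add: hook_def)
qed

lemma hook_pos: "0 < hook \<tau> 1 1"
  using hook_corner two_columns m by simp

lemma generic_singular: "generic \<kappa>\<^sub>0"
  unfolding generic_def
proof (intro allI impI notI)
  fix n :: int
  assume n: "\<bar>n\<bar> \<le> int (part \<tau> 1) + int (length \<tau>) - 2" and "1 + \<kappa>\<^sub>0 * of_int n = 0"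
  then have "real_of_int (hook \<tau> 1 1) = of_int n" using hook_pos by (simp add: singular_value_def field_simps)
  then show False using n hook_corner by linarith
qed

lemma content_corner: "content \<tau> m (T0 \<tau>) = int (part \<tau> 1) - 1"
  using cell_of_T0_last[of m] m by (simp add: content_def row_def col_def)

lemma content_foot: "content \<tau> (N - length \<tau> + 1) (T0 \<tau>) = 1 - int (length \<tau>)"
proof -
  have "N - length \<tau> + 1 = N + 1 - length \<tau>" using size_bound by simp
  then show ?thesis using cell_of_T0_first by (simp add: content_def row_def col_def)
qed

text \<open>The eigenfunctions with leading exponent \<open>moved k\<close>, for \<open>k\<close> from \<open>N\<close> down to \<open>m\<close>, form a chain that ends
  in the specialized polynomial. The coefficient of the step to \<open>k = N - length \<tau>\<close> is \<open>-1\<close> at the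
  singular value; this kills the Dunkl operator there, and the steps below preserve the vanishing.\<close>
definition moved :: "nat \<Rightarrow> expo" where
  "moved k = (\<lambda>i. if 1 \<le> i \<and> i < m \<or> i = k then 1 else 0)"

lemma moved_start: "moved m = \<alpha>"
  using m by (auto simp: moved_def block_def fun_eq_iff)

lemma moved_step: "m \<le> k \<Longrightarrow> moved k \<circ> sw k (k + 1) = moved (k + 1)"
  "m \<le> k \<Longrightarrow> moved (k + 1) \<circ> sw k (k + 1) = moved k"
  by (auto simp: moved_def sw_def fun_eq_iff)

text \<open>The moved one is the last of the m ones, hence of rank m, and the zeros behind it keep
  their places.\<close>

lemma moved_props:
  assumes "m \<le> k" "k \<le> N"
  shows "moved k \<in> cube m \<and> rank N (moved k) k = m \<and> (\<forall>i>k. rank N (moved k) i = i)"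
  using assms
proof (induction k rule: dec_induct)
  case base
  then show ?case using block_in_cube rank_block by (simp add: moved_start)
next
  case (step k)
  have k: "1 \<le> k" "k < N" using m step by auto
  have r: "rank N (moved (k + 1)) = rank N (moved k) \<circ> sw k (k + 1)"
    using rank_swap[OF k, of "moved k"] moved_step(1)[of k] m step by (simp add: moved_def)
  have "moved (k + 1) \<in> cube m" using cube_comp_simple[OF k, of "moved k" m] moved_step(1)[of k] step by simp
  then show ?case using step.IH step.prems r by (simp add: sw_def)
qed

text \<open>Position k holds a zero; before it in rank are all m ones and the zeros at positions m
  to k - 1, which are k - m in number.\<close>

lemma rank_moved_pred:
  assumes "m \<le> k" "k < N"
  shows "rank N (moved (k + 1)) k = k + 1"
proof -
  have k: "1 \<le> k" using m assms by auto
  have "rank N (moved (k + 1)) = rank N (moved k) \<circ> sw k (k + 1)"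
    using rank_swap[OF k assms(2), of "moved k"] moved_step(1)[of k] m assms by (simp add: moved_def)
  then show ?thesis using moved_props[of k] assms by (simp add: sw_def)
qed

lemma dunkl_moved_tail:
  assumes "m \<le> k" "k \<le> N" "jack m \<kappa>\<^sub>0 (moved k) (T0 \<tau>) Z" "k < i" "i \<le> N"
  shows "dunkl \<tau> \<kappa>\<^sub>0 i Z = (\<lambda>h S. 0)"
  using moved_props[OF assms(1,2)] assms m
  by (intro dunkl_jack_tail[OF generic_singular, of "moved k" m "k + 1" "T0 \<tau>"] T0_RSYT) (auto simp: moved_def)

text \<open>Let Z = s Y + b Y with Y belonging to \<open>moved (k + 1)\<close>. Then s Z - b Z = (1
  - b^2) Y, and D_k s Z = s D_(k+1) Z = 0 because k + 1 lies in the tail of \<open>moved k\<close>.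
  So - b D_k Z = (1 - b^2) D_k Y, which settles b^2 = 1. If D_(k+1) Y = 0, then also D_k s Y = 0 and
  D_k Z = b D_k Y; eliminating D_k Y gives (1 - b^2) D_k Z = - b^2 D_k Z.\<close>

lemma dunkl_moved_step:
  assumes k: "m \<le> k" "k < N" and Z: "jack m \<kappa>\<^sub>0 (moved k) (T0 \<tau>) Z"
    and alt: "(\<forall>Y. jack m \<kappa>\<^sub>0 (moved (k + 1)) (T0 \<tau>) Y \<longrightarrow> dunkl \<tau> \<kappa>\<^sub>0 (k + 1) Y = (\<lambda>h S. 0))
      \<or> (jack_coeff \<kappa>\<^sub>0 (moved (k + 1)) (T0 \<tau>) k)\<^sup>2 = 1"
  shows "dunkl \<tau> \<kappa>\<^sub>0 k Z = (\<lambda>h S. 0)"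
proof -
  let ?s = "sw k (k + 1)" and ?D = "dunkl \<tau> \<kappa>\<^sub>0"
  define b where "b = jack_coeff \<kappa>\<^sub>0 (moved (k + 1)) (T0 \<tau>) k"
  have k1: "1 \<le> k" using k m by auto
  have i: "k \<in> {1..N}" "k + 1 \<in> {1..N}" using k k1 by auto
  have gc: "moved (k + 1) \<in> cube m" using moved_props[of "k + 1"] k by simp
  have gc': "moved k \<in> cube m" using moved_props[of k] k by simp
  obtain Y where Y: "jack m \<kappa>\<^sub>0 (moved (k + 1)) (T0 \<tau>) Y"
    using jack_exists[OF generic_singular T0_RSYT gc] by blast
  have "moved (k + 1) k = 0" "moved (k + 1) (k + 1) = 1" using k by (auto simp: moved_def)
  from jack_step[OF Y generic_singular T0_RSYT gc k1 k(2) this]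
  have "jack m \<kappa>\<^sub>0 (moved k) (T0 \<tau>) (\<lambda>h S. act ?s Y h S + b * Y h S)"
    unfolding moved_step(2)[OF k(1)] b_def .
  from jack_unique[OF Z this generic_singular T0_RSYT gc']
  have ZY: "Z = (\<lambda>h S. 1 * act ?s Y h S + b * Y h S)" by simp
  have mY: "mlin m Y" and mZ: "mlin m Z" using jack_eig Y Z by blast+
  have msY: "mlin m (act ?s Y)" and msZ: "mlin m (act ?s Z)"
    using mlin_act[OF simple_permutes[OF k1 k(2)]] mY mZ by blast+
  have s: "?s (k + 1) = k" by (simp add: sw_def)
  have Ds: "?D k (act ?s F) = act ?s (?D (k + 1) F)" if "mlin m F" for F
    using dunkl_act[OF simple_permutes[OF k1 k(2)] that i(2), of \<kappa>\<^sub>0] unfolding s .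
  have "?D (k + 1) Z = (\<lambda>h S. 0)" using dunkl_moved_tail[OF k(1) _ Z, of "k + 1"] k by simp
  then have DsZ: "?D k (act ?s Z) = (\<lambda>h S. 0)" using Ds[OF mZ] by (simp add: act_def)
  have sq: "act ?s (act ?s Y) = Y" using act_square[of k "k + 1" Y] i mlin_supp[OF mY] by blast
  have sZ: "act ?s Z = (\<lambda>h S. 1 * Y h S + b * act ?s Y h S)"
    unfolding ZY act_lin sq ..
  have "(\<lambda>h S. 1 * act ?s Z h S + (- b) * Z h S) = (\<lambda>h S. (1 - b\<^sup>2) * Y h S + 0 * Y h S)"
    unfolding sZ by (subst ZY) (simp add: algebra_simps power2_eq_square)
  then have "?D k (\<lambda>h S. 1 * act ?s Z h S + (- b) * Z h S) = ?D k (\<lambda>h S. (1 - b\<^sup>2) * Y h S + 0 * Y h S)"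
    by simp
  then have rel: "- b * ?D k Z h S = (1 - b\<^sup>2) * ?D k Y h S" for h S
    unfolding dunkl_lin[OF msZ mZ] dunkl_lin[OF mY mY] DsZ by (simp add: fun_eq_iff)
  show ?thesis
  proof (intro ext)
    fix h S
    from alt show "?D k Z h S = 0"
    proof
      assume "\<forall>Y. jack m \<kappa>\<^sub>0 (moved (k + 1)) (T0 \<tau>) Y \<longrightarrow> ?D (k + 1) Y = (\<lambda>h S. 0)"
      then have "?D (k + 1) Y = (\<lambda>h S. 0)" using Y by blast
      then have "?D k (act ?s Y) = (\<lambda>h S. 0)" using Ds[OF mY] by (simp add: act_def)
      moreover have "?D k Z = (\<lambda>h S. 1 * ?D k (act ?s Y) h S + b * ?D k Y h S)"
        by (subst ZY) (rule dunkl_lin[OF msY mY])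
      ultimately have x: "?D k Z h S = b * ?D k Y h S" by simp
      have "(1 - b\<^sup>2) * ?D k Z h S = b * ((1 - b\<^sup>2) * ?D k Y h S)" unfolding x by simp
      also have "\<dots> = - b\<^sup>2 * ?D k Z h S" unfolding rel[symmetric] by (simp add: power2_eq_square)
      finally show ?thesis by (simp add: algebra_simps)
    next
      assume "(jack_coeff \<kappa>\<^sub>0 (moved (k + 1)) (T0 \<tau>) k)\<^sup>2 = 1"
      then have "b\<^sup>2 = 1" by (simp add: b_def)
      then show ?thesis using rel[of h S] by auto
    qed
  qed
qed

text \<open>The ends of the arm and the leg of the corner hook have contents differing by h - 1, the
  extreme value, and (-1/h) / (1 - (h - 1)/h) = -1. They are met here because \<open>T0\<close> puts
  m at the end of the first row and N - l + 1 at the foot of the first column.\<close>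

lemma jack_coeff_critical: "jack_coeff \<kappa>\<^sub>0 (moved (N - length \<tau> + 1)) (T0 \<tau>) (N - length \<tau>) = - 1"
proof -
  let ?k = "N - length \<tau>"
  have k: "m \<le> ?k" "?k < N" using size_bound m by auto
  have "rank N (moved (?k + 1)) (?k + 1) = m" using moved_props[of "?k + 1"] k by simp
  moreover have "rank N (moved (?k + 1)) ?k = ?k + 1" by (rule rank_moved_pred[OF k])
  moreover have "content \<tau> m (T0 \<tau>) - content \<tau> (?k + 1) (T0 \<tau>) = hook \<tau> 1 1 - 1"
    unfolding content_corner content_foot hook_corner by simp
  ultimately have "jack_coeff \<kappa>\<^sub>0 (moved (?k + 1)) (T0 \<tau>) ?k = \<kappa>\<^sub>0 / (1 + \<kappa>\<^sub>0 * of_int (hook \<tau> 1 1 - 1))"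
    unfolding jack_coeff_def by (simp only:)
  then show ?thesis using hook_pos by (simp add: singular_value_def field_simps)
qed

lemma dunkl_moved:
  assumes "k \<le> N - length \<tau>" "m \<le> k" "jack m \<kappa>\<^sub>0 (moved k) (T0 \<tau>) Z"
  shows "dunkl \<tau> \<kappa>\<^sub>0 k Z = (\<lambda>h S. 0)"
  using assms
proof (induction k arbitrary: Z rule: inc_induct)
  case base
  have "N - length \<tau> < N" using size_bound m by auto
  then show ?case using base jack_coeff_critical by (intro dunkl_moved_step) auto
next
  case (step k)
  have "dunkl \<tau> \<kappa>\<^sub>0 (k + 1) Y = (\<lambda>h S. 0)" if "jack m \<kappa>\<^sub>0 (moved (k + 1)) (T0 \<tau>) Y" for Y
    using step.IH[of Y] step.prems that by simp
  then show ?case using step by (intro dunkl_moved_step) auto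
qed

lemma dunkl_block:
  assumes Z: "jack m \<kappa>\<^sub>0 \<alpha> (T0 \<tau>) Z" and i: "i \<in> {1..N}"
  shows "dunkl \<tau> \<kappa>\<^sub>0 i Z = (\<lambda>h S. 0)"
proof (cases "m < i")
  case True
  then show ?thesis using dunkl_moved_tail[of m Z i] Z i size_bound by (simp add: moved_start)
next
  case False
  then have "i \<le> m" by simp
  then show ?thesis using i
  proof (induction i rule: inc_induct)
    case base
    show ?case using dunkl_moved[of m Z] Z size_bound by (simp add: moved_start)
  next
    case (step i)
    let ?s = "sw i (i + 1)" and ?D = "dunkl \<tau> \<kappa>\<^sub>0"
    have a: "1 \<le> i" "i < N" using step size_bound by auto
    \<comment> \<open>Both i and i + 1 are at most m, hence vertical neighbours in the last column
      of \<open>T0\<close>; so s_i Z = - Z, and D_i Z is minus s_i applied to D_(i+1) Z.\<close>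
    have bc: "bc i (T0 \<tau>) = - 1"
      using cell_of_T0_last[of i] cell_of_T0_last[of "i + 1"] step a
      by (simp add: bc_def content_def row_def col_def)
    have "act ?s Z = (\<lambda>h S. Z h S / of_int (bc i (T0 \<tau>)))"
      by (rule act_jack(1)[OF Z generic_singular T0_RSYT block_in_cube a])
        (use step a in \<open>simp_all add: rank_block bc, simp add: block_def\<close>)
    then have sZ: "act ?s Z = (\<lambda>h S. (- 1) * Z h S + 0 * Z h S)" by (simp add: bc)
    have mZ: "mlin m Z" by (rule jack_eig[OF Z])
    have s: "?s (i + 1) = i" by (simp add: sw_def)
    have i1: "i + 1 \<in> {1..N}" using a by auto
    have D0: "?D (i + 1) Z = (\<lambda>h S. 0)" using step.IH i1 by simp
    have "?D i (act ?s Z) = act ?s (?D (i + 1) Z)"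
      using dunkl_act[OF simple_permutes[OF a] mZ i1, of \<kappa>\<^sub>0] unfolding s .
    then have "?D i (act ?s Z) = (\<lambda>h S. 0)" unfolding D0 by (simp add: act_def)
    then show ?case unfolding sZ dunkl_lin[OF mZ mZ] by (simp add: fun_eq_iff)
  qed
qed

end

theorem theorem7p7:
  fixes \<tau> :: "nat list" and N m :: nat
  assumes "is_partition \<tau> N"
    and "2 \<le> part \<tau> 1"
    and "1 \<le> m" and "m \<le> length \<tau>"
    and "\<forall>i\<in>{1..m}. part \<tau> i = part \<tau> 1"
    and "part \<tau> (m + 1) < part \<tau> 1"
  shows "(\<forall>\<gamma> S. no_pole (- 1 / real_of_int (hook \<tau> 1 1))
              (zeta \<tau> (\<lambda>i. if 1 \<le> i \<and> i \<le> m then 1 else 0) (T0 \<tau>) \<gamma> S))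
       \<and> (\<forall>i\<in>{1..N}. dunkl \<tau> (- 1 / real_of_int (hook \<tau> 1 1)) i
              (\<lambda>\<gamma> S. eval_at (- 1 / real_of_int (hook \<tau> 1 1))
                 (zeta \<tau> (\<lambda>i. if 1 \<le> i \<and> i \<le> m then 1 else 0) (T0 \<tau>) \<gamma> S))
            = (\<lambda>\<gamma> S. 0))"
proof -
  have N: "sum_list \<tau> = N" using assms(1) by (simp add: is_partition_def)
  interpret top_block \<tau> m
  proof
    show "is_partition \<tau> (sum_list \<tau>)" using assms(1) N by simp
    show "part \<tau> i = part \<tau> 1" if "1 \<le> i" "i \<le> m" for i using assms(5) that by (meson atLeastAtMost_iff)
  qed (rule assms)+
  \<comment> \<open>\<open>Z'\<close> is both the Jack polynomial at \<open>\<kappa>\<^sub>0\<close>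
    and the specialization of \<open>Z\<close>, so what \<open>dunkl_block\<close> proves for it is
    a statement about the specialized \<open>zeta\<close>.\<close>
  obtain Z Z' where Z: "jack m kappa \<alpha> (T0 \<tau>) Z" and Z': "jack m \<kappa>\<^sub>0 \<alpha> (T0 \<tau>) Z'"
    and spec: "\<And>h S. specializes \<kappa>\<^sub>0 (Z h S) (Z' h S)"
    using jack_exists[OF generic_singular T0_RSYT block_in_cube] by blast
  have zeta: "zeta \<tau> \<alpha> (T0 \<tau>) = Z" by (rule zeta_eq[OF T0_RSYT Z])
  have "(\<lambda>h S. eval_at \<kappa>\<^sub>0 (Z h S)) = Z'" using specializes_eval_at[OF spec] by simp
  then have "(\<forall>h S. no_pole \<kappa>\<^sub>0 (zeta \<tau> \<alpha> (T0 \<tau>) h S))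
    \<and> (\<forall>i\<in>{1..N}. dunkl \<tau> \<kappa>\<^sub>0 i (\<lambda>h S. eval_at \<kappa>\<^sub>0 (zeta \<tau> \<alpha> (T0 \<tau>) h S)) = (\<lambda>h S. 0))"
    unfolding zeta using specializes_no_pole[OF spec] dunkl_block[OF Z'] N by simp
  then show ?thesis unfolding singular_value_def block_def .
qed

end
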